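(* Let $\alpha,\beta\in\mathbb{R}$ be such that neither is a negative integer and $\alpha+\beta>-1$. Let $p\ge1$, let $f\in L^{p}(\mathbb{T})$ be complex-valued, and let $u=P_{\alpha,\beta}[f]$ on $\mathbb{D}$. For $r\in(0,1)$ put $$J(r)=\int_0^{2\pi}|1+re^{-is}|^{\alpha+\beta}ds,\quad J_c(r)=\int_0^{2\pi}|\cos s||1+re^{-is}|^{\alpha+\beta}ds,\quad J_s(r)=\int_0^{2\pi}|\sin s||1+re^{-is}|^{\alpha+\beta}ds,$$ and define the functions $$A_{\alpha,\beta}(r)=|c_{\alpha,\beta}|\left(\frac{|\alpha+\beta|r}{2\pi}J(r)+\frac{\alpha+\beta+2}{2\pi}J_c(r)+\frac{|\alpha-\beta|}{2\pi}J_s(r)\right),$$ $$B_{\alpha,\beta}(r)=|c_{\alpha,\beta}|\left(\frac{|\beta-\alpha|r}{2\pi}J(r)+\frac{\alpha+\beta+2}{2\pi}J_s(r)+\frac{|\beta-\alpha|}{2\pi}J_c(r)\right),$$ $$C_{\alpha,\beta}(r)=\frac{|c_{\alpha,\beta}|(|\alpha+1|+|\beta|r)}{2\pi}J(r),$$ and the constants $$A_{\alpha,\beta}=\sup_{r\in(0,1)}A_{\alpha,\beta}(r)=\begin{cases}|c_{\alpha,\beta}|\left(\frac{\alpha+\beta+2+|\alpha-\beta|}{\pi}2^{\frac{\alpha+\beta}{2}-1}\int_0^{2\pi}|\cos s|(1+\cos s)^{\frac{\alpha+\beta}{2}}ds+|\alpha+\beta|\frac{\Gamma(\alpha+\beta+1)}{\Gamma^2(\frac{\alpha+\beta+2}{2})}\right),&\alpha+\beta\ge2;\\[2mm]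 |c_{\alpha,\beta}|\left(\frac{\alpha+\beta+2+|\alpha-\beta|}{\pi}2^{\frac{\alpha+\beta}{2}-1}\int_0^{2\pi}|\sin s|(1+\cos s)^{\frac{\alpha+\beta}{2}}ds+|\alpha+\beta|\frac{\Gamma(\alpha+\beta+1)}{\Gamma^2(\frac{\alpha+\beta+2}{2})}\right),&-1<\alpha+\beta<2,\end{cases}$$ $$B_{\alpha,\beta}=\sup_{r\in(0,1)}B_{\alpha,\beta}(r)=\begin{cases}|c_{\alpha,\beta}|\left(\frac{\alpha+\beta+2+|\beta-\alpha|}{\pi}2^{\frac{\alpha+\beta}{2}-1}\int_0^{2\pi}|\cos s|(1+\cos s)^{\frac{\alpha+\beta}{2}}ds+|\beta-\alpha|\frac{\Gamma(\alpha+\beta+1)}{\Gamma^2(\frac{\alpha+\beta+2}{2})}\right),&\alpha+\beta\ge2;\\[2mm] |c_{\alpha,\beta}|\left(\frac{\alpha+\beta+2+|\beta-\alpha|}{\pi}2^{\frac{\alpha+\beta}{2}-1}\int_0^{2\pi}|\sin s|(1+\cos s)^{\frac{\alpha+\beta}{2}}ds+|\beta-\alpha|\frac{\Gamma(\alpha+\beta+1)}{\Gamma^2(\frac{\alpha+\beta+2}{2})}\right),&-1<\alpha+\beta<2,\end{cases}$$ $$C_{\alpha,\beta}=\sup_{r\in(0,1)}C_{\alpha,\beta}(r)=|c_{\alpha,\beta}|(|\alpha+1|+|\beta|)\frac{\Gamma(\alpha+\beta+1)}{\Gamma^{2}(\frac{\alpha+\beta+2}{2})}.$$ Then, for $z=re^{i\theta}\in\mathbb{D}$: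 (1) $\displaystyle M_p(r,u_r)\le\frac{A_{\alpha,\beta}(r)}{1-r^2}\|f\|_{L^p(\mathbb{T})}\le\frac{A_{\alpha,\beta}}{1-r^2}\|f\|_{L^p(\mathbb{T})}$, and the constant $A_{\alpha,\beta}$ is asymptotically sharp as $\alpha,\beta\to0$. (2) $\displaystyle M_p(r,u_\theta)\le\frac{B_{\alpha,\beta}(r)}{1-r^2}\|f\|_{L^p(\mathbb{T})}\le\frac{B_{\alpha,\beta}}{1-r^2}\|f\|_{L^p(\mathbb{T})}$, and the constant $B_{\alpha,\beta}$ is asymptotically sharp as $\alpha,\beta\to0$. (3) $\displaystyle M_p(r,u_z)\le\frac{C_{\alpha,\beta}(r)}{1-r^2}\|f\|_{L^p(\mathbb{T})}\le\frac{C_{\alpha,\beta}}{1-r^2}\|f\|_{L^p(\mathbb{T})}$, and the constant $C_{\alpha,\beta}$ is asymptotically sharp as $\alpha,\beta\to0$.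
   Context: $\mathbb{D}$ is the open unit disk and $\mathbb{T}$ the unit circle. $c_{\alpha,\beta}=\frac{\Gamma(\alpha+1)\Gamma(\beta+1)}{\Gamma(\alpha+\beta+1)}$. The $(\alpha,\beta)$-Poisson integral of $f\in L^1(\mathbb{T})$ is $$P_{\alpha,\beta}[f](z)=\frac1{2\pi}\int_0^{2\pi}P_{\alpha,\beta}(ze^{-it})f(e^{it})\,dt,\qquad P_{\alpha,\beta}(z)=c_{\alpha,\beta}\frac{(1-|z|^2)^{\alpha+\beta+1}}{(1-z)^{\alpha+1}(1-\overline z)^{\beta+1}}.$$ $\|f\|_{L^p(\mathbb{T})}=\big(\frac1{2\pi}\int_0^{2\pi}|f(e^{i\theta})|^pd\theta\big)^{1/p}$ for $p<\infty$, and the essential supremum for $p=\infty$; $M_p(r,v)=\big(\frac1{2\pi}\int_0^{2\pi}|v(re^{i\theta})|^pd\theta\big)^{1/p}$ for $p<\infty$ and $M_\infty(r,v)=\operatorname{ess\,sup}_\theta|v(re^{i\theta})|$. $u_r,u_\theta$ denote the partial derivatives of $u(re^{i\theta})$ with respect to the polar coordinates $r,\theta$, and $u_z$ the Wirtinger derivative. A constant is "asymptotically sharp as $\alpha,\beta\to0$" if for $\alpha=\beta=0$ it cannot be replaced by a smaller constant in the inequality.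
   Formalization: The closed forms of A_{α,β}, B_{α,β} fail in general (e.g. A at α=β=1/2, B at α=β=−1/4), so these constants are the suprema; the closed forms are asserted as equalities or upper bounds only where true. Sharpness of A, B is over all p in [1,∞] jointly, as it fails for p=2. *)

theory Defs
  imports "HOL-Analysis.Analysis" "HOL-Probability.Essential_Supremum"
begin

text \<open>
  Functions on the unit circle are parametrised by the angle in \<open>[0, 2\<pi>]\<close>; exponents range over
  \<open>[1, \<infinity>]\<close>. Norms are extended nonnegative reals, so that no value is assigned by convention to a
  divergent integral.
\<close>

definition circle_norm :: "ennreal \<Rightarrow> (real \<Rightarrow> complex) \<Rightarrow> ennreal" where
  "circle_norm p g =
     (if p = \<infinity> then esssup (lebesgue_on {0..2*pi}) (\<lambda>t. ennreal (cmod (g t)))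
      else let I = (\<integral>\<^sup>+ t. ennreal (cmod (g t) powr enn2real p) \<partial>lebesgue_on {0..2*pi})
           in if I = \<infinity> then \<infinity> else ennreal ((enn2real I / (2*pi)) powr (1 / enn2real p)))"

definition Lp_norm :: "ennreal \<Rightarrow> (complex \<Rightarrow> complex) \<Rightarrow> ennreal" where
  "Lp_norm p f = circle_norm p (\<lambda>t. f (cis t))"

definition Lp_circle :: "ennreal \<Rightarrow> (complex \<Rightarrow> complex) set" where
  "Lp_circle p = {f. (\<lambda>t. f (cis t)) \<in> borel_measurable (lebesgue_on {0..2*pi}) \<and> Lp_norm p f < \<infinity>}"

text \<open>The integral mean \<open>M\<^sub>p(r,v)\<close> of a function \<open>v\<close> of the polar coordinates.\<close>

definition integral_mean :: "ennreal \<Rightarrow> real \<Rightarrow> (real \<Rightarrow> real \<Rightarrow> complex) \<Rightarrow> ennreal" where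
  "integral_mean p r v = circle_norm p (\<lambda>\<theta>. v r \<theta>)"

definition d_radial :: "(complex \<Rightarrow> complex) \<Rightarrow> real \<Rightarrow> real \<Rightarrow> complex" where
  "d_radial u r \<theta> = vector_derivative (\<lambda>\<rho>. u (of_real \<rho> * cis \<theta>)) (at r)"

definition d_angular :: "(complex \<Rightarrow> complex) \<Rightarrow> real \<Rightarrow> real \<Rightarrow> complex" where
  "d_angular u r \<theta> = vector_derivative (\<lambda>\<phi>. u (of_real r * cis \<phi>)) (at \<theta>)"

definition wirtinger :: "(complex \<Rightarrow> complex) \<Rightarrow> complex \<Rightarrow> complex" where
  "wirtinger u z =
     (vector_derivative (\<lambda>x. u (Complex x (Im z))) (at (Re z))
      - \<i> * vector_derivative (\<lambda>y. u (Complex (Re z) y)) (at (Im z))) / 2"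

definition d_wirtinger :: "(complex \<Rightarrow> complex) \<Rightarrow> real \<Rightarrow> real \<Rightarrow> complex" where
  "d_wirtinger u r \<theta> = wirtinger u (of_real r * cis \<theta>)"

definition c_coeff :: "real \<Rightarrow> real \<Rightarrow> real" where
  "c_coeff \<alpha> \<beta> = Gamma (\<alpha> + 1) * Gamma (\<beta> + 1) / Gamma (\<alpha> + \<beta> + 1)"

definition poisson_kernel :: "real \<Rightarrow> real \<Rightarrow> complex \<Rightarrow> complex" where
  "poisson_kernel \<alpha> \<beta> z =
     of_real (c_coeff \<alpha> \<beta>) * of_real ((1 - (cmod z)\<^sup>2) powr (\<alpha> + \<beta> + 1)) /
     ((1 - z) powr of_real (\<alpha> + 1) * (1 - cnj z) powr of_real (\<beta> + 1))"

definition poisson_integral :: "real \<Rightarrow> real \<Rightarrow> (complex \<Rightarrow> complex) \<Rightarrow> complex \<Rightarrow> complex" where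
  "poisson_integral \<alpha> \<beta> f z =
     of_real (1 / (2*pi)) *
     (LINT t|lebesgue_on {0..2*pi}. poisson_kernel \<alpha> \<beta> (z * cis (- t)) * f (cis t))"

definition J_int :: "real \<Rightarrow> real \<Rightarrow> real \<Rightarrow> real" where
  "J_int \<alpha> \<beta> r =
     (LINT s|lebesgue_on {0..2*pi}. cmod (1 + of_real r * cis (- s)) powr (\<alpha> + \<beta>))"

definition Jc_int :: "real \<Rightarrow> real \<Rightarrow> real \<Rightarrow> real" where
  "Jc_int \<alpha> \<beta> r =
     (LINT s|lebesgue_on {0..2*pi}. \<bar>cos s\<bar> * cmod (1 + of_real r * cis (- s)) powr (\<alpha> + \<beta>))"

definition Js_int :: "real \<Rightarrow> real \<Rightarrow> real \<Rightarrow> real" where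
  "Js_int \<alpha> \<beta> r =
     (LINT s|lebesgue_on {0..2*pi}. \<bar>sin s\<bar> * cmod (1 + of_real r * cis (- s)) powr (\<alpha> + \<beta>))"

definition A_fun :: "real \<Rightarrow> real \<Rightarrow> real \<Rightarrow> real" where
  "A_fun \<alpha> \<beta> r = \<bar>c_coeff \<alpha> \<beta>\<bar> *
     (\<bar>\<alpha> + \<beta>\<bar> * r / (2*pi) * J_int \<alpha> \<beta> r + (\<alpha> + \<beta> + 2) / (2*pi) * Jc_int \<alpha> \<beta> r
      + \<bar>\<alpha> - \<beta>\<bar> / (2*pi) * Js_int \<alpha> \<beta> r)"

definition B_fun :: "real \<Rightarrow> real \<Rightarrow> real \<Rightarrow> real" where
  "B_fun \<alpha> \<beta> r = \<bar>c_coeff \<alpha> \<beta>\<bar> *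
     (\<bar>\<beta> - \<alpha>\<bar> * r / (2*pi) * J_int \<alpha> \<beta> r + (\<alpha> + \<beta> + 2) / (2*pi) * Js_int \<alpha> \<beta> r
      + \<bar>\<beta> - \<alpha>\<bar> / (2*pi) * Jc_int \<alpha> \<beta> r)"

definition C_fun :: "real \<Rightarrow> real \<Rightarrow> real \<Rightarrow> real" where
  "C_fun \<alpha> \<beta> r = \<bar>c_coeff \<alpha> \<beta>\<bar> * (\<bar>\<alpha> + 1\<bar> + \<bar>\<beta>\<bar> * r) / (2*pi) * J_int \<alpha> \<beta> r"

definition A_const :: "real \<Rightarrow> real \<Rightarrow> real" where
  "A_const \<alpha> \<beta> = (SUP r\<in>{0<..<1}. A_fun \<alpha> \<beta> r)"

definition B_const :: "real \<Rightarrow> real \<Rightarrow> real" where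
  "B_const \<alpha> \<beta> = (SUP r\<in>{0<..<1}. B_fun \<alpha> \<beta> r)"

definition C_const :: "real \<Rightarrow> real \<Rightarrow> real" where
  "C_const \<alpha> \<beta> = (SUP r\<in>{0<..<1}. C_fun \<alpha> \<beta> r)"

text \<open>
  The explicit expressions for the three constants. \<open>C_formula\<close> is the supremum for all
  parameters. \<open>A_formula\<close> and \<open>B_formula\<close> use a single one of the weights
  \<open>\<bar>cos s\<bar>\<close>, \<open>\<bar>sin s\<bar>\<close> for both terms, although \<open>A_fun\<close> and \<open>B_fun\<close> contain both weights; they
  dominate the suprema only for \<open>\<alpha> + \<beta> \<ge> 0\<close> and equal them only in special cases. For
  \<open>\<alpha> + \<beta> < 0\<close> both are strictly smaller than the suprema (for instance, if
  \<open>\<alpha> = \<beta> = -1/4\<close>, \<open>B_fun\<close> is decreasing).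
\<close>

definition weight_int :: "real \<Rightarrow> real \<Rightarrow> real" where
  "weight_int \<alpha> \<beta> =
     (if \<alpha> + \<beta> \<ge> 2
      then LINT s|lebesgue_on {0..2*pi}. \<bar>cos s\<bar> * (1 + cos s) powr ((\<alpha> + \<beta>) / 2)
      else LINT s|lebesgue_on {0..2*pi}. \<bar>sin s\<bar> * (1 + cos s) powr ((\<alpha> + \<beta>) / 2))"

definition A_formula :: "real \<Rightarrow> real \<Rightarrow> real" where
  "A_formula \<alpha> \<beta> = \<bar>c_coeff \<alpha> \<beta>\<bar> *
     ((\<alpha> + \<beta> + 2 + \<bar>\<alpha> - \<beta>\<bar>) / pi * 2 powr ((\<alpha> + \<beta>) / 2 - 1) * weight_int \<alpha> \<beta>
      + \<bar>\<alpha> + \<beta>\<bar> * (Gamma (\<alpha> + \<beta> + 1) / (Gamma ((\<alpha> + \<beta> + 2) / 2))\<^sup>2))"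

definition B_formula :: "real \<Rightarrow> real \<Rightarrow> real" where
  "B_formula \<alpha> \<beta> = \<bar>c_coeff \<alpha> \<beta>\<bar> *
     ((\<alpha> + \<beta> + 2 + \<bar>\<beta> - \<alpha>\<bar>) / pi * 2 powr ((\<alpha> + \<beta>) / 2 - 1) * weight_int \<alpha> \<beta>
      + \<bar>\<beta> - \<alpha>\<bar> * (Gamma (\<alpha> + \<beta> + 1) / (Gamma ((\<alpha> + \<beta> + 2) / 2))\<^sup>2))"

definition C_formula :: "real \<Rightarrow> real \<Rightarrow> real" where
  "C_formula \<alpha> \<beta> = \<bar>c_coeff \<alpha> \<beta>\<bar> * (\<bar>\<alpha> + 1\<bar> + \<bar>\<beta>\<bar>) *
     (Gamma (\<alpha> + \<beta> + 1) / (Gamma ((\<alpha> + \<beta> + 2) / 2))\<^sup>2)"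

text \<open>
  Asymptotic sharpness as \<open>\<alpha>, \<beta> \<rightarrow> 0\<close> of a constant \<open>K \<alpha> \<beta>\<close> in the inequality
  \<open>M\<^sub>p(r, D u) \<le> K / (1 - r\<^sup>2) * \<parallel>f\<parallel>\<^sub>p\<close>, required for all exponents \<open>p \<in> P\<close>, all \<open>f\<close> and
  all \<open>r\<close>: for \<open>\<alpha> = \<beta> = 0\<close> the inequality fails with any smaller constant.
\<close>

definition asymptotically_sharp ::
  "ennreal set \<Rightarrow> ((complex \<Rightarrow> complex) \<Rightarrow> real \<Rightarrow> real \<Rightarrow> complex) \<Rightarrow> (real \<Rightarrow> real \<Rightarrow> real) \<Rightarrow> bool"
  where
  "asymptotically_sharp P D K \<longleftrightarrow>
     (\<forall>k < K 0 0. \<not> (\<forall>p\<in>P. \<forall>f\<in>Lp_circle p. \<forall>r\<in>{0<..<1}.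
        integral_mean p r (D (poisson_integral 0 0 f)) \<le> ennreal (k / (1 - r\<^sup>2)) * Lp_norm p f))"

end

(*
  Write the kernels of u_r, u_theta, u_z on the circle |z| = r as k(e^{i(theta - t)}).  By Young's inequality
  M_p is at most the L^1 mean of k times the norm of f.  Substituting w = (zeta + r) / (1 + r zeta), the Jacobian
  and the Poisson factor combine to |c| |1 + r zeta|^(alpha + beta) / (1 - r^2), while the logarithmic derivative
  of the kernel becomes linear in cos s, sin s for zeta = e^{is}; this gives A(r), B(r), C(r).

  The integral J(r) increases by Parseval for (1 + z)^((alpha + beta)/2), and J(1) is a Beta integral.
  The |sin|-weighted integral is elementary; the |cos|-weighted one is compared with it after averaging over
  s -> s + pi and s -> s + pi/2, which reduces everything to the monotonicity of (1 + y)^b + (1 - y)^b.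

  For alpha = beta = 0, sharpness of A and B is seen at p = infinity on the sign of the kernel, and that of C
  on f(z) = z as r -> 0.
*)

theory Submission
  imports Defs
begin

section \<open>Convolution on the circle\<close>

text \<open>The substitution makes 1 - r w equal to (1 - r^2) / (1 + r zeta): the singular
  denominator of the kernel is traded for a power of |1 + r zeta| that is harmless for r < 1 and
  still integrable at r = 1, because \<alpha> + \<beta> > -1. The case distinction at \<alpha> +
  \<beta> = 2 comes from the derivative of (1 + y)^b + (1 - y)^b with b = (\<alpha> + \<beta>) / 2,
  whose sign for y > 0 changes at b = 1. It changes again at b = 0, which is why the closed formulas
  for A and B are compared with the suprema only for \<alpha> + \<beta> >= 0. Equality is obtained
  when both weights have the same boundary integral, or when \<alpha> = \<beta> leaves only the
  dominant one. The data are merely integrable, so differentiation under the integral rests on a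
  linearisation error of the kernel that is uniform under rotations. For \<alpha> = \<beta> = 0 the
  triangle inequalities behind A(r) and B(r) lose nothing, but the angular estimate drops a factor
  r: sharpness of A is visible at a single radius, that of B only as r -> 1.\<close>

abbreviation circ :: "real measure" where "circ \<equiv> lebesgue_on {0..2*pi}"

lemma finite_measure_circ: "finite_measure circ"
  by (simp add: finite_measure_lebesgue_on)

lemma emeasure_circ: "emeasure circ (space circ) = ennreal (2*pi)"
  by (simp add: emeasure_restrict_space)

lemma measure_circ [simp]: "measure circ {0..2*pi} = 2*pi"
  using emeasure_circ by (simp add: measure_def)

lemma circ_integrable_const [simp]: "integrable circ (\<lambda>_. c)"
  using finite_measure.integrable_const finite_measure_circ by blast

lemma circ_integrable_continuous:
  fixes f :: "real \<Rightarrow> 'b::euclidean_space"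
  assumes "continuous_on UNIV f"
  shows "integrable circ f"
  using assms continuous_imp_integrable_real continuous_on_subset by blast

lemma circ_integral_FTC:
  fixes F f :: "real \<Rightarrow> 'b::euclidean_space"
  assumes "continuous_on {a..b} f" "a \<le> b"
    and "\<And>x. x \<in> {a..b} \<Longrightarrow> (F has_vector_derivative f x) (at x within {a..b})"
  shows "(LINT t|lebesgue_on {a..b}. f t) = F b - F a"
proof -
  have "(f has_integral (F b - F a)) {a..b}"
    using assms by (intro fundamental_theorem_of_calculus) auto
  moreover have "integrable (lebesgue_on {a..b}) f"
    using assms continuous_imp_integrable_real by blast
  ultimately show ?thesis
    by (simp add: lebesgue_integral_eq_integral integral_unique)
qed

lemma circ_integrable_mult:
  fixes k g :: "real \<Rightarrow> complex"
  assumes k: "continuous_on UNIV k" and g: "integrable circ g"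
  shows "integrable circ (\<lambda>t. k t * g t)"
proof -
  have "compact (k ` {0..2*pi})"
    by (intro compact_continuous_image continuous_on_subset[OF k]) auto
  then obtain B where B: "\<And>t. t \<in> {0..2*pi} \<Longrightarrow> norm (k t) \<le> B"
    unfolding bounded_iff by (meson bounded_iff compact_imp_bounded imageI)
  have B0: "B \<ge> 0" using order_trans[OF norm_ge_zero B[of 0]] by simp
  show ?thesis
  proof (rule Bochner_Integration.integrable_bound)
    show "integrable circ (\<lambda>t. B * norm (g t))" using g by auto
    show "(\<lambda>t. k t * g t) \<in> borel_measurable circ"
      using g circ_integrable_continuous[OF k] by (intro borel_measurable_times) auto
    show "AE t in circ. norm (k t * g t) \<le> norm (B * norm (g t))"
      using B B0 by (intro AE_I2) (auto simp: norm_mult intro!: mult_right_mono)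
  qed
qed

text \<open>All three integrals are increments of one antiderivative \<open>g\<close> over intervals
  of length 2 pi. Such increments do not depend on the interval, because g(y + 2 pi) - g(y) has
  derivative zero.\<close>

lemma periodic_integral:
  fixes \<kappa> :: "real \<Rightarrow> 'b::euclidean_space"
  assumes c: "continuous_on UNIV \<kappa>" and per: "\<And>t. \<kappa> (t + 2*pi) = \<kappa> t"
  shows "(LINT t|circ. \<kappa> (t + x)) = (LINT t|circ. \<kappa> t)"
    and "(LINT t|circ. \<kappa> (x - t)) = (LINT t|circ. \<kappa> t)"
proof -
  \<comment> \<open>Large enough that \<open>g\<close> is differentiable at every shifted or
    reflected argument used below.\<close>
  define L where "L = \<bar>x\<bar> + 8*pi"
  have "continuous_on {-L..L} \<kappa>" using c continuous_on_subset by blast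
  from antiderivative_continuous[OF this] obtain g where
    g: "\<And>x. x \<in> {-L..L} \<Longrightarrow> (g has_vector_derivative \<kappa> x) (at x within {-L..L})" by blast
  have g': "(g has_vector_derivative \<kappa> y) (at y)" if "\<bar>y\<bar> < L" for y
  proof -
    have "at y within {-L..L} = at y" using that by (intro at_within_Icc_at) auto
    moreover have "y \<in> {-L..L}" using that by auto
    ultimately show ?thesis using g by metis
  qed
  have shift: "g (b + 2*pi) - g b = g (a + 2*pi) - g a"
    if "a \<le> b" "\<bar>a\<bar> + 2*pi < L" "\<bar>b\<bar> + 2*pi < L" for a b
  proof -
    have "((\<lambda>_. 0) has_integral ((g (b + 2*pi) - g b) - (g (a + 2*pi) - g a))) {a..b}"
    proof (rule fundamental_theorem_of_calculus)
      fix y assume y: "y \<in> {a..b}"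
      have yL: "\<bar>y\<bar> < L" "\<bar>y + 2*pi\<bar> < L"
        using that y pi_gt_zero unfolding atLeastAtMost_iff by arith+
      have "((\<lambda>y. g (y + 2*pi)) has_vector_derivative (1 *\<^sub>R \<kappa> (y + 2*pi))) (at y)"
        by (intro vector_diff_chain_at[unfolded o_def, of "\<lambda>y. y + 2*pi" 1 y g] g' yL)
          (auto intro!: derivative_eq_intros)
      moreover have "(g has_vector_derivative \<kappa> y) (at y)"
        by (intro g' yL)
      ultimately have "((\<lambda>y. g (y + 2*pi) - g y) has_vector_derivative (1 *\<^sub>R \<kappa> (y + 2*pi) - \<kappa> y)) (at y)"
        by (rule has_vector_derivative_diff)
      then have "((\<lambda>y. g (y + 2*pi) - g y) has_vector_derivative 0) (at y)"
        by (simp only: per scaleR_one diff_self)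
      then show "((\<lambda>y. g (y + 2*pi) - g y) has_vector_derivative 0) (at y within {a..b})"
        by (rule has_vector_derivative_at_within)
    qed (use that in auto)
    then show ?thesis by (metis has_integral_0_eq right_minus_eq)
  qed
  have shift': "g (b + 2*pi) - g b = g (2*pi) - g 0" if "\<bar>b\<bar> + 2*pi < L" for b
  proof -
    have z: "\<bar>0::real\<bar> + 2*pi < L" using pi_gt_zero unfolding L_def by arith
    show ?thesis
    proof (cases "b \<le> 0")
      case True then show ?thesis using shift[OF True that z] by simp
    next
      case False
      then have "0 \<le> b" by simp
      then show ?thesis using shift[OF _ z that] by simp
    qed
  qed
  have bd: "\<bar>y + x\<bar> < L" "\<bar>x - y\<bar> < L" "\<bar>y\<bar> < L" if "y \<in> {0..2*pi}" for y
    using that pi_gt_zero unfolding L_def atLeastAtMost_iff by arith+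
  have "(LINT t|circ. \<kappa> t) = g (2*pi) - g 0"
    by (rule circ_integral_FTC)
      (use bd in \<open>auto intro!: continuous_on_subset[OF c] has_vector_derivative_at_within g'\<close>)
  moreover have "(LINT t|circ. \<kappa> (t + x)) = g (2*pi + x) - g (0 + x)"
  proof (rule circ_integral_FTC)
    show "continuous_on {0..2*pi} (\<lambda>t. \<kappa> (t + x))"
      by (intro continuous_on_compose2[OF c] continuous_intros) auto
    fix y assume y: "y \<in> {0..2*pi}"
    have "((\<lambda>y. g (y + x)) has_vector_derivative (1 *\<^sub>R \<kappa> (y + x))) (at y)"
      by (intro vector_diff_chain_at[unfolded o_def, of "\<lambda>y. y + x" 1 y g] g' bd y)
        (auto intro!: derivative_eq_intros)
    then show "((\<lambda>y. g (y + x)) has_vector_derivative \<kappa> (y + x)) (at y within {0..2*pi})"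
      by (simp add: has_vector_derivative_at_within)
  qed auto
  moreover have "(LINT t|circ. \<kappa> (x - t)) = (- g (x - 2*pi)) - (- g (x - 0))"
  proof (rule circ_integral_FTC)
    show "continuous_on {0..2*pi} (\<lambda>t. \<kappa> (x - t))"
      by (intro continuous_on_compose2[OF c] continuous_intros) auto
    fix y assume y: "y \<in> {0..2*pi}"
    have "((\<lambda>y. g (x - y)) has_vector_derivative ((-1) *\<^sub>R \<kappa> (x - y))) (at y)"
      by (intro vector_diff_chain_at[unfolded o_def, of "\<lambda>y. x - y" "-1" y g] g' bd y)
        (auto intro!: derivative_eq_intros)
    from has_vector_derivative_minus[OF this]
    show "((\<lambda>y. - g (x - y)) has_vector_derivative \<kappa> (x - y)) (at y within {0..2*pi})"
      by (simp add: has_vector_derivative_at_within)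
  qed auto
  moreover have xL: "\<bar>x\<bar> + 2*pi < L" "\<bar>x - 2*pi\<bar> + 2*pi < L"
    using pi_gt_zero unfolding L_def by arith+
  ultimately show "(LINT t|circ. \<kappa> (t + x)) = (LINT t|circ. \<kappa> t)"
    and "(LINT t|circ. \<kappa> (x - t)) = (LINT t|circ. \<kappa> t)"
    using shift'[OF xL(1)] shift'[OF xL(2)] by (simp_all add: add.commute)
qed

section \<open>Convolution of a kernel on the circle with data given on
  \<open>{0..2*pi}\<close>\<close>

definition circ_conv :: "(complex \<Rightarrow> complex) \<Rightarrow> (real \<Rightarrow> complex) \<Rightarrow> real \<Rightarrow> complex" where
  "circ_conv k g \<theta> = of_real (1 / (2*pi)) * (LINT t|circ. k (cis (\<theta> - t)) * g t)"

definition circ_mean :: "(complex \<Rightarrow> complex) \<Rightarrow> real" where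
  "circ_mean k = (LINT t|circ. cmod (k (cis t))) / (2*pi)"

lemma continuous_on_cis_comp:
  assumes "continuous_on (sphere 0 1) k" "continuous_on S f"
  shows "continuous_on S (\<lambda>t. k (cis (f t)))"
  by (rule continuous_on_compose2[OF assms(1)]) (auto intro!: continuous_on_cis assms)

lemma circ_mean_shift:
  assumes k: "continuous_on (sphere 0 1) k"
  shows "(LINT t|circ. cmod (k (cis (\<theta> - t)))) = 2*pi * circ_mean k"
    and "(LINT t|circ. cmod (k (cis (t - \<theta>)))) = 2*pi * circ_mean k"
proof -
  have c: "continuous_on UNIV (\<lambda>t. cmod (k (cis t)))"
    by (intro continuous_on_norm continuous_on_cis_comp[OF k]) auto
  have p: "\<And>t. cmod (k (cis (t + 2*pi))) = cmod (k (cis t))"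
    by (simp add: cis_mult[symmetric])
  from periodic_integral(2)[OF c p, of \<theta>] periodic_integral(1)[OF c p, of "-\<theta>"]
  show "(LINT t|circ. cmod (k (cis (\<theta> - t)))) = 2*pi * circ_mean k"
    and "(LINT t|circ. cmod (k (cis (t - \<theta>)))) = 2*pi * circ_mean k"
    by (simp_all add: circ_mean_def)
qed

text \<open>Dominated convergence, with a bound for \<open>k\<close> on the compact circle.
  Continuity supplies measurability inside the essential supremum and later turns the value at a
  single angle into a lower bound for it.\<close>

lemma continuous_on_circ_conv:
  assumes k: "continuous_on (sphere 0 1) k" and g: "integrable circ g"
  shows "continuous_on UNIV (circ_conv k g)"
proof -
  have "compact (k ` sphere 0 1)" by (intro compact_continuous_image k) auto
  then obtain B where B: "\<And>t. norm (k (cis t)) \<le> B"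
    unfolding compact_eq_bounded_closed bounded_iff by (metis (no_types, lifting) imageI mem_sphere_0 norm_cis)
  have B0: "B \<ge> 0" using order_trans[OF norm_ge_zero B[of 0]] .
  have cont: "continuous_on UNIV (\<lambda>t. k (cis (y - t)))" for y
    by (rule continuous_on_cis_comp[OF k]) (intro continuous_intros)
  have "isCont (circ_conv k g) \<theta>" for \<theta>
  proof (rule continuous_at_sequentiallyI)
    fix x :: "nat \<Rightarrow> real" assume x: "x \<longlonglongrightarrow> \<theta>"
    have "(\<lambda>n. LINT t|circ. k (cis (x n - t)) * g t) \<longlonglongrightarrow> (LINT t|circ. k (cis (\<theta> - t)) * g t)"
    proof (rule integral_dominated_convergence)
      show "integrable circ (\<lambda>t. B * norm (g t))" using g by auto
      show "(\<lambda>t. k (cis (\<theta> - t)) * g t) \<in> borel_measurable circ"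
        by (intro borel_measurable_integrable circ_integrable_mult g cont)
      show "(\<lambda>t. k (cis (x n - t)) * g t) \<in> borel_measurable circ" for n
        by (intro borel_measurable_integrable circ_integrable_mult g cont)
      show "AE t in circ. (\<lambda>n. k (cis (x n - t)) * g t) \<longlonglongrightarrow> k (cis (\<theta> - t)) * g t"
      proof (intro AE_I2 tendsto_intros)
        fix t
        have "isCont (\<lambda>y. k (cis (y - t))) \<theta>"
          using continuous_on_cis_comp[OF k, of UNIV "\<lambda>y. y - t"]
          by (auto intro!: continuous_intros simp: continuous_on_eq_continuous_at)
        then show "(\<lambda>n. k (cis (x n - t))) \<longlonglongrightarrow> k (cis (\<theta> - t))"
          using x isCont_tendsto_compose by blast
      qed
      show "AE t in circ. norm (k (cis (x n - t)) * g t) \<le> B * norm (g t)" for n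
        by (intro AE_I2) (auto simp: norm_mult intro!: mult_right_mono B)
    qed
    then show "(\<lambda>n. circ_conv k g (x n)) \<longlonglongrightarrow> circ_conv k g \<theta>"
      unfolding circ_conv_def by (intro tendsto_intros)
  qed
  then show ?thesis by (simp add: continuous_at_imp_continuous_on)
qed

section \<open>Jensen's inequality for powers and Young's inequality\<close>

lemma powr_above_tangent:
  fixes x m p :: real
  assumes "x \<ge> 0" "m > 0" "p \<ge> 1"
  shows "x powr p \<ge> m powr p + p * m powr (p - 1) * (x - m)"
proof (cases "x = 0")
  case True
  have "m powr (p - 1) * m = m powr p"
    using assms by (simp add: powr_diff)
  then show ?thesis using assms True by (simp add: algebra_simps)
next
  case False
  have "p * m powr (p - 1) * (x - m) \<le> x powr p - m powr p"
  proof (rule convex_on_imp_above_tangent[where A = "{0<..}"])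
    show "convex_on {0<..} (\<lambda>x. x powr p)" using assms powr_convex by blast
    show "((\<lambda>x. x powr p) has_field_derivative p * m powr (p - 1)) (at m within {0<..})"
      using assms by (auto intro!: derivative_eq_intros)
  qed (use assms False in \<open>auto simp: interior_open\<close>)
  then show ?thesis by linarith
qed

text \<open>Jensen's inequality for the weight \<open>w\<close>, with the factor
  \<open>W powr (p - 1)\<close> in place of a normalised weight, so that total mass zero is
  allowed.\<close>

lemma weighted_power_mean:
  fixes w g :: "'a \<Rightarrow> real"
  assumes w: "integrable M w" "\<And>x. x \<in> space M \<Longrightarrow> w x \<ge> 0" and W: "W = (LINT x|M. w x)"
    and g: "\<And>x. x \<in> space M \<Longrightarrow> g x \<ge> 0" and wg: "integrable M (\<lambda>x. w x * g x)"
    and wgp: "integrable M (\<lambda>x. w x * g x powr p)" and p: "p \<ge> 1"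
  shows "(LINT x|M. w x * g x) powr p \<le> W powr (p - 1) * (LINT x|M. w x * g x powr p)"
proof -
  have W0: "W \<ge> 0" unfolding W using w by (intro integral_nonneg_AE AE_I2) auto
  have S0: "(LINT x|M. w x * g x) \<ge> 0" using w g by (intro integral_nonneg_AE AE_I2) auto
  have P0: "(LINT x|M. w x * g x powr p) \<ge> 0" using w g by (intro integral_nonneg_AE AE_I2) auto
  show ?thesis
  proof (cases "(LINT x|M. w x * g x) = 0")
    case True
    then show ?thesis using P0 by simp
  next
    case False
    then have S: "(LINT x|M. w x * g x) > 0" using S0 by simp
    have "W \<noteq> 0"
    proof
      assume "W = 0"
      then have "AE x in M. w x = 0"
        using w integral_nonneg_eq_0_iff_AE[of M w] W by (simp add: AE_I2)
      then have "AE x in M. w x * g x = 0" by eventually_elim simp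
      then have "(LINT x|M. w x * g x) = 0"
        by (simp add: integral_eq_zero_AE)
      with S show False by simp
    qed
    then have Wp: "W > 0" using W0 by simp
    define S where "S = (LINT x|M. w x * g x)"
    \<comment> \<open>The weighted mean of \<open>g\<close>: the linear part of the tangent of
      \<open>x powr p\<close> at this point integrates to zero against \<open>w\<close>.\<close>
    define m where "m = S / W"
    have m: "m > 0" using S Wp by (simp add: m_def S_def)
    have "(LINT x|M. w x * (m powr p - p * m powr (p - 1) * m) + p * m powr (p - 1) * (w x * g x))
       \<le> (LINT x|M. w x * g x powr p)"
    proof (rule integral_mono)
      show "integrable M (\<lambda>x. w x * (m powr p - p * m powr (p - 1) * m) + p * m powr (p - 1) * (w x * g x))"
        using w wg by auto
      fix x assume x: "x \<in> space M"
      have "w x * (m powr p + p * m powr (p - 1) * (g x - m)) \<le> w x * g x powr p"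
        using powr_above_tangent[OF g[OF x] m p] w(2)[OF x] by (intro mult_left_mono) auto
      then show "w x * (m powr p - p * m powr (p - 1) * m) + p * m powr (p - 1) * (w x * g x) \<le> w x * g x powr p"
        by (simp add: algebra_simps)
    qed (use wgp in auto)
    also have "(LINT x|M. w x * (m powr p - p * m powr (p - 1) * m) + p * m powr (p - 1) * (w x * g x))
      = W * (m powr p - p * m powr (p - 1) * m) + p * m powr (p - 1) * S"
      using w wg by (simp add: W S_def)
    also have "\<dots> = W * m powr p"
      using Wp by (simp add: m_def algebra_simps)
    also have "\<dots> = S powr p / W powr (p - 1)"
      using Wp S by (simp add: m_def powr_divide powr_diff S_def field_simps)
    finally show ?thesis using Wp by (simp add: S_def field_simps)
  qed
qed

lemma sigma_finite_circ: "sigma_finite_measure circ"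
  by (rule finite_measure.axioms(1)[OF finite_measure_circ])

lemma pair_circ: "pair_sigma_finite circ circ"
  by (rule pair_sigma_finite.intro[OF sigma_finite_circ sigma_finite_circ])

lemma circ_powr_integrable:
  assumes g: "g \<in> borel_measurable circ" and p: "1 \<le> p" "p \<noteq> \<infinity>" and fin: "circle_norm p g < \<infinity>"
  shows "integrable circ (\<lambda>t. cmod (g t) powr enn2real p)"
proof (rule integrableI_bounded)
  show "(\<lambda>t. cmod (g t) powr enn2real p) \<in> borel_measurable circ" using g by measurable
  show "(\<integral>\<^sup>+ t. ennreal (norm (cmod (g t) powr enn2real p)) \<partial>circ) < \<infinity>"
    using fin p by (auto simp: circle_norm_def Let_def less_top split: if_splits)
qed

lemma enn2real_ge_1: "1 \<le> p \<Longrightarrow> p \<noteq> \<infinity> \<Longrightarrow> 1 \<le> enn2real p"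
  using enn2real_mono[of 1 p] by (simp add: less_top)

text \<open>On a finite measure space L^p embeds into L^1: |g| is at most its essential supremum
  almost everywhere, or at most 1 + |g|^p.\<close>

lemma circ_integrable_of_norm:
  assumes g: "g \<in> borel_measurable circ" and p: "1 \<le> p" and fin: "circle_norm p g < \<infinity>"
  shows "integrable circ g"
proof (cases "p = \<infinity>")
  case True
  define E where "E = enn2real (esssup circ (\<lambda>t. ennreal (cmod (g t))))"
  have "esssup circ (\<lambda>t. ennreal (cmod (g t))) = ennreal E"
    using fin True by (simp add: circle_norm_def E_def)
  then have "AE t in circ. ennreal (cmod (g t)) \<le> ennreal E"
    using esssup_AE[of "\<lambda>t. ennreal (cmod (g t))" circ] by simp
  then have "AE t in circ. norm (g t) \<le> norm E"
    by eventually_elim (auto simp: E_def)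
  then show ?thesis by (rule Bochner_Integration.integrable_bound[rotated 2]) (use g in auto)
next
  case False
  have i: "integrable circ (\<lambda>t. 1 + cmod (g t) powr enn2real p)"
    using circ_powr_integrable[OF g p False fin] by auto
  have "norm (g t) \<le> norm (1 + cmod (g t) powr enn2real p)" for t
  proof (cases "cmod (g t) \<le> 1")
    case True then show ?thesis
      by (metis abs_of_nonneg add_increasing2 norm_ge_zero powr_ge_zero real_norm_def zero_le_one order_trans add_nonneg_nonneg)
  next
    case g1: False
    have "cmod (g t) powr 1 \<le> cmod (g t) powr enn2real p"
      using g1 by (intro powr_mono enn2real_ge_1 p False) auto
    then show ?thesis using g1 by simp
  qed
  then show ?thesis by (intro Bochner_Integration.integrable_bound[OF i g]) auto
qed

text \<open>Jensen's inequality with the weight |k(e^{i(theta - t)})| / (2 pi), whose total mass is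
  the mean of the kernel for every theta.\<close>

lemma circ_conv_powr_le:
  assumes k: "continuous_on (sphere 0 1) k" and g: "integrable circ g"
    and gp: "integrable circ (\<lambda>t. cmod (g t) powr p)" and p: "p \<ge> 1"
  shows "cmod (circ_conv k g \<theta>) powr p \<le>
    (circ_mean k powr (p - 1) / (2*pi)) * (LINT t|circ. cmod (k (cis (\<theta> - t))) * cmod (g t) powr p)"
proof -
  have cont: "continuous_on UNIV (\<lambda>t. k (cis (\<theta> - t)))"
    by (rule continuous_on_cis_comp[OF k]) (intro continuous_intros)
  let ?w = "\<lambda>t. cmod (k (cis (\<theta> - t))) / (2*pi)"
  have wi: "integrable circ ?w"
    by (intro integrable_divide circ_integrable_continuous continuous_on_norm cont)
  have wg: "integrable circ (\<lambda>t. ?w t * cmod (g t))"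
    using integrable_norm[OF circ_integrable_mult[OF cont g]] by (auto simp: norm_mult)
  have wgp: "integrable circ (\<lambda>t. ?w t * cmod (g t) powr p)"
    using integrable_norm[OF circ_integrable_mult[OF cont, of "\<lambda>t. of_real (cmod (g t) powr p)"]] gp
    by (auto simp: norm_mult)
  have W: "circ_mean k = (LINT t|circ. ?w t)"
    using circ_mean_shift(1)[OF k, of \<theta>] by simp
  have "cmod (circ_conv k g \<theta>) \<le> 1 / (2*pi) * (LINT t|circ. cmod (k (cis (\<theta> - t)) * g t))"
    unfolding circ_conv_def norm_mult norm_of_real using integral_norm_bound[of circ "\<lambda>t. k (cis (\<theta> - t)) * g t"]
    by (simp add: norm_mult divide_right_mono)
  also have "\<dots> = (LINT t|circ. ?w t * cmod (g t))"
    by (simp add: norm_mult)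
  finally have "cmod (circ_conv k g \<theta>) powr p \<le> (LINT t|circ. ?w t * cmod (g t)) powr p"
    using p by (intro powr_mono2) auto
  also have "\<dots> \<le> circ_mean k powr (p - 1) * (LINT t|circ. ?w t * cmod (g t) powr p)"
    by (intro weighted_power_mean wi W wg wgp p) auto
  finally show ?thesis by (simp add: norm_mult)
qed

lemma circ_mean_nonneg: "circ_mean k \<ge> 0"
  unfolding circ_mean_def by (intro divide_nonneg_pos integral_nonneg_AE AE_I2) auto

text \<open>For finite exponent the pointwise estimate is integrated in theta and the order of
  integration exchanged; the inner integral supplies one more factor \<open>W\<close> and completes
  \<open>W powr (q - 1)\<close> to \<open>W powr q\<close>. With nonnegative integrals the exchange
  asks for joint measurability only.\<close>

theorem circ_conv_norm_le:
  assumes k: "continuous_on (sphere 0 1) k" and g: "g \<in> borel_measurable circ"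
    and p: "1 \<le> p" and fin: "circle_norm p g < \<infinity>"
  shows "circle_norm p (circ_conv k g) \<le> ennreal (circ_mean k) * circle_norm p g"
proof -
  have gi: "integrable circ g" by (rule circ_integrable_of_norm[OF g p fin])
  have cont: "continuous_on UNIV (\<lambda>t. k (cis (\<theta> - t)))" for \<theta>
    by (rule continuous_on_cis_comp[OF k]) (intro continuous_intros)
  have kint: "integrable circ (\<lambda>t. cmod (k (cis (\<theta> - t))))" for \<theta>
    by (intro circ_integrable_continuous continuous_on_norm cont)
  show ?thesis
  proof (cases "p = \<infinity>")
    case True
    define E where "E = enn2real (esssup circ (\<lambda>t. ennreal (cmod (g t))))"
    have E: "esssup circ (\<lambda>t. ennreal (cmod (g t))) = ennreal E" "E \<ge> 0"
      using fin True by (simp_all add: circle_norm_def E_def)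
    then have ae: "AE t in circ. cmod (g t) \<le> E"
      using esssup_AE[of "\<lambda>t. ennreal (cmod (g t))" circ] by simp
    have "cmod (circ_conv k g \<theta>) \<le> circ_mean k * E" for \<theta>
    proof -
      have "cmod (circ_conv k g \<theta>) \<le> 1 / (2*pi) * (LINT t|circ. cmod (k (cis (\<theta> - t)) * g t))"
        unfolding circ_conv_def norm_mult norm_of_real using integral_norm_bound[of circ "\<lambda>t. k (cis (\<theta> - t)) * g t"]
        by (simp add: norm_mult divide_right_mono)
      also have "(LINT t|circ. cmod (k (cis (\<theta> - t)) * g t)) \<le> (LINT t|circ. cmod (k (cis (\<theta> - t))) * E)"
      proof (rule integral_mono_AE)
        show "integrable circ (\<lambda>t. cmod (k (cis (\<theta> - t)) * g t))"
          by (intro integrable_norm circ_integrable_mult cont gi)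
        show "AE t in circ. cmod (k (cis (\<theta> - t)) * g t) \<le> cmod (k (cis (\<theta> - t))) * E"
          using ae by eventually_elim (auto simp: norm_mult intro!: mult_left_mono)
      qed (use kint in auto)
      also have "\<dots> = 2 * pi * circ_mean k * E"
        using circ_mean_shift(1)[OF k, of \<theta>] by simp
      finally show ?thesis by (simp add: divide_right_mono)
    qed
    then have "esssup circ (\<lambda>\<theta>. ennreal (cmod (circ_conv k g \<theta>))) \<le> ennreal (circ_mean k * E)"
      using continuous_on_circ_conv[OF k gi]
      by (intro esssup_I AE_I2 ennreal_leI)
         (auto intro!: borel_measurable_integrable circ_integrable_continuous continuous_intros measurable_compose[OF _ measurable_ennreal])
    then show ?thesis
      using True E circ_mean_nonneg by (simp add: circle_norm_def ennreal_mult)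
  next
    case False
    define q where "q = enn2real p"
    define W where "W = circ_mean k"
    have W0: "W \<ge> 0" by (simp add: W_def circ_mean_nonneg)
    have q: "q \<ge> 1" using enn2real_ge_1[OF p False] by (simp add: q_def)
    have gq: "integrable circ (\<lambda>t. cmod (g t) powr q)"
      unfolding q_def by (rule circ_powr_integrable[OF g p False fin])
    define I where "I = (\<integral>\<^sup>+ t. ennreal (cmod (g t) powr q) \<partial>circ)"
    define G where "G = (\<integral>\<^sup>+ t. ennreal (cmod (circ_conv k g t) powr q) \<partial>circ)"
    have Ifin: "I < \<infinity>"
      using fin False by (auto simp: circle_norm_def Let_def I_def q_def less_top split: if_splits)
    \<comment> \<open>The kernel is a Borel function of the angle, so joint measurability reduces to
      that of the difference of the two angles.\<close>
    have m1: "(\<lambda>x. k (cis (fst x - snd x))) \<in> borel_measurable (circ \<Otimes>\<^sub>M circ)"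
    proof -
      have "(\<lambda>t. k (cis t)) \<in> borel_measurable borel"
        by (intro borel_measurable_continuous_onI continuous_on_cis_comp[OF k] continuous_intros)
      moreover have "(\<lambda>x. fst x - snd x) \<in> borel_measurable (circ \<Otimes>\<^sub>M circ)"
        using id_borel_measurable_lebesgue_on[of "{0..2*pi}"] unfolding id_def
        by (intro borel_measurable_diff measurable_compose[OF measurable_fst] measurable_compose[OF measurable_snd]) auto
      ultimately show ?thesis by (rule measurable_compose[rotated])
    qed
    have m2: "(\<lambda>x. g (snd x)) \<in> borel_measurable (circ \<Otimes>\<^sub>M circ)"
      using g by (intro measurable_compose[OF measurable_snd])
    have meas: "(\<lambda>(\<theta>, t). ennreal (cmod (k (cis (\<theta> - t))) * cmod (g t) powr q)) \<in> borel_measurable (circ \<Otimes>\<^sub>M circ)"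
      unfolding split_beta using m1 m2 by measurable
    have inner: "ennreal (LINT t|circ. cmod (k (cis (\<theta> - t))) * cmod (g t) powr q) =
        (\<integral>\<^sup>+ t. ennreal (cmod (k (cis (\<theta> - t))) * cmod (g t) powr q) \<partial>circ)" for \<theta>
    proof (rule nn_integral_eq_integral[symmetric])
      show "integrable circ (\<lambda>t. cmod (k (cis (\<theta> - t))) * cmod (g t) powr q)"
        using integrable_norm[OF circ_integrable_mult[OF cont[of \<theta>], of "\<lambda>t. of_real (cmod (g t) powr q)"]] gq
        by (auto simp: norm_mult)
    qed auto
    have "G \<le> (\<integral>\<^sup>+ \<theta>. ennreal (W powr (q - 1) / (2*pi)) *
        (\<integral>\<^sup>+ t. ennreal (cmod (k (cis (\<theta> - t))) * cmod (g t) powr q) \<partial>circ) \<partial>circ)"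
      unfolding G_def inner[symmetric]
    proof (rule nn_integral_mono)
      fix \<theta>
      show "ennreal (cmod (circ_conv k g \<theta>) powr q) \<le> ennreal (W powr (q - 1) / (2*pi)) *
          ennreal (LINT t|circ. cmod (k (cis (\<theta> - t))) * cmod (g t) powr q)"
        using circ_conv_powr_le[OF k gi gq q, of \<theta>] W0
        by (subst ennreal_mult'[symmetric]) (auto simp: W_def intro!: ennreal_leI)
    qed
    also have "\<dots> = ennreal (W powr (q - 1) / (2*pi)) * (\<integral>\<^sup>+ \<theta>.
        (\<integral>\<^sup>+ t. ennreal (cmod (k (cis (\<theta> - t))) * cmod (g t) powr q) \<partial>circ) \<partial>circ)"
      using sigma_finite_measure.borel_measurable_nn_integral_fst[OF sigma_finite_circ meas] by (intro nn_integral_cmult) simp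
    also have "(\<integral>\<^sup>+ \<theta>. (\<integral>\<^sup>+ t. ennreal (cmod (k (cis (\<theta> - t))) * cmod (g t) powr q) \<partial>circ) \<partial>circ)
      = (\<integral>\<^sup>+ t. (\<integral>\<^sup>+ \<theta>. ennreal (cmod (k (cis (\<theta> - t))) * cmod (g t) powr q) \<partial>circ) \<partial>circ)"
      using pair_sigma_finite.Fubini'[OF pair_circ meas] by simp
    also have "\<dots> = (\<integral>\<^sup>+ t. ennreal (2*pi*W) * ennreal (cmod (g t) powr q) \<partial>circ)"
    proof (rule nn_integral_cong)
      fix t
      have ci: "integrable circ (\<lambda>\<theta>. cmod (k (cis (\<theta> - t))))"
        by (intro circ_integrable_continuous continuous_on_norm continuous_on_cis_comp[OF k] continuous_on_diff continuous_on_id continuous_on_const)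
      have "(\<integral>\<^sup>+ \<theta>. ennreal (cmod (k (cis (\<theta> - t))) * cmod (g t) powr q) \<partial>circ) =
          ennreal (LINT \<theta>|circ. cmod (k (cis (\<theta> - t))) * cmod (g t) powr q)"
        using ci by (intro nn_integral_eq_integral) auto
      also have "(LINT \<theta>|circ. cmod (k (cis (\<theta> - t))) * cmod (g t) powr q) = 2*pi*W * cmod (g t) powr q"
        using circ_mean_shift(2)[OF k, of t] by (simp add: W_def)
      finally show "(\<integral>\<^sup>+ \<theta>. ennreal (cmod (k (cis (\<theta> - t))) * cmod (g t) powr q) \<partial>circ) =
          ennreal (2*pi*W) * ennreal (cmod (g t) powr q)"
        using W0 by (simp add: ennreal_mult'[symmetric])
    qed
    also have "\<dots> = ennreal (2*pi*W) * I"
      unfolding I_def using g by (intro nn_integral_cmult) measurable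
    also have "ennreal (W powr (q - 1) / (2*pi)) * (ennreal (2*pi*W) * I) = ennreal (W powr (q - 1) * W) * I"
      using W0 by (simp add: mult.assoc[symmetric] ennreal_mult'[symmetric])
    also have "W powr (q - 1) * W = W powr q"
      using W0 by (cases "W = 0") (auto simp: powr_diff)
    finally have GI: "G \<le> ennreal (W powr q) * I" .
    \<comment> \<open>\<open>enn2real\<close> sends infinity to 0, so \<open>G\<close> must be known
      to be finite before its real power means anything.\<close>
    then have Gfin: "G < \<infinity>"
      using Ifin by (metis ennreal_mult_less_top ennreal_less_top infinity_ennreal_def le_less_trans)
    have "enn2real G \<le> enn2real (ennreal (W powr q) * I)"
      using GI Ifin by (intro enn2real_mono) (auto simp: ennreal_mult_less_top)
    also have "\<dots> = W powr q * enn2real I" by (simp add: enn2real_mult)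
    finally have "(enn2real G / (2*pi)) powr (1/q) \<le> (W powr q * (enn2real I / (2*pi))) powr (1/q)"
      using q by (intro powr_mono2) (auto simp: divide_right_mono)
    also have "\<dots> = W * (enn2real I / (2*pi)) powr (1/q)"
      using W0 q by (subst powr_mult) (auto simp: powr_powr)
    finally have "ennreal ((enn2real G / (2*pi)) powr (1/q)) \<le> ennreal W * ennreal ((enn2real I / (2*pi)) powr (1/q))"
      using W0 by (simp add: ennreal_mult'[symmetric] ennreal_leI)
    then show ?thesis
      using False Ifin Gfin by (auto simp add: circle_norm_def Let_def q_def[symmetric] I_def[symmetric] G_def[symmetric] W_def)
  qed
qed

section \<open>Derivatives of the Poisson integral\<close>

text \<open>Kept as the kernel times a logarithmic derivative: moduli then factor, and only the
  second factor differs between the derivatives.\<close>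

definition poisson_dz :: "real \<Rightarrow> real \<Rightarrow> complex \<Rightarrow> complex" where
  "poisson_dz \<alpha> \<beta> z = poisson_kernel \<alpha> \<beta> z *
     (of_real (\<alpha> + 1) / (1 - z) - of_real (\<alpha> + \<beta> + 1) * cnj z / of_real (1 - (cmod z)\<^sup>2))"

definition poisson_dzbar :: "real \<Rightarrow> real \<Rightarrow> complex \<Rightarrow> complex" where
  "poisson_dzbar \<alpha> \<beta> z = poisson_kernel \<alpha> \<beta> z *
     (of_real (\<beta> + 1) / (1 - cnj z) - of_real (\<alpha> + \<beta> + 1) * z / of_real (1 - (cmod z)\<^sup>2))"

lemma disc_Re_pos: "cmod z < 1 \<Longrightarrow> Re (1 - z) > 0"
  using complex_Re_le_cmod[of z] by simp

text \<open>Keeps \<open>1 - z\<close> off the branch cut of the principal power.\<close>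

lemma disc_notin_nonpos: "cmod z < 1 \<Longrightarrow> 1 - z \<notin> \<real>\<^sub>\<le>\<^sub>0"
  using disc_Re_pos[of z] by (auto simp: complex_nonpos_Reals_iff)

lemma disc_sq_pos: "cmod z < 1 \<Longrightarrow> 1 - (cmod z)\<^sup>2 > 0"
  by (simp add: abs_square_less_1)

lemma poisson_kernel_alt:
  "poisson_kernel \<alpha> \<beta> z = of_real (c_coeff \<alpha> \<beta>) * (of_real ((1 - (cmod z)\<^sup>2) powr (\<alpha> + \<beta> + 1)) *
     ((1 - z) powr (- of_real (\<alpha> + 1)) * (1 - cnj z) powr (- of_real (\<beta> + 1))))"
  unfolding poisson_kernel_def powr_minus by (simp only: divide_inverse inverse_mult_distrib mult_ac)

lemma has_derivative_powr_one_minus: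
  assumes "cmod z < 1"
  shows "((\<lambda>z. (1 - z) powr (- c)) has_derivative (\<lambda>h. (1 - z) powr (- c) * (c / (1 - z) * h))) (at z)"
proof -
  have nz: "1 - z \<noteq> 0" using disc_notin_nonpos[OF assms] by auto
  have "((\<lambda>z. (1 - z) powr (- c)) has_field_derivative (1 - z) powr (- c) * (c / (1 - z))) (at z)"
    using disc_notin_nonpos[OF assms] nz
    by (auto intro!: derivative_eq_intros simp: powr_diff field_simps)
  then show ?thesis
    unfolding has_field_derivative_def
    by (rule has_derivative_eq_rhs) (simp add: fun_eq_iff mult.assoc)
qed

lemma has_derivative_disc_powr:
  assumes "cmod z < 1"
  shows "((\<lambda>z. complex_of_real ((1 - (cmod z)\<^sup>2) powr b)) has_derivative
    (\<lambda>h. of_real ((1 - (cmod z)\<^sup>2) powr b) * (- of_real b * (cnj z * h + z * cnj h) / of_real (1 - (cmod z)\<^sup>2)))) (at z)"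
proof -
  have "((\<lambda>z::complex. 1 - z \<bullet> z) has_derivative (\<lambda>h. - (2 * (z \<bullet> h)))) (at z)"
    by (auto intro!: derivative_eq_intros simp: inner_commute)
  then have 1: "((\<lambda>z. 1 - (cmod z)\<^sup>2) has_derivative (\<lambda>h. - (2 * (z \<bullet> h)))) (at z)"
    by (simp add: dot_square_norm)
  have 2: "((\<lambda>x. x powr b) has_derivative (\<lambda>y. (b * (1 - (cmod z)\<^sup>2) powr (b - 1)) * y)) (at (1 - (cmod z)\<^sup>2))"
    using disc_sq_pos[OF assms] unfolding has_field_derivative_def[symmetric]
    by (auto intro!: derivative_eq_intros)
  have 3: "((\<lambda>z. (1 - (cmod z)\<^sup>2) powr b) has_derivative
     (\<lambda>h. (b * (1 - (cmod z)\<^sup>2) powr (b - 1)) * (- (2 * (z \<bullet> h))))) (at z)"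
    using has_derivative_compose[OF 1 2] .
  have 4: "complex_of_real ((b * (1 - (cmod z)\<^sup>2) powr (b - 1)) * (- (2 * (z \<bullet> h)))) =
     of_real ((1 - (cmod z)\<^sup>2) powr b) * (- of_real b * (cnj z * h + z * cnj h) / of_real (1 - (cmod z)\<^sup>2))" for h
  proof -
    have "cnj z * h + z * cnj h = of_real (2 * (z \<bullet> h))"
      by (simp add: complex_eq_iff inner_complex_def)
    moreover have "(1 - (cmod z)\<^sup>2) powr (b - 1) = (1 - (cmod z)\<^sup>2) powr b / (1 - (cmod z)\<^sup>2)"
      using disc_sq_pos[OF assms] by (simp add: powr_diff)
    ultimately show ?thesis by simp
  qed
  show ?thesis
    using has_derivative_of_real[OF 3, where 'a = complex] unfolding 4 .
qed

text \<open>The kernel is not holomorphic, so its derivative is only real-linear. The coefficients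
  at h and at its conjugate are the two Wirtinger derivatives, and evaluation in suitable directions
  yields the radial, angular and Wirtinger derivatives alike.\<close>

lemma poisson_kernel_has_derivative:
  assumes z: "cmod z < 1"
  shows "(poisson_kernel \<alpha> \<beta> has_derivative
    (\<lambda>h. poisson_dz \<alpha> \<beta> z * h + poisson_dzbar \<alpha> \<beta> z * cnj h)) (at z)"
proof -
  have "((\<lambda>w. (1 - cnj w) powr (- of_real (\<beta> + 1))) has_derivative
      (\<lambda>h. (1 - cnj z) powr (- of_real (\<beta> + 1)) * (of_real (\<beta> + 1) / (1 - cnj z) * cnj h))) (at z)"
    by (rule has_derivative_compose[OF bounded_linear_imp_has_derivative[OF bounded_linear_cnj]
        has_derivative_powr_one_minus]) (simp add: z)
  note d = has_derivative_mult_right[OF has_derivative_mult[OF has_derivative_disc_powr[OF z, of "\<alpha> + \<beta> + 1"]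
    has_derivative_mult[OF has_derivative_powr_one_minus[OF z, of "of_real (\<alpha> + 1)"] this]], of "of_real (c_coeff \<alpha> \<beta>)"]
  have "poisson_kernel \<alpha> \<beta> = (\<lambda>z. of_real (c_coeff \<alpha> \<beta>) * (of_real ((1 - (cmod z)\<^sup>2) powr (\<alpha> + \<beta> + 1)) *
     ((1 - z) powr (- of_real (\<alpha> + 1)) * (1 - cnj z) powr (- of_real (\<beta> + 1)))))"
    by (rule ext) (rule poisson_kernel_alt)
  note d = d[folded this]
  show ?thesis
    by (rule has_derivative_eq_rhs[OF d])
       (simp only: poisson_dz_def poisson_dzbar_def fun_eq_iff poisson_kernel_alt divide_inverse ring_distribs
         mult_minus_left mult_minus_right mult_ac add_ac diff_conv_add_uminus simp_thms)
qed

lemma continuous_on_poisson_kernel: "continuous_on (ball 0 1) (poisson_kernel \<alpha> \<beta>)"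
  by (intro continuous_at_imp_continuous_on ballI has_derivative_continuous[OF poisson_kernel_has_derivative]) simp

lemma continuous_on_poisson_dz: "continuous_on (ball 0 1) (poisson_dz \<alpha> \<beta>)"
  unfolding poisson_dz_def
proof (intro continuous_intros continuous_on_poisson_kernel ballI)
  fix z :: complex assume "z \<in> ball 0 1"
  then have z: "cmod z < 1" by simp
  show "1 - z \<noteq> 0" using disc_notin_nonpos[OF z] by auto
  show "complex_of_real (1 - (cmod z)\<^sup>2) \<noteq> 0" using disc_sq_pos[OF z] of_real_eq_0_iff by (metis less_irrefl)
qed

lemma continuous_on_poisson_dzbar: "continuous_on (ball 0 1) (poisson_dzbar \<alpha> \<beta>)"
  unfolding poisson_dzbar_def
proof (intro continuous_intros continuous_on_poisson_kernel ballI)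
  fix z :: complex assume "z \<in> ball 0 1"
  then have z: "cmod z < 1" by simp
  show "1 - cnj z \<noteq> 0" using disc_notin_nonpos[of "cnj z"] z by auto
  show "complex_of_real (1 - (cmod z)\<^sup>2) \<noteq> 0" using disc_sq_pos[OF z] of_real_eq_0_iff by (metis less_irrefl)
qed

text \<open>Uniform continuity of the two partial derivatives on a compact disc makes the linearisation
  error uniform in the rotation angle, which is what allows differentiation under the integral.\<close>

lemma uniform_linearization:
  fixes P Q R :: "complex \<Rightarrow> complex"
  assumes d: "\<And>z. cmod z < 1 \<Longrightarrow> (P has_derivative (\<lambda>h. Q z * h + R z * cnj h)) (at z)"
    and Q: "continuous_on (ball 0 1) Q" and R: "continuous_on (ball 0 1) R"
    and r: "r < 1" and e: "e > 0"
  shows "\<exists>\<delta>>0. \<forall>w k. cmod w \<le> r \<longrightarrow> cmod k < \<delta> \<longrightarrow> cmod (P (w + k) - P w - (Q w * k + R w * cnj k)) \<le> e * cmod k"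
proof -
  \<comment> \<open>A radius strictly between \<open>r\<close> and 1: short steps from the disc of
    radius \<open>r\<close> stay in a compact disc on which \<open>Q\<close> and \<open>R\<close>
    are uniformly continuous.\<close>
  define \<rho> where "\<rho> = (r + 1) / 2"
  have \<rho>: "r < \<rho>" "\<rho> < 1" using r by (auto simp: \<rho>_def)
  have sub: "cball 0 \<rho> \<subseteq> ball (0::complex) 1" using \<rho> by auto
  have "uniformly_continuous_on (cball 0 \<rho>) Q" "uniformly_continuous_on (cball 0 \<rho>) R"
    using sub Q R by (auto intro!: compact_uniformly_continuous intro: continuous_on_subset)
  note uc = this
  obtain d1 where d1: "d1 > 0" "\<And>x y. x \<in> cball 0 \<rho> \<Longrightarrow> y \<in> cball 0 \<rho> \<Longrightarrow> dist y x < d1 \<Longrightarrow> dist (Q y) (Q x) < e/2"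
    by (rule uniformly_continuous_onE[OF uc(1) half_gt_zero[OF e]]) blast
  obtain d2 where d2: "d2 > 0" "\<And>x y. x \<in> cball 0 \<rho> \<Longrightarrow> y \<in> cball 0 \<rho> \<Longrightarrow> dist y x < d2 \<Longrightarrow> dist (R y) (R x) < e/2"
    by (rule uniformly_continuous_onE[OF uc(2) half_gt_zero[OF e]]) blast
  define \<delta> where "\<delta> = min (\<rho> - r) (min d1 d2)"
  have \<delta>: "\<delta> > 0" "\<delta> \<le> \<rho> - r" "\<delta> \<le> d1" "\<delta> \<le> d2" using \<rho> d1(1) d2(1) by (auto simp: \<delta>_def)
  have "cmod (P (w + k) - P w - (Q w * k + R w * cnj k)) \<le> e * cmod k" if w: "cmod w \<le> r" and k: "cmod k < \<delta>" for w k
  proof -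
    define S where "S = ball w \<delta>"
    have S: "x \<in> cball 0 \<rho>" if "x \<in> S" for x
      using that w \<delta>(2) norm_triangle_ineq2[of x w] by (auto simp: S_def dist_norm norm_minus_commute)
    have "cmod (P (w + k) - P w - (\<lambda>h. Q w * h + R w * cnj h) ((w + k) - w)) \<le> norm ((w + k) - w) * e"
    proof (rule differentiable_bound_linearization[where S = S and f' = "\<lambda>z h. Q z * h + R z * cnj h"])
      show "w + t *\<^sub>R (w + k - w) \<in> S" if "t \<in> {0..1}" for t
      proof -
        have "\<bar>t\<bar> * cmod k \<le> 1 * cmod k" using that by (intro mult_right_mono) auto
        then show ?thesis using k by (auto simp: S_def dist_norm)
      qed
      show "(P has_derivative (\<lambda>h. Q x * h + R x * cnj h)) (at x within S)" if "x \<in> S" for x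
        by (rule has_derivative_at_withinI[OF d]) (use S[OF that] \<rho>(2) in simp)
      show "w \<in> S" using \<delta> by (simp add: S_def)
      show "onorm ((\<lambda>h. Q x * h + R x * cnj h) - (\<lambda>h. Q w * h + R w * cnj h)) \<le> e" if x: "x \<in> S" for x
      proof (rule onorm_le)
        fix h
        have dx: "dist x w < \<delta>" using x by (simp add: S_def dist_commute)
        have wS: "w \<in> S" using \<delta> by (simp add: S_def)
        have "dist (Q x) (Q w) < e/2"
          by (rule d1(2)[OF S[OF wS] S[OF x]]) (use dx \<delta> in linarith)
        moreover have "dist (R x) (R w) < e/2"
          by (rule d2(2)[OF S[OF wS] S[OF x]]) (use dx \<delta> in linarith)
        ultimately have "cmod (Q x - Q w) \<le> e/2" "cmod (R x - R w) \<le> e/2"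
          by (simp_all add: dist_norm)
        then have "cmod ((Q x - Q w) * h) \<le> e/2 * cmod h" "cmod ((R x - R w) * cnj h) \<le> e/2 * cmod h"
          by (simp_all only: norm_mult complex_mod_cnj mult_right_mono norm_ge_zero)
        then show "norm (((\<lambda>h. Q x * h + R x * cnj h) - (\<lambda>h. Q w * h + R w * cnj h)) h) \<le> e * norm h"
          using norm_triangle_ineq[of "(Q x - Q w) * h" "(R x - R w) * cnj h"]
          by (simp add: algebra_simps)
      qed
    qed
    then show ?thesis by (simp add: mult.commute)
  qed
  with \<delta>(1) show ?thesis by blast
qed

lemma rotation_integrable:
  fixes P :: "complex \<Rightarrow> complex"
  assumes P: "continuous_on (ball 0 1) P" and z: "cmod z < 1" and g: "integrable circ g"
  shows "integrable circ (\<lambda>t. P (z * cis (- t)) * g t)"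
proof (rule circ_integrable_mult[OF _ g])
  show "continuous_on UNIV (\<lambda>t. P (z * cis (- t)))"
    using z by (intro continuous_on_compose2[OF P] continuous_intros continuous_on_cis) (auto simp: norm_mult)
qed

text \<open>Rotation by t turns the increment y - z into (y - z) e^{-it}, of the same length, so the
  linearisation error is at most one fixed multiple of |y - z| |g(t)| for all t and can be
  integrated. The factors e^{-it} and e^{it} produced by the chain rule are put with the
  data.\<close>

lemma rotation_integral_has_derivative:
  fixes P Q R :: "complex \<Rightarrow> complex"
  assumes d: "\<And>z. cmod z < 1 \<Longrightarrow> (P has_derivative (\<lambda>h. Q z * h + R z * cnj h)) (at z)"
    and Q: "continuous_on (ball 0 1) Q" and R: "continuous_on (ball 0 1) R"
    and g: "integrable circ g" and z: "cmod z < 1"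
  shows "((\<lambda>z. LINT t|circ. P (z * cis (- t)) * g t) has_derivative
    (\<lambda>h. (LINT t|circ. Q (z * cis (- t)) * (cis (- t) * g t)) * h + (LINT t|circ. R (z * cis (- t)) * (cis t * g t)) * cnj h)) (at z)"
proof -
  have P: "continuous_on (ball 0 1) P"
    by (intro continuous_at_imp_continuous_on ballI has_derivative_continuous[OF d]) simp
  have g1: "integrable circ (\<lambda>t. cis (- t) * g t)" and g2: "integrable circ (\<lambda>t. cis t * g t)"
    by (intro circ_integrable_mult g continuous_intros continuous_on_cis)+
  let ?A = "LINT t|circ. Q (z * cis (- t)) * (cis (- t) * g t)"
  let ?B = "LINT t|circ. R (z * cis (- t)) * (cis t * g t)"
  show ?thesis
    unfolding has_derivative_at_alt
  proof (intro conjI allI impI)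
    show "bounded_linear (\<lambda>h. ?A * h + ?B * cnj h)"
      by (intro bounded_linear_add bounded_linear_mult_right bounded_linear_compose[OF bounded_linear_mult_right bounded_linear_cnj])
    fix e :: real assume e: "e > 0"
    define G where "G = (LINT t|circ. cmod (g t))"
    have G0: "G \<ge> 0" unfolding G_def by (intro integral_nonneg_AE AE_I2) auto
    \<comment> \<open>The added 1 keeps the denominator positive when the data vanish.\<close>
    define e' where "e' = e / (G + 1)"
    have e': "e' > 0" "e' * G \<le> e" using e G0 by (auto simp: e'_def field_simps)
    obtain \<delta> where \<delta>: "\<delta> > 0" "\<And>w k. cmod w \<le> cmod z \<Longrightarrow> cmod k < \<delta> \<Longrightarrow>
        cmod (P (w + k) - P w - (Q w * k + R w * cnj k)) \<le> e' * cmod k"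
      using uniform_linearization[OF d Q R z e'(1)] by blast
    show "\<exists>d>0. \<forall>y. norm (y - z) < d \<longrightarrow> norm ((LINT t|circ. P (y * cis (- t)) * g t) - (LINT t|circ. P (z * cis (- t)) * g t)
        - (?A * (y - z) + ?B * cnj (y - z))) \<le> e * norm (y - z)"
    proof (intro exI conjI allI impI)
      show "min \<delta> (1 - cmod z) > 0" using \<delta>(1) z by simp
      fix y assume y: "norm (y - z) < min \<delta> (1 - cmod z)"
      then have y1: "cmod y < 1" using norm_triangle_ineq2[of y z] by simp
      note i = rotation_integrable[OF P y1 g] rotation_integrable[OF P z g]
        rotation_integrable[OF Q z g1] rotation_integrable[OF R z g2]
      have j: "integrable circ (\<lambda>t. (y - z) * (Q (z * cis (- t)) * (cis (- t) * g t)))"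
          "integrable circ (\<lambda>t. cnj (y - z) * (R (z * cis (- t)) * (cis t * g t)))"
        by (rule integrable_mult_right, rule i)+
      let ?E = "\<lambda>t. (P (y * cis (- t)) * g t - P (z * cis (- t)) * g t)
        - ((y - z) * (Q (z * cis (- t)) * (cis (- t) * g t)) + cnj (y - z) * (R (z * cis (- t)) * (cis t * g t)))"
      have eq: "(LINT t|circ. P (y * cis (- t)) * g t) - (LINT t|circ. P (z * cis (- t)) * g t)
        - (?A * (y - z) + ?B * cnj (y - z)) = (LINT t|circ. ?E t)"
        by (subst Bochner_Integration.integral_diff[OF Bochner_Integration.integrable_diff[OF i(1,2)] Bochner_Integration.integrable_add[OF j]],
            subst Bochner_Integration.integral_diff[OF i(1,2)], subst Bochner_Integration.integral_add[OF j],
            subst integral_mult_right_zero, subst integral_mult_right_zero) (rule arg_cong2[where f = minus], rule refl, rule arg_cong2[where f = plus]; rule mult.commute)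
      have "norm (LINT t|circ. ?E t) \<le> (LINT t|circ. norm (?E t))"
        by (rule integral_norm_bound)
      also have "\<dots> \<le> (LINT t|circ. e' * cmod (y - z) * cmod (g t))"
      proof (rule integral_mono)
        show "integrable circ (\<lambda>t. norm (?E t))"
          by (rule integrable_norm, rule Bochner_Integration.integrable_diff[OF Bochner_Integration.integrable_diff[OF i(1,2)] Bochner_Integration.integrable_add[OF j]])
        show "integrable circ (\<lambda>t. e' * cmod (y - z) * cmod (g t))" using g by auto
        fix t
        have eqt: "?E t = (P (z * cis (- t) + (y - z) * cis (- t)) - P (z * cis (- t))
           - (Q (z * cis (- t)) * ((y - z) * cis (- t)) + R (z * cis (- t)) * cnj ((y - z) * cis (- t)))) * g t"
        proof -
          have "z * cis (- t) + (y - z) * cis (- t) = y * cis (- t)"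
            by (simp add: algebra_simps)
          moreover have "cnj ((y - z) * cis (- t)) = cnj (y - z) * cis t" by (simp add: cis_cnj)
          ultimately show ?thesis
            by (simp only: left_diff_distrib[of _ _ "g t"] distrib_right[of _ _ "g t"] mult_ac)
              (simp only: right_diff_distrib[of "g t"] distrib_left[of "g t"] mult_ac)
        qed
        have "cmod (?E t) \<le> e' * cmod ((y - z) * cis (- t)) * cmod (g t)"
          unfolding eqt norm_mult[of _ "g t"] using y by (intro mult_right_mono \<delta>(2)) (auto simp: norm_mult)
        then show "norm (?E t) \<le> e' * cmod (y - z) * cmod (g t)" by (simp add: norm_mult)
      qed
      also have "\<dots> = e' * G * cmod (y - z)" by (simp add: G_def)
      also have "\<dots> \<le> e * cmod (y - z)" using e' by (intro mult_right_mono) auto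
      finally show "norm ((LINT t|circ. P (y * cis (- t)) * g t) - (LINT t|circ. P (z * cis (- t)) * g t)
        - (?A * (y - z) + ?B * cnj (y - z))) \<le> e * norm (y - z)"
        unfolding eq .
    qed
  qed
qed

section \<open>Radial, angular and Wirtinger derivatives of the Poisson integral\<close>

lemma vector_derivative_comp_has_derivative:
  assumes "(f has_derivative f') (at (g x))" "(g has_vector_derivative g') (at x)"
  shows "vector_derivative (\<lambda>x. f (g x)) (at x) = f' g'"
proof -
  have lin: "f' (y *\<^sub>R g') = y *\<^sub>R f' g'" for y
    using assms(1) by (intro linear_scale has_derivative_linear)
  have "((\<lambda>x. f (g x)) has_derivative (\<lambda>y. f' (y *\<^sub>R g'))) (at x)"
    using has_derivative_compose[of g "\<lambda>y. y *\<^sub>R g'" x UNIV f f'] assms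
    by (simp add: has_vector_derivative_def)
  then have "((\<lambda>x. f (g x)) has_vector_derivative f' g') (at x)"
    by (simp add: has_vector_derivative_def lin)
  then show ?thesis by (rule vector_derivative_at)
qed

definition poisson_integral_dz :: "real \<Rightarrow> real \<Rightarrow> (complex \<Rightarrow> complex) \<Rightarrow> complex \<Rightarrow> complex" where
  "poisson_integral_dz \<alpha> \<beta> f z =
     of_real (1 / (2*pi)) * (LINT t|circ. poisson_dz \<alpha> \<beta> (z * cis (- t)) * (cis (- t) * f (cis t)))"

definition poisson_integral_dzbar :: "real \<Rightarrow> real \<Rightarrow> (complex \<Rightarrow> complex) \<Rightarrow> complex \<Rightarrow> complex" where
  "poisson_integral_dzbar \<alpha> \<beta> f z =
     of_real (1 / (2*pi)) * (LINT t|circ. poisson_dzbar \<alpha> \<beta> (z * cis (- t)) * (cis t * f (cis t)))"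

lemma poisson_integral_has_derivative:
  assumes "integrable circ (\<lambda>t. f (cis t))" "cmod z < 1"
  shows "(poisson_integral \<alpha> \<beta> f has_derivative
    (\<lambda>h. poisson_integral_dz \<alpha> \<beta> f z * h + poisson_integral_dzbar \<alpha> \<beta> f z * cnj h)) (at z)"
proof -
  note d = has_derivative_mult_right[OF rotation_integral_has_derivative[OF poisson_kernel_has_derivative[where \<alpha> = \<alpha> and \<beta> = \<beta>]
    continuous_on_poisson_dz continuous_on_poisson_dzbar assms], of "of_real (1 / (2*pi))"]
  have "poisson_integral \<alpha> \<beta> f = (\<lambda>z. of_real (1 / (2*pi)) *
     (LINT t|circ. poisson_kernel \<alpha> \<beta> (z * cis (- t)) * f (cis t)))"
    by (rule ext) (rule poisson_integral_def)
  note d = d[folded this]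
  show ?thesis
    by (rule has_derivative_eq_rhs[OF d])
      (assumption, rule ext, simp only: poisson_integral_dz_def poisson_integral_dzbar_def distrib_left mult.assoc)
qed

lemma d_radial_poisson:
  assumes f: "integrable circ (\<lambda>t. f (cis t))" and r: "0 < r" "r < 1"
  shows "d_radial (poisson_integral \<alpha> \<beta> f) r \<theta> =
    poisson_integral_dz \<alpha> \<beta> f (of_real r * cis \<theta>) * cis \<theta> + poisson_integral_dzbar \<alpha> \<beta> f (of_real r * cis \<theta>) * cis (- \<theta>)"
proof -
  have "((\<lambda>\<rho>. complex_of_real \<rho> * cis \<theta>) has_vector_derivative cis \<theta>) (at r)"
    by (auto intro!: derivative_eq_intros)
  from vector_derivative_comp_has_derivative[OF poisson_integral_has_derivative[OF f] this] r
  show ?thesis unfolding d_radial_def by (simp add: norm_mult cis_cnj)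
qed

lemma d_angular_poisson:
  assumes f: "integrable circ (\<lambda>t. f (cis t))" and r: "0 < r" "r < 1"
  shows "d_angular (poisson_integral \<alpha> \<beta> f) r \<theta> =
    \<i> * of_real r * (poisson_integral_dz \<alpha> \<beta> f (of_real r * cis \<theta>) * cis \<theta> - poisson_integral_dzbar \<alpha> \<beta> f (of_real r * cis \<theta>) * cis (- \<theta>))"
proof -
  have "((\<lambda>\<phi>. complex_of_real r * cis \<phi>) has_vector_derivative of_real r * (\<i> * cis \<theta>)) (at \<theta>)"
    unfolding cis_conv_exp by (auto intro!: derivative_eq_intros has_vector_derivative_real_field)
  from vector_derivative_comp_has_derivative[OF poisson_integral_has_derivative[OF f] this] r
  show ?thesis unfolding d_angular_def by (simp add: norm_mult cis_cnj algebra_simps)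
qed

text \<open>The real-linear derivative is evaluated in the directions 1 and i; the Wirtinger
  combination cancels the coefficient of the conjugate.\<close>

lemma d_wirtinger_poisson:
  assumes f: "integrable circ (\<lambda>t. f (cis t))" and r: "0 < r" "r < 1"
  shows "d_wirtinger (poisson_integral \<alpha> \<beta> f) r \<theta> = poisson_integral_dz \<alpha> \<beta> f (of_real r * cis \<theta>)"
proof -
  define z where "z = of_real r * cis \<theta>"
  have z: "cmod z < 1" using r by (simp add: z_def norm_mult)
  have 1: "((\<lambda>x. Complex x (Im z)) has_vector_derivative 1) (at (Re z))"
    unfolding Complex_eq by (auto intro!: derivative_eq_intros)
  have 2: "((\<lambda>y. Complex (Re z) y) has_vector_derivative \<i>) (at (Im z))"
    unfolding Complex_eq by (auto intro!: derivative_eq_intros)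
  have d: "(poisson_integral \<alpha> \<beta> f has_derivative
    (\<lambda>h. poisson_integral_dz \<alpha> \<beta> f z * h + poisson_integral_dzbar \<alpha> \<beta> f z * cnj h)) (at (Complex (Re z) (Im z)))"
    using poisson_integral_has_derivative[OF f z] by simp
  show ?thesis
    unfolding d_wirtinger_def z_def[symmetric] wirtinger_def
      vector_derivative_comp_has_derivative[OF d 1] vector_derivative_comp_has_derivative[OF d 2]
    by (simp add: algebra_simps)
qed

section \<open>The three derivatives as convolutions on a fixed circle\<close>

definition radial_kernel :: "real \<Rightarrow> real \<Rightarrow> real \<Rightarrow> complex \<Rightarrow> complex" where
  "radial_kernel \<alpha> \<beta> r w =
     poisson_dz \<alpha> \<beta> (of_real r * w) * w + poisson_dzbar \<alpha> \<beta> (of_real r * w) * cnj w"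

definition angular_kernel :: "real \<Rightarrow> real \<Rightarrow> real \<Rightarrow> complex \<Rightarrow> complex" where
  "angular_kernel \<alpha> \<beta> r w =
     \<i> * of_real r * (poisson_dz \<alpha> \<beta> (of_real r * w) * w - poisson_dzbar \<alpha> \<beta> (of_real r * w) * cnj w)"

definition wirtinger_kernel :: "real \<Rightarrow> real \<Rightarrow> real \<Rightarrow> complex \<Rightarrow> complex" where
  "wirtinger_kernel \<alpha> \<beta> r w = poisson_dz \<alpha> \<beta> (of_real r * w)"

lemma continuous_on_disc_scaled:
  assumes "continuous_on (ball 0 1) P" "0 < r" "r < 1"
  shows "continuous_on (sphere 0 1) (\<lambda>w. P (complex_of_real r * w))"
  using assms(2,3) by (intro continuous_on_compose2[OF assms(1)] continuous_intros) (auto simp: norm_mult)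

lemma continuous_on_kernels:
  assumes "0 < r" "r < 1"
  shows "continuous_on (sphere 0 1) (radial_kernel \<alpha> \<beta> r)"
    and "continuous_on (sphere 0 1) (angular_kernel \<alpha> \<beta> r)"
    and "continuous_on (sphere 0 1) (wirtinger_kernel \<alpha> \<beta> r)"
  unfolding radial_kernel_def[abs_def] angular_kernel_def[abs_def] wirtinger_kernel_def[abs_def]
  by (intro continuous_intros continuous_on_disc_scaled continuous_on_poisson_dz continuous_on_poisson_dzbar assms)+

lemma kernel_integrable:
  assumes f: "integrable circ (\<lambda>t. f (cis t))" and r: "0 < r" "r < 1"
  shows "integrable circ (\<lambda>t. poisson_dz \<alpha> \<beta> (of_real r * cis \<theta> * cis (- t)) * (cis (- t) * f (cis t)))"
    and "integrable circ (\<lambda>t. poisson_dzbar \<alpha> \<beta> (of_real r * cis \<theta> * cis (- t)) * (cis t * f (cis t)))"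
proof -
  have g: "integrable circ (\<lambda>t. cis (- t) * f (cis t))" "integrable circ (\<lambda>t. cis t * f (cis t))"
    by (intro circ_integrable_mult f continuous_on_cis continuous_intros)+
  have z: "cmod (of_real r * cis \<theta>) < 1" using r by (simp add: norm_mult)
  show "integrable circ (\<lambda>t. poisson_dz \<alpha> \<beta> (of_real r * cis \<theta> * cis (- t)) * (cis (- t) * f (cis t)))"
    by (rule rotation_integrable[OF continuous_on_poisson_dz z g(1)])
  show "integrable circ (\<lambda>t. poisson_dzbar \<alpha> \<beta> (of_real r * cis \<theta> * cis (- t)) * (cis t * f (cis t)))"
    by (rule rotation_integrable[OF continuous_on_poisson_dzbar z g(2)])
qed

lemma d_radial_conv:
  assumes f: "integrable circ (\<lambda>t. f (cis t))" and r: "0 < r" "r < 1"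
  shows "d_radial (poisson_integral \<alpha> \<beta> f) r = circ_conv (radial_kernel \<alpha> \<beta> r) (\<lambda>t. f (cis t))"
proof
  fix \<theta>
  let ?c = "of_real (1 / (2*pi)) :: complex"
  let ?F = "\<lambda>t. poisson_dz \<alpha> \<beta> (of_real r * cis \<theta> * cis (- t)) * (cis (- t) * f (cis t))"
  let ?G = "\<lambda>t. poisson_dzbar \<alpha> \<beta> (of_real r * cis \<theta> * cis (- t)) * (cis t * f (cis t))"
  note i = kernel_integrable[OF f r, of \<alpha> \<beta> \<theta>]
  have "radial_kernel \<alpha> \<beta> r (cis (\<theta> - t)) * f (cis t) = ?F t * cis \<theta> + ?G t * cis (- \<theta>)" for t
  proof -
    have "cis (\<theta> - t) = cis \<theta> * cis (- t)" "cnj (cis (\<theta> - t)) = cis t * cis (- \<theta>)"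
      by (simp_all add: cis_mult cis_cnj)
    then show ?thesis unfolding radial_kernel_def by (simp add: algebra_simps)
  qed
  moreover have "(LINT t|circ. ?F t * cis \<theta> + ?G t * cis (- \<theta>)) =
     (LINT t|circ. ?F t) * cis \<theta> + (LINT t|circ. ?G t) * cis (- \<theta>)"
    by (subst Bochner_Integration.integral_add[OF integrable_mult_left[OF i(1)] integrable_mult_left[OF i(2)]])
      (simp only: integral_mult_left_zero)
  ultimately show "d_radial (poisson_integral \<alpha> \<beta> f) r \<theta> = circ_conv (radial_kernel \<alpha> \<beta> r) (\<lambda>t. f (cis t)) \<theta>"
    unfolding d_radial_poisson[OF f r] circ_conv_def poisson_integral_dz_def poisson_integral_dzbar_def
    by (simp only: distrib_left mult.assoc)
qed

lemma d_angular_conv: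
  assumes f: "integrable circ (\<lambda>t. f (cis t))" and r: "0 < r" "r < 1"
  shows "d_angular (poisson_integral \<alpha> \<beta> f) r = circ_conv (angular_kernel \<alpha> \<beta> r) (\<lambda>t. f (cis t))"
proof
  fix \<theta>
  let ?c = "of_real (1 / (2*pi)) :: complex"
  let ?F = "\<lambda>t. poisson_dz \<alpha> \<beta> (of_real r * cis \<theta> * cis (- t)) * (cis (- t) * f (cis t))"
  let ?G = "\<lambda>t. poisson_dzbar \<alpha> \<beta> (of_real r * cis \<theta> * cis (- t)) * (cis t * f (cis t))"
  note i = kernel_integrable[OF f r, of \<alpha> \<beta> \<theta>]
  have "angular_kernel \<alpha> \<beta> r (cis (\<theta> - t)) * f (cis t) =
     ?F t * (\<i> * of_real r * cis \<theta>) - ?G t * (\<i> * of_real r * cis (- \<theta>))" for t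
  proof -
    have "cis (\<theta> - t) = cis \<theta> * cis (- t)" "cnj (cis (\<theta> - t)) = cis t * cis (- \<theta>)"
      by (simp_all add: cis_mult cis_cnj)
    then show ?thesis unfolding angular_kernel_def by (simp add: algebra_simps)
  qed
  moreover have "(LINT t|circ. ?F t * (\<i> * of_real r * cis \<theta>) - ?G t * (\<i> * of_real r * cis (- \<theta>))) =
     (LINT t|circ. ?F t) * (\<i> * of_real r * cis \<theta>) - (LINT t|circ. ?G t) * (\<i> * of_real r * cis (- \<theta>))"
    by (subst Bochner_Integration.integral_diff[OF integrable_mult_left[OF i(1)] integrable_mult_left[OF i(2)]])
      (simp only: integral_mult_left_zero)
  ultimately show "d_angular (poisson_integral \<alpha> \<beta> f) r \<theta> = circ_conv (angular_kernel \<alpha> \<beta> r) (\<lambda>t. f (cis t)) \<theta>"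
    unfolding d_angular_poisson[OF f r] circ_conv_def poisson_integral_dz_def poisson_integral_dzbar_def
    by (simp only: right_diff_distrib mult_ac)
qed

text \<open>The chain-rule factor \<open>cis (- t)\<close> is assigned to the data rather than to
  the kernel; being unimodular it leaves the norm of the data unchanged.\<close>

lemma d_wirtinger_conv:
  assumes f: "integrable circ (\<lambda>t. f (cis t))" and r: "0 < r" "r < 1"
  shows "d_wirtinger (poisson_integral \<alpha> \<beta> f) r = circ_conv (wirtinger_kernel \<alpha> \<beta> r) (\<lambda>t. cis (- t) * f (cis t))"
proof
  fix \<theta>
  have "cis (\<theta> - t) = cis \<theta> * cis (- t)" for t by (simp add: cis_mult)
  then show "d_wirtinger (poisson_integral \<alpha> \<beta> f) r \<theta> = circ_conv (wirtinger_kernel \<alpha> \<beta> r) (\<lambda>t. cis (- t) * f (cis t)) \<theta>"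
    unfolding d_wirtinger_poisson[OF f r] circ_conv_def poisson_integral_dz_def wirtinger_kernel_def
    by (simp only: mult.assoc)
qed

section \<open>Change of variables by a disc automorphism\<close>

text \<open>Chosen for its effect on the kernel: 1 - r w becomes (1 - r^2) / (1 + r zeta), so the
  singular denominator turns into a numerator.\<close>

definition disc_automorphism :: "real \<Rightarrow> complex \<Rightarrow> complex" where
  "disc_automorphism r \<zeta> = (\<zeta> + of_real r) / (1 + of_real r * \<zeta>)"

lemma one_plus_nonzero:
  assumes "0 < r" "r < 1" "cmod \<zeta> = 1"
  shows "1 + of_real r * \<zeta> \<noteq> 0" "Re (1 + of_real r * \<zeta>) > 0" "1 + of_real r * \<zeta> \<notin> \<real>\<^sub>\<le>\<^sub>0"
proof -
  have "r * Re \<zeta> \<ge> - r"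
    using assms abs_Re_le_cmod[of \<zeta>] mult_left_mono[of "-1" "Re \<zeta>" r] by auto
  then show 1: "Re (1 + of_real r * \<zeta>) > 0" using assms by simp
  then show "1 + of_real r * \<zeta> \<noteq> 0" by (metis less_irrefl zero_complex.sel(1))
  show "1 + of_real r * \<zeta> \<notin> \<real>\<^sub>\<le>\<^sub>0" using 1 by (auto simp: complex_nonpos_Reals_iff)
qed

lemma cmod_one_plus_sq: "(cmod (1 + of_real r * cis s))\<^sup>2 = 1 + r\<^sup>2 + 2 * r * cos s"
proof -
  have "(cmod (1 + of_real r * cis s))\<^sup>2 = (1 + r * cos s)\<^sup>2 + (r * sin s)\<^sup>2"
    by (simp add: cmod_power2)
  also have "\<dots> = 1 + r\<^sup>2 + 2 * r * cos s"
    using sin_cos_squared_add[of s] by algebra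
  finally show ?thesis .
qed

lemma one_minus_disc_automorphism:
  assumes "0 < r" "r < 1" "cmod \<zeta> = 1"
  shows "1 - of_real r * disc_automorphism r \<zeta> = of_real (1 - r\<^sup>2) / (1 + of_real r * \<zeta>)"
  using one_plus_nonzero(1)[OF assms]
  by (simp add: disc_automorphism_def field_simps power2_eq_square)

lemma cmod_disc_automorphism:
  assumes "0 < r" "r < 1" "cmod \<zeta> = 1"
  shows "cmod (disc_automorphism r \<zeta>) = 1"
proof -
  have "\<zeta> * cnj \<zeta> = 1" using assms(3) by (simp add: complex_norm_square[symmetric])
  then have "\<zeta> + of_real r = \<zeta> * cnj (1 + of_real r * \<zeta>)"
    by (simp add: algebra_simps)
  then have "cmod (\<zeta> + of_real r) = cmod \<zeta> * cmod (1 + of_real r * \<zeta>)"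
    by (metis norm_mult complex_mod_cnj)
  then show ?thesis
    using one_plus_nonzero(1)[OF assms] assms(3) by (simp add: disc_automorphism_def norm_divide)
qed

text \<open>The automorphism lifts to the angle \<open>\<phi>(s) = s - 2 arg (1 + r e\<^sup>i\<^sup>s)\<close>, because
  \<open>\<zeta> + r = \<zeta> \<cdot> cnj (1 + r \<zeta>)\<close> on the circle.\<close>

lemma disc_automorphism_substitution:
  fixes h :: "complex \<Rightarrow> real"
  assumes r: "0 < r" "r < 1" and h: "continuous_on (sphere 0 1) h"
  shows "(LINT t|circ. h (cis t)) =
    (LINT s|circ. (1 - r\<^sup>2) / (cmod (1 + of_real r * cis s))\<^sup>2 * h (disc_automorphism r (cis s)))"
proof -
  define X where "X = (\<lambda>s. 1 + of_real r * cis s)"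
  define \<phi> where "\<phi> = (\<lambda>s. s - 2 * Im (Ln (X s)))"
  have X: "X s \<noteq> 0" "X s \<notin> \<real>\<^sub>\<le>\<^sub>0" for s
    using one_plus_nonzero[OF r, of "cis s"] by (simp_all add: X_def)
  have cX: "(cmod (X s))\<^sup>2 = 1 + r\<^sup>2 + 2 * r * cos s" for s
    using cmod_one_plus_sq by (simp add: X_def)
  have cp: "(cmod (X s))\<^sup>2 > 0" for s using X[of s] by simp
  have sq: "complex_of_real ((cmod (X s))\<^sup>2) = X s * cnj (X s)" for s
    by (metis complex_norm_square of_real_power)
  have contX: "continuous_on S X" for S
    unfolding X_def by (intro continuous_intros continuous_on_cis)
  have cis\<phi>: "cis (\<phi> s) = disc_automorphism r (cis s)" for s
  proof -
    have a: "cis (Im (Ln (X s))) = X s / of_real (cmod (X s))"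
      using cis_Arg[OF X(1)[of s]] Arg_eq_Im_Ln[OF X(1)[of s]] by (simp add: sgn_eq)
    have "cis (\<phi> s) = cis s * (cnj (cis (Im (Ln (X s)))) * cnj (cis (Im (Ln (X s)))))"
      by (simp add: \<phi>_def cis_cnj cis_mult)
    also have "\<dots> = cis s * (cnj (X s) * cnj (X s) / of_real ((cmod (X s))\<^sup>2))"
      unfolding a by (simp add: power2_eq_square)
    also note sq
    also have "cis s * (cnj (X s) * cnj (X s) / (X s * cnj (X s))) = cis s * cnj (X s) / X s"
      using X(1)[of s] by simp
    also have "cis s * cnj (X s) = cis s + of_real r"
      by (simp add: X_def algebra_simps cis_cnj cis_mult)
    finally show ?thesis by (simp add: disc_automorphism_def X_def)
  qed
  \<comment> \<open>With zeta = e^{is}, the derivative of the lift is 1 - 2 Im (i r zeta / (1 + r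
    zeta)), which simplifies to the Poisson factor (1 - r^2) / |1 + r zeta|^2.\<close>
  have d\<phi>: "(\<phi> has_field_derivative (1 - r\<^sup>2) / (cmod (X s))\<^sup>2) (at s within S)" for s S
  proof -
    have "(X has_vector_derivative of_real r * (\<i> * cis s)) (at s within S)"
      unfolding X_def cis_conv_exp
      by (auto intro!: derivative_eq_intros has_vector_derivative_real_field)
    moreover have "(Ln has_field_derivative inverse (X s)) (at (X s))"
      by (rule has_field_derivative_Ln[OF X(2)])
    ultimately have "((Ln \<circ> X) has_vector_derivative (of_real r * (\<i> * cis s) * inverse (X s))) (at s within S)"
      by (rule field_vector_diff_chain_within[OF _ has_field_derivative_at_within])
    from bounded_linear.has_vector_derivative[OF bounded_linear_Im this]
    have "((\<lambda>s. Im (Ln (X s))) has_field_derivative Im (of_real r * (\<i> * cis s) * inverse (X s))) (at s within S)"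
      by (simp add: has_real_derivative_iff_has_vector_derivative o_def)
    then have "(\<phi> has_field_derivative (1 - 2 * Im (of_real r * (\<i> * cis s) * inverse (X s)))) (at s within S)"
      unfolding \<phi>_def by (intro DERIV_diff DERIV_ident DERIV_cmult)
    moreover have "Im (of_real r * (\<i> * cis s) * inverse (X s)) = r * (cos s + r) / (cmod (X s))\<^sup>2"
    proof -
      have "inverse (X s) = cnj (X s) / of_real ((cmod (X s))\<^sup>2)"
        unfolding sq using X(1)[of s] by (simp add: field_simps)
      then have "of_real r * (\<i> * cis s) * inverse (X s) = \<i> * (of_real r * (cis s * cnj (X s)) / of_real ((cmod (X s))\<^sup>2))"
        by simp
      also have "cis s * cnj (X s) = cis s + of_real r"
        by (simp add: X_def algebra_simps cis_cnj cis_mult)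
      finally show ?thesis by (simp add: Im_divide_of_real)
    qed
    moreover have "1 - 2 * (r * (cos s + r) / (cmod (X s))\<^sup>2) = (1 - r\<^sup>2) / (cmod (X s))\<^sup>2"
    proof -
      have "1 + r\<^sup>2 + 2 * r * cos s \<noteq> 0" using cp[of s] unfolding cX by simp
      then show ?thesis unfolding cX by (simp add: divide_simps) (simp add: algebra_simps power2_eq_square)
    qed
    ultimately show ?thesis by (simp only:)
  qed
  \<comment> \<open>At both ends \<open>X\<close> is the positive number 1 + r, whose argument is 0,
    so the new range of integration is again a full period.\<close>
  have \<phi>0: "\<phi> 0 = 0" "\<phi> (2*pi) = 2*pi"
  proof -
    have "X 0 = of_real (1 + r)" "X (2*pi) = of_real (1 + r)" by (simp_all add: X_def)
    moreover have "Ln (of_real (1 + r)) = of_real (ln (1 + r))" using r by (intro Ln_of_real) simp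
    ultimately show "\<phi> 0 = 0" "\<phi> (2*pi) = 2*pi" unfolding \<phi>_def by simp_all
  qed
  have ch: "continuous_on S (\<lambda>t. h (cis t))" for S
    by (intro continuous_on_compose2[OF h] continuous_on_cis continuous_on_id) auto
  have "((\<lambda>s. ((1 - r\<^sup>2) / (cmod (X s))\<^sup>2) *\<^sub>R h (cis (\<phi> s))) has_integral (integral {\<phi> 0..\<phi> (2*pi)} (\<lambda>t. h (cis t)))) {0..2*pi}"
  \<comment> \<open>The term with the argument of \<open>X\<close> moves s by at most 2 pi, so this
    interval contains the range of the lift.\<close>
  proof (rule has_integral_substitution[where c = "-4*pi" and d = "4*pi" and g = \<phi> and f = "\<lambda>t. h (cis t)"])
    show "\<phi> ` {0..2*pi} \<subseteq> {-4*pi..4*pi}"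
    proof (rule image_subsetI)
      fix s assume "s \<in> {0..2*pi}"
      then show "\<phi> s \<in> {-4*pi..4*pi}"
        using Im_Ln_le_pi[OF X(1), of s] mpi_less_Im_Ln[OF X(1), of s] unfolding \<phi>_def atLeastAtMost_iff by linarith
    qed
  qed (simp_all add: \<phi>0 ch d\<phi>)
  then have "(LINT t|circ. h (cis t)) = integral {0..2*pi} (\<lambda>s. (1 - r\<^sup>2) / (cmod (X s))\<^sup>2 * h (cis (\<phi> s)))"
    using circ_integrable_continuous[OF ch] \<phi>0 by (simp add: lebesgue_integral_eq_integral integral_unique)
  also have "\<dots> = (LINT s|circ. (1 - r\<^sup>2) / (cmod (X s))\<^sup>2 * h (cis (\<phi> s)))"
  proof -
    have "continuous_on UNIV \<phi>" by (rule DERIV_continuous_on[OF d\<phi>])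
    then have "continuous_on UNIV (\<lambda>s. h (cis (\<phi> s)))"
      by (intro continuous_on_compose2[OF ch[of UNIV]]) auto
    then have "integrable circ (\<lambda>s. (1 - r\<^sup>2) / (cmod (X s))\<^sup>2 * h (cis (\<phi> s)))"
      using X(1) by (intro circ_integrable_continuous continuous_intros contX) auto
    then show ?thesis by (simp add: lebesgue_integral_eq_integral)
  qed
  finally show ?thesis by (simp add: cis\<phi> X_def)
qed

lemma cmod_powr_of_real: "z \<noteq> 0 \<Longrightarrow> cmod (z powr of_real b) = cmod z powr b"
  by (simp add: powr_def norm_exp)

lemma cmod_poisson_kernel:
  assumes "cmod z < 1"
  shows "cmod (poisson_kernel \<alpha> \<beta> z) =
    \<bar>c_coeff \<alpha> \<beta>\<bar> * (1 - (cmod z)\<^sup>2) powr (\<alpha> + \<beta> + 1) / cmod (1 - z) powr (\<alpha> + \<beta> + 2)"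
proof -
  have nz: "1 - z \<noteq> 0" "1 - cnj z \<noteq> 0"
    using disc_notin_nonpos[OF assms] disc_notin_nonpos[of "cnj z"] assms by auto
  have "cmod (1 - cnj z) = cmod (1 - z)" by (metis complex_cnj_diff complex_cnj_one complex_mod_cnj)
  then show ?thesis
    unfolding poisson_kernel_def norm_divide norm_mult cmod_powr_of_real[OF nz(1)] cmod_powr_of_real[OF nz(2)]
    by (simp add: powr_add[symmetric] add.commute add.left_commute)
qed

lemma one_minus_sq_pos: "0 < r \<Longrightarrow> r < 1 \<Longrightarrow> 1 - r\<^sup>2 > (0::real)"
  by (simp add: abs_square_less_1)

text \<open>Along the automorphism the Jacobian cancels all but the power \<open>\<alpha> + \<beta>\<close> of \<open>|1 + r \<zeta>|\<close>.\<close>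

lemma poisson_kernel_disc_automorphism:
  assumes r: "0 < r" "r < 1" and \<zeta>: "cmod \<zeta> = 1"
  shows "(1 - r\<^sup>2) / (cmod (1 + of_real r * \<zeta>))\<^sup>2 * cmod (poisson_kernel \<alpha> \<beta> (of_real r * disc_automorphism r \<zeta>)) =
    \<bar>c_coeff \<alpha> \<beta>\<bar> * cmod (1 + of_real r * \<zeta>) powr (\<alpha> + \<beta>)"
proof -
  let ?X = "cmod (1 + of_real r * \<zeta>)"
  have X: "?X > 0" using one_plus_nonzero(1)[OF r \<zeta>] by simp
  have q: "1 - r\<^sup>2 > 0" by (rule one_minus_sq_pos[OF r])
  have w: "cmod (of_real r * disc_automorphism r \<zeta>) = r"
    using cmod_disc_automorphism[OF r \<zeta>] r by (simp add: norm_mult)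
  have "cmod (of_real (1 - r\<^sup>2) / (1 + of_real r * \<zeta>)) = (1 - r\<^sup>2) / ?X"
    using q by (simp only: norm_divide norm_of_real abs_of_pos)
  then have "cmod (poisson_kernel \<alpha> \<beta> (of_real r * disc_automorphism r \<zeta>)) =
      \<bar>c_coeff \<alpha> \<beta>\<bar> * (1 - r\<^sup>2) powr (\<alpha> + \<beta> + 1) / ((1 - r\<^sup>2) / ?X) powr (\<alpha> + \<beta> + 2)"
    using w r one_minus_disc_automorphism[OF r \<zeta>] by (simp add: cmod_poisson_kernel)
  also have "\<dots> = \<bar>c_coeff \<alpha> \<beta>\<bar> * ?X powr (\<alpha> + \<beta> + 2) / (1 - r\<^sup>2)"
  proof -
    have "(1 - r\<^sup>2) powr (\<alpha> + \<beta> + 2) = (1 - r\<^sup>2) powr (\<alpha> + \<beta> + 1) * (1 - r\<^sup>2)"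
      using q by (simp add: powr_mult_base add.commute mult.commute)
    then show ?thesis using q X by (simp add: powr_divide)
  qed
  also have "?X powr (\<alpha> + \<beta> + 2) = ?X powr (\<alpha> + \<beta>) * ?X\<^sup>2"
    using X by (simp add: powr_add powr_numeral)
  finally show ?thesis using q X by simp
qed

text \<open>The factor 1 + r zeta cancels in w / (1 - r w), leaving (zeta + r) / (1 - r^2), and |w|
  = 1 makes the other term of the logarithmic derivative constant. What remains is affine in zeta or
  in its conjugate.\<close>

lemma poisson_dz_disc_automorphism:
  assumes r: "0 < r" "r < 1" and \<zeta>: "cmod \<zeta> = 1"
  defines "w \<equiv> disc_automorphism r \<zeta>"
  shows "poisson_dz \<alpha> \<beta> (of_real r * w) * w = poisson_kernel \<alpha> \<beta> (of_real r * w) *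
      ((of_real (\<alpha> + 1) * (\<zeta> + of_real r) - of_real (\<alpha> + \<beta> + 1) * of_real r) / of_real (1 - r\<^sup>2))"
    and "poisson_dzbar \<alpha> \<beta> (of_real r * w) * cnj w = poisson_kernel \<alpha> \<beta> (of_real r * w) *
      ((of_real (\<beta> + 1) * (cnj \<zeta> + of_real r) - of_real (\<alpha> + \<beta> + 1) * of_real r) / of_real (1 - r\<^sup>2))"
proof -
  have q: "complex_of_real (1 - r\<^sup>2) \<noteq> 0" using one_minus_sq_pos[OF r] of_real_eq_0_iff less_irrefl by metis
  note nz = one_plus_nonzero(1)[OF r \<zeta>]
  have cw: "cmod w = 1" unfolding w_def by (rule cmod_disc_automorphism[OF r \<zeta>])
  then have ww: "cnj w * w = 1" by (simp add: complex_norm_square[symmetric] mult.commute)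
  have m: "1 - (cmod (of_real r * w))\<^sup>2 = 1 - r\<^sup>2" using cw by (simp add: norm_mult)
  have 1: "w / (1 - of_real r * w) = (\<zeta> + of_real r) / of_real (1 - r\<^sup>2)"
    unfolding w_def one_minus_disc_automorphism[OF r \<zeta>] using nz q by (simp add: disc_automorphism_def)
  then have 2: "cnj w / (1 - of_real r * cnj w) = (cnj \<zeta> + of_real r) / of_real (1 - r\<^sup>2)"
    by (metis (no_types, lifting) complex_cnj_add complex_cnj_complex_of_real complex_cnj_diff complex_cnj_divide complex_cnj_mult complex_cnj_one)
  have "(of_real (\<alpha> + 1) / (1 - of_real r * w) - of_real (\<alpha> + \<beta> + 1) * cnj (of_real r * w) / of_real (1 - r\<^sup>2)) * w
     = of_real (\<alpha> + 1) * (w / (1 - of_real r * w)) - of_real (\<alpha> + \<beta> + 1) * of_real r * (cnj w * w) / of_real (1 - r\<^sup>2)"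
    by (simp add: algebra_simps)
  also have "\<dots> = (of_real (\<alpha> + 1) * (\<zeta> + of_real r) - of_real (\<alpha> + \<beta> + 1) * of_real r) / of_real (1 - r\<^sup>2)"
    unfolding 1 ww by (simp add: diff_divide_distrib)
  finally show "poisson_dz \<alpha> \<beta> (of_real r * w) * w = poisson_kernel \<alpha> \<beta> (of_real r * w) *
      ((of_real (\<alpha> + 1) * (\<zeta> + of_real r) - of_real (\<alpha> + \<beta> + 1) * of_real r) / of_real (1 - r\<^sup>2))"
    unfolding poisson_dz_def m by (simp only: mult.assoc)
  have "(of_real (\<beta> + 1) / (1 - cnj (of_real r * w)) - of_real (\<alpha> + \<beta> + 1) * (of_real r * w) / of_real (1 - r\<^sup>2)) * cnj w
     = of_real (\<beta> + 1) * (cnj w / (1 - of_real r * cnj w)) - of_real (\<alpha> + \<beta> + 1) * of_real r * (cnj w * w) / of_real (1 - r\<^sup>2)"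
    by (simp add: algebra_simps)
  also have "\<dots> = (of_real (\<beta> + 1) * (cnj \<zeta> + of_real r) - of_real (\<alpha> + \<beta> + 1) * of_real r) / of_real (1 - r\<^sup>2)"
    unfolding 2 ww by (simp add: diff_divide_distrib)
  finally show "poisson_dzbar \<alpha> \<beta> (of_real r * w) * cnj w = poisson_kernel \<alpha> \<beta> (of_real r * w) *
      ((of_real (\<beta> + 1) * (cnj \<zeta> + of_real r) - of_real (\<alpha> + \<beta> + 1) * of_real r) / of_real (1 - r\<^sup>2))"
    unfolding poisson_dzbar_def m by (simp only: mult.assoc)
qed

text \<open>Adding the two affine expressions leaves the constant -(\<alpha> + \<beta>) r, while
  subtracting them cancels the terms with \<alpha> + \<beta> + 1: this is the origin of the
  coefficients in \<open>A_fun\<close> and \<open>B_fun\<close>. For the Wirtinger kernel the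
  constant is -\<beta> r, whence the term with |\<beta>| r in \<open>C_fun\<close>.\<close>

lemma kernels_disc_automorphism:
  assumes r: "0 < r" "r < 1"
  defines "w \<equiv> \<lambda>s. disc_automorphism r (cis s)"
  shows "radial_kernel \<alpha> \<beta> r (w s) = poisson_kernel \<alpha> \<beta> (of_real r * w s) *
      (Complex ((\<alpha> + \<beta> + 2) * cos s - (\<alpha> + \<beta>) * r) ((\<alpha> - \<beta>) * sin s) / of_real (1 - r\<^sup>2))"
    and "angular_kernel \<alpha> \<beta> r (w s) = poisson_kernel \<alpha> \<beta> (of_real r * w s) *
      (\<i> * of_real r * Complex ((\<alpha> - \<beta>) * (cos s + r)) ((\<alpha> + \<beta> + 2) * sin s) / of_real (1 - r\<^sup>2))"
    and "wirtinger_kernel \<alpha> \<beta> r (w s) * w s = poisson_kernel \<alpha> \<beta> (of_real r * w s) *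
      ((of_real (\<alpha> + 1) * cis s - of_real (\<beta> * r)) / of_real (1 - r\<^sup>2))"
proof -
  have "disc_automorphism r (cis s) = w s" by (simp add: w_def)
  note p = poisson_dz_disc_automorphism[OF r norm_cis[of s], of \<alpha> \<beta>, unfolded this]
  have comb: "k * (x / q) + k * (y / q) = k * ((x + y) / q)" "k * (x / q) - k * (y / q) = k * ((x - y) / q)"
    for k x y q :: complex
    by (simp_all add: add_divide_distrib diff_divide_distrib distrib_left right_diff_distrib)
  have "(of_real (\<alpha> + 1) * (cis s + of_real r) - of_real (\<alpha> + \<beta> + 1) * of_real r) +
     (of_real (\<beta> + 1) * (cnj (cis s) + of_real r) - of_real (\<alpha> + \<beta> + 1) * of_real r) =
     Complex ((\<alpha> + \<beta> + 2) * cos s - (\<alpha> + \<beta>) * r) ((\<alpha> - \<beta>) * sin s)"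
    by (simp add: complex_eq_iff algebra_simps)
  then show "radial_kernel \<alpha> \<beta> r (w s) = poisson_kernel \<alpha> \<beta> (of_real r * w s) *
      (Complex ((\<alpha> + \<beta> + 2) * cos s - (\<alpha> + \<beta>) * r) ((\<alpha> - \<beta>) * sin s) / of_real (1 - r\<^sup>2))"
    unfolding radial_kernel_def p comb by (simp only:)
  have "(of_real (\<alpha> + 1) * (cis s + of_real r) - of_real (\<alpha> + \<beta> + 1) * of_real r) -
     (of_real (\<beta> + 1) * (cnj (cis s) + of_real r) - of_real (\<alpha> + \<beta> + 1) * of_real r) =
     Complex ((\<alpha> - \<beta>) * (cos s + r)) ((\<alpha> + \<beta> + 2) * sin s)"
    by (simp add: complex_eq_iff algebra_simps)
  then have "poisson_dz \<alpha> \<beta> (of_real r * w s) * w s - poisson_dzbar \<alpha> \<beta> (of_real r * w s) * cnj (w s) =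
     poisson_kernel \<alpha> \<beta> (of_real r * w s) * (Complex ((\<alpha> - \<beta>) * (cos s + r)) ((\<alpha> + \<beta> + 2) * sin s) / of_real (1 - r\<^sup>2))"
    unfolding p comb by (simp only:)
  then show "angular_kernel \<alpha> \<beta> r (w s) = poisson_kernel \<alpha> \<beta> (of_real r * w s) *
      (\<i> * of_real r * Complex ((\<alpha> - \<beta>) * (cos s + r)) ((\<alpha> + \<beta> + 2) * sin s) / of_real (1 - r\<^sup>2))"
    unfolding angular_kernel_def by (simp add: mult_ac)
  have "of_real (\<alpha> + 1) * (cis s + of_real r) - of_real (\<alpha> + \<beta> + 1) * of_real r =
     of_real (\<alpha> + 1) * cis s - of_real (\<beta> * r)"
    by (simp add: algebra_simps)
  then show "wirtinger_kernel \<alpha> \<beta> r (w s) * w s = poisson_kernel \<alpha> \<beta> (of_real r * w s) *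
      ((of_real (\<alpha> + 1) * cis s - of_real (\<beta> * r)) / of_real (1 - r\<^sup>2))"
    unfolding wirtinger_kernel_def p(1) by (simp only:)
qed

text \<open>The base is |1 + r e^{is}|^2, hence the exponent \<open>a / 2\<close>. The radius r = 1
  is allowed and gives the boundary integrals.\<close>

definition power_integral :: "(real \<Rightarrow> real) \<Rightarrow> real \<Rightarrow> real \<Rightarrow> real" where
  "power_integral \<phi> a r = (LINT s|circ. \<phi> s * (1 + r\<^sup>2 + 2 * r * cos s) powr (a / 2))"

lemma cmod_powr_eq_sq_powr:
  "cmod (1 + of_real r * cis s) powr a = (1 + r\<^sup>2 + 2 * r * cos s) powr (a / 2)"
proof (cases "1 + of_real r * cis s = 0")
  case True
  then show ?thesis using cmod_one_plus_sq[of r s] by simp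
next
  case False
  then have "cmod (1 + of_real r * cis s) powr a = ((cmod (1 + of_real r * cis s))\<^sup>2) powr (a / 2)"
    by (simp add: powr_powr flip: powr_numeral)
  then show ?thesis by (simp add: cmod_one_plus_sq)
qed

lemma J_eq_power_integral:
  "J_int \<alpha> \<beta> r = power_integral (\<lambda>_. 1) (\<alpha> + \<beta>) r"
  "Jc_int \<alpha> \<beta> r = power_integral (\<lambda>s. \<bar>cos s\<bar>) (\<alpha> + \<beta>) r"
  "Js_int \<alpha> \<beta> r = power_integral (\<lambda>s. \<bar>sin s\<bar>) (\<alpha> + \<beta>) r"
  unfolding J_int_def Jc_int_def Js_int_def power_integral_def cmod_powr_eq_sq_powr by simp_all

lemma base_pos:
  fixes r s :: real
  assumes "0 \<le> r" "r < 1"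
  shows "1 + r\<^sup>2 + 2 * r * cos s > 0"
proof -
  have "r * cos s \<ge> r * (-1)" using assms by (intro mult_left_mono) auto
  moreover have "(1 - r)\<^sup>2 > 0" using assms by simp
  ultimately show ?thesis by (simp add: power2_eq_square algebra_simps)
qed

lemma continuous_on_base_powr:
  fixes r :: real
  assumes "0 \<le> r" "r < 1"
  shows "continuous_on S (\<lambda>s::real. (1 + r\<^sup>2 + 2 * r * cos s) powr b)"
  using base_pos[OF assms] by (intro continuous_intros) (auto simp: less_le)

lemma power_integral_integrable:
  assumes "0 \<le> r" "r < 1" "continuous_on UNIV \<phi>"
  shows "integrable circ (\<lambda>s. \<phi> s * (1 + r\<^sup>2 + 2 * r * cos s) powr b)"
  by (intro circ_integrable_continuous continuous_on_mult assms continuous_on_base_powr)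

text \<open>The computation common to the three kernels: \<open>m s / (1 - r\<^sup>2)\<close> is the
  modulus of the affine factor, and the Jacobian times the Poisson kernel leaves only a power of |1
  + r zeta|.\<close>

lemma circ_mean_disc_automorphism:
  assumes r: "0 < r" "r < 1" and k: "continuous_on (sphere 0 1) k"
    and m: "\<And>s. cmod (k (disc_automorphism r (cis s))) =
      cmod (poisson_kernel \<alpha> \<beta> (of_real r * disc_automorphism r (cis s))) * (m s / (1 - r\<^sup>2))"
  shows "circ_mean k = \<bar>c_coeff \<alpha> \<beta>\<bar> / (2*pi) * power_integral m (\<alpha> + \<beta>) r / (1 - r\<^sup>2)"
proof -
  have "(LINT t|circ. cmod (k (cis t))) =
    (LINT s|circ. (1 - r\<^sup>2) / (cmod (1 + of_real r * cis s))\<^sup>2 * cmod (k (disc_automorphism r (cis s))))"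
    by (rule disc_automorphism_substitution[OF r]) (intro continuous_on_norm k)
  also have "\<dots> = (LINT s|circ. (\<bar>c_coeff \<alpha> \<beta>\<bar> / (1 - r\<^sup>2)) * (m s * (1 + r\<^sup>2 + 2 * r * cos s) powr ((\<alpha> + \<beta>) / 2)))"
  proof (rule Bochner_Integration.integral_cong[OF refl])
    fix s
    have "(1 - r\<^sup>2) / (cmod (1 + of_real r * cis s))\<^sup>2 * cmod (k (disc_automorphism r (cis s))) =
      ((1 - r\<^sup>2) / (cmod (1 + of_real r * cis s))\<^sup>2 * cmod (poisson_kernel \<alpha> \<beta> (of_real r * disc_automorphism r (cis s)))) * (m s / (1 - r\<^sup>2))"
      unfolding m by (simp only: mult.assoc)
    then show "(1 - r\<^sup>2) / (cmod (1 + of_real r * cis s))\<^sup>2 * cmod (k (disc_automorphism r (cis s))) =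
      (\<bar>c_coeff \<alpha> \<beta>\<bar> / (1 - r\<^sup>2)) * (m s * (1 + r\<^sup>2 + 2 * r * cos s) powr ((\<alpha> + \<beta>) / 2))"
      unfolding poisson_kernel_disc_automorphism[OF r norm_cis] cmod_powr_eq_sq_powr by simp
  qed
  finally show ?thesis by (simp add: circ_mean_def power_integral_def)
qed

lemma power_integral_mono:
  assumes "0 \<le> r" "r < 1" "continuous_on UNIV \<phi>" "continuous_on UNIV \<psi>" "\<And>s. \<phi> s \<le> \<psi> s"
  shows "power_integral \<phi> a r \<le> power_integral \<psi> a r"
  unfolding power_integral_def using assms
  by (intro integral_mono power_integral_integrable mult_right_mono) auto

lemma power_integral_combination:
  assumes r: "0 \<le> r" "r < 1"
  shows "power_integral (\<lambda>s. x + y * \<bar>cos s\<bar> + z * \<bar>sin s\<bar>) a r =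
    x * power_integral (\<lambda>_. 1) a r + y * power_integral (\<lambda>s. \<bar>cos s\<bar>) a r + z * power_integral (\<lambda>s. \<bar>sin s\<bar>) a r"
proof -
  have i: "integrable circ (\<lambda>s. 1 * (1 + r\<^sup>2 + 2 * r * cos s) powr (a/2))"
    "integrable circ (\<lambda>s. \<bar>cos s\<bar> * (1 + r\<^sup>2 + 2 * r * cos s) powr (a/2))"
    "integrable circ (\<lambda>s. \<bar>sin s\<bar> * (1 + r\<^sup>2 + 2 * r * cos s) powr (a/2))"
    by (intro power_integral_integrable r continuous_intros)+
  show ?thesis
    unfolding power_integral_def distrib_right mult.assoc[of x] mult.assoc[of y] mult.assoc[of z]
    using i by (simp add: distrib_right mult.assoc)
qed

lemma cmod_Complex_le: "cmod (Complex x y) \<le> \<bar>x\<bar> + \<bar>y\<bar>"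
  using complex_norm by (simp add: cmod_def sqrt_sum_squares_le_sum_abs)

lemma circ_mean_radial:
  assumes r: "0 < r" "r < 1"
  shows "circ_mean (radial_kernel \<alpha> \<beta> r) = \<bar>c_coeff \<alpha> \<beta>\<bar> / (2*pi) *
    power_integral (\<lambda>s. cmod (Complex ((\<alpha> + \<beta> + 2) * cos s - (\<alpha> + \<beta>) * r) ((\<alpha> - \<beta>) * sin s))) (\<alpha> + \<beta>) r / (1 - r\<^sup>2)"
  using one_minus_sq_pos[OF r]
  by (intro circ_mean_disc_automorphism r continuous_on_kernels)
    (simp only: kernels_disc_automorphism[OF r] norm_mult norm_divide norm_of_real abs_of_pos)

lemma circ_mean_angular:
  assumes r: "0 < r" "r < 1"
  shows "circ_mean (angular_kernel \<alpha> \<beta> r) = \<bar>c_coeff \<alpha> \<beta>\<bar> / (2*pi) *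
    power_integral (\<lambda>s. r * cmod (Complex ((\<alpha> - \<beta>) * (cos s + r)) ((\<alpha> + \<beta> + 2) * sin s))) (\<alpha> + \<beta>) r / (1 - r\<^sup>2)"
  using one_minus_sq_pos[OF r] r(1)
  by (intro circ_mean_disc_automorphism r continuous_on_kernels)
    (simp only: kernels_disc_automorphism[OF r] norm_mult norm_divide norm_of_real norm_ii abs_of_pos mult_1)

lemma circ_mean_wirtinger:
  assumes r: "0 < r" "r < 1"
  shows "circ_mean (wirtinger_kernel \<alpha> \<beta> r) = \<bar>c_coeff \<alpha> \<beta>\<bar> / (2*pi) *
    power_integral (\<lambda>s. cmod (of_real (\<alpha> + 1) * cis s - of_real (\<beta> * r))) (\<alpha> + \<beta>) r / (1 - r\<^sup>2)"
proof (intro circ_mean_disc_automorphism r continuous_on_kernels)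
  fix s
  \<comment> \<open>The unimodular factor is inserted because only the product has the affine
    form.\<close>
  have "cmod (wirtinger_kernel \<alpha> \<beta> r (disc_automorphism r (cis s))) =
    cmod (wirtinger_kernel \<alpha> \<beta> r (disc_automorphism r (cis s)) * disc_automorphism r (cis s))"
    using cmod_disc_automorphism[OF r norm_cis] by (simp add: norm_mult)
  then show "cmod (wirtinger_kernel \<alpha> \<beta> r (disc_automorphism r (cis s))) =
    cmod (poisson_kernel \<alpha> \<beta> (of_real r * disc_automorphism r (cis s))) *
      (cmod (of_real (\<alpha> + 1) * cis s - of_real (\<beta> * r)) / (1 - r\<^sup>2))"
    using one_minus_sq_pos[OF r]
    by (simp only: kernels_disc_automorphism[OF r] norm_mult norm_divide norm_of_real abs_of_pos)
qed

lemma circ_mean_radial_le: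
  assumes r: "0 < r" "r < 1" and ab: "\<alpha> + \<beta> > -1"
  shows "circ_mean (radial_kernel \<alpha> \<beta> r) \<le> A_fun \<alpha> \<beta> r / (1 - r\<^sup>2)"
proof -
  have r0: "0 \<le> r" using r by simp
  have "power_integral (\<lambda>s. cmod (Complex ((\<alpha> + \<beta> + 2) * cos s - (\<alpha> + \<beta>) * r) ((\<alpha> - \<beta>) * sin s))) (\<alpha> + \<beta>) r
    \<le> power_integral (\<lambda>s. \<bar>\<alpha> + \<beta>\<bar> * r + (\<alpha> + \<beta> + 2) * \<bar>cos s\<bar> + \<bar>\<alpha> - \<beta>\<bar> * \<bar>sin s\<bar>) (\<alpha> + \<beta>) r"
  proof (rule power_integral_mono[OF r0 r(2)])
    fix s
    have "\<bar>(\<alpha> + \<beta> + 2) * cos s - (\<alpha> + \<beta>) * r\<bar> \<le> \<bar>(\<alpha> + \<beta> + 2) * cos s\<bar> + \<bar>(\<alpha> + \<beta>) * r\<bar>" by linarith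
    then show "cmod (Complex ((\<alpha> + \<beta> + 2) * cos s - (\<alpha> + \<beta>) * r) ((\<alpha> - \<beta>) * sin s)) \<le>
      \<bar>\<alpha> + \<beta>\<bar> * r + (\<alpha> + \<beta> + 2) * \<bar>cos s\<bar> + \<bar>\<alpha> - \<beta>\<bar> * \<bar>sin s\<bar>"
      using cmod_Complex_le[of "(\<alpha> + \<beta> + 2) * cos s - (\<alpha> + \<beta>) * r" "(\<alpha> - \<beta>) * sin s"] ab r
      by (simp add: abs_mult)
  qed ((unfold cmod_def complex.sel)?, intro continuous_intros)+
  then have "\<bar>c_coeff \<alpha> \<beta>\<bar> / (2*pi) * power_integral (\<lambda>s. cmod (Complex ((\<alpha> + \<beta> + 2) * cos s - (\<alpha> + \<beta>) * r) ((\<alpha> - \<beta>) * sin s))) (\<alpha> + \<beta>) r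
    \<le> \<bar>c_coeff \<alpha> \<beta>\<bar> / (2*pi) * (\<bar>\<alpha> + \<beta>\<bar> * r * J_int \<alpha> \<beta> r + (\<alpha> + \<beta> + 2) * Jc_int \<alpha> \<beta> r + \<bar>\<alpha> - \<beta>\<bar> * Js_int \<alpha> \<beta> r)"
    unfolding power_integral_combination[OF r0 r(2)] J_eq_power_integral by (intro mult_left_mono) auto
  also have "\<dots> = A_fun \<alpha> \<beta> r"
    by (simp add: A_fun_def distrib_left)
  finally show ?thesis
    unfolding circ_mean_radial[OF r] using one_minus_sq_pos[OF r] by (intro divide_right_mono) auto
qed

text \<open>Besides the triangle inequality, the estimate gives away the factor r of the angular
  derivative, which is at most 1; this loss disappears only as r tends to 1.\<close>

lemma circ_mean_angular_le:
  assumes r: "0 < r" "r < 1" and ab: "\<alpha> + \<beta> > -1"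
  shows "circ_mean (angular_kernel \<alpha> \<beta> r) \<le> B_fun \<alpha> \<beta> r / (1 - r\<^sup>2)"
proof -
  have r0: "0 \<le> r" using r by simp
  have "power_integral (\<lambda>s. r * cmod (Complex ((\<alpha> - \<beta>) * (cos s + r)) ((\<alpha> + \<beta> + 2) * sin s))) (\<alpha> + \<beta>) r
    \<le> power_integral (\<lambda>s. \<bar>\<beta> - \<alpha>\<bar> * r + \<bar>\<beta> - \<alpha>\<bar> * \<bar>cos s\<bar> + (\<alpha> + \<beta> + 2) * \<bar>sin s\<bar>) (\<alpha> + \<beta>) r"
  proof (rule power_integral_mono[OF r0 r(2)])
    fix s
    have "\<bar>\<beta> - \<alpha>\<bar> * \<bar>cos s + r\<bar> \<le> \<bar>\<beta> - \<alpha>\<bar> * (\<bar>cos s\<bar> + r)" using r by (intro mult_left_mono) auto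
    moreover have "\<bar>(\<alpha> - \<beta>) * (cos s + r)\<bar> = \<bar>\<beta> - \<alpha>\<bar> * \<bar>cos s + r\<bar>"
      "\<bar>(\<alpha> + \<beta> + 2) * sin s\<bar> = (\<alpha> + \<beta> + 2) * \<bar>sin s\<bar>"
      using ab by (simp_all add: abs_mult abs_minus_commute)
    ultimately have "cmod (Complex ((\<alpha> - \<beta>) * (cos s + r)) ((\<alpha> + \<beta> + 2) * sin s)) \<le>
      \<bar>\<beta> - \<alpha>\<bar> * r + \<bar>\<beta> - \<alpha>\<bar> * \<bar>cos s\<bar> + (\<alpha> + \<beta> + 2) * \<bar>sin s\<bar>"
      using cmod_Complex_le[of "(\<alpha> - \<beta>) * (cos s + r)" "(\<alpha> + \<beta> + 2) * sin s"]
      unfolding distrib_left[of "\<bar>\<beta> - \<alpha>\<bar>"] by linarith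
    then show "r * cmod (Complex ((\<alpha> - \<beta>) * (cos s + r)) ((\<alpha> + \<beta> + 2) * sin s)) \<le>
      \<bar>\<beta> - \<alpha>\<bar> * r + \<bar>\<beta> - \<alpha>\<bar> * \<bar>cos s\<bar> + (\<alpha> + \<beta> + 2) * \<bar>sin s\<bar>"
      using r mult_right_mono[of r 1 "cmod (Complex ((\<alpha> - \<beta>) * (cos s + r)) ((\<alpha> + \<beta> + 2) * sin s))"] by simp
  qed ((unfold cmod_def complex.sel)?, intro continuous_intros)+
  then have "\<bar>c_coeff \<alpha> \<beta>\<bar> / (2*pi) * power_integral (\<lambda>s. r * cmod (Complex ((\<alpha> - \<beta>) * (cos s + r)) ((\<alpha> + \<beta> + 2) * sin s))) (\<alpha> + \<beta>) r
    \<le> \<bar>c_coeff \<alpha> \<beta>\<bar> / (2*pi) * (\<bar>\<beta> - \<alpha>\<bar> * r * J_int \<alpha> \<beta> r + \<bar>\<beta> - \<alpha>\<bar> * Jc_int \<alpha> \<beta> r + (\<alpha> + \<beta> + 2) * Js_int \<alpha> \<beta> r)"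
    unfolding power_integral_combination[OF r0 r(2)] J_eq_power_integral by (intro mult_left_mono) auto
  also have "\<dots> = B_fun \<alpha> \<beta> r"
    by (simp add: B_fun_def distrib_left)
  finally show ?thesis
    unfolding circ_mean_angular[OF r] using one_minus_sq_pos[OF r] by (intro divide_right_mono) auto
qed

lemma circ_mean_wirtinger_le:
  assumes r: "0 < r" "r < 1"
  shows "circ_mean (wirtinger_kernel \<alpha> \<beta> r) \<le> C_fun \<alpha> \<beta> r / (1 - r\<^sup>2)"
proof -
  have r0: "0 \<le> r" using r by simp
  have "power_integral (\<lambda>s. cmod (of_real (\<alpha> + 1) * cis s - of_real (\<beta> * r))) (\<alpha> + \<beta>) r
    \<le> power_integral (\<lambda>s. (\<bar>\<alpha> + 1\<bar> + \<bar>\<beta>\<bar> * r) + 0 * \<bar>cos s\<bar> + 0 * \<bar>sin s\<bar>) (\<alpha> + \<beta>) r"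
  proof (rule power_integral_mono[OF r0 r(2)])
    fix s
    show "cmod (of_real (\<alpha> + 1) * cis s - of_real (\<beta> * r)) \<le> (\<bar>\<alpha> + 1\<bar> + \<bar>\<beta>\<bar> * r) + 0 * \<bar>cos s\<bar> + 0 * \<bar>sin s\<bar>"
      using norm_triangle_ineq4[of "of_real (\<alpha> + 1) * cis s" "of_real (\<beta> * r)"] r
      unfolding norm_mult norm_of_real norm_cis by (simp add: abs_mult)
  qed (intro continuous_intros continuous_on_cis)+
  then have "\<bar>c_coeff \<alpha> \<beta>\<bar> / (2*pi) * power_integral (\<lambda>s. cmod (of_real (\<alpha> + 1) * cis s - of_real (\<beta> * r))) (\<alpha> + \<beta>) r
    \<le> \<bar>c_coeff \<alpha> \<beta>\<bar> / (2*pi) * ((\<bar>\<alpha> + 1\<bar> + \<bar>\<beta>\<bar> * r) * J_int \<alpha> \<beta> r)"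
    unfolding power_integral_combination[OF r0 r(2)] J_eq_power_integral by (intro mult_left_mono) auto
  also have "\<dots> = C_fun \<alpha> \<beta> r"
    by (simp add: C_fun_def)
  finally show ?thesis
    unfolding circ_mean_wirtinger[OF r] using one_minus_sq_pos[OF r] by (intro divide_right_mono) auto
qed

text \<open>For vanishing parameters the affine factor reduces to a single real or purely imaginary
  term, so the triangle inequality becomes an equality; the angular mean keeps its factor r.\<close>

lemma circ_mean_classical:
  assumes r: "0 < r" "r < 1"
  shows "circ_mean (radial_kernel 0 0 r) = A_fun 0 0 r / (1 - r\<^sup>2)"
    and "circ_mean (angular_kernel 0 0 r) = r * B_fun 0 0 r / (1 - r\<^sup>2)"
proof -
  have c: "cmod (Complex x 0) = \<bar>x\<bar>" "cmod (Complex 0 x) = \<bar>x\<bar>" for x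
    by (simp_all add: cmod_def)
  show "circ_mean (radial_kernel 0 0 r) = A_fun 0 0 r / (1 - r\<^sup>2)"
    unfolding circ_mean_radial[OF r] A_fun_def J_eq_power_integral
    by (simp add: c abs_mult power_integral_def mult.assoc)
  show "circ_mean (angular_kernel 0 0 r) = r * B_fun 0 0 r / (1 - r\<^sup>2)"
    unfolding circ_mean_angular[OF r] B_fun_def J_eq_power_integral
    by (simp add: c abs_mult power_integral_def mult.assoc)
qed

section \<open>Monotonicity of the weighted integrals\<close>

lemma circ_shift_integral:
  assumes "continuous_on UNIV f" "\<And>t. f (t + 2*pi) = (f t :: real)"
  shows "(LINT t|circ. f (t + x)) = (LINT t|circ. f t)"
  by (rule periodic_integral(1)[OF assms])

text \<open>The sum of the base powers at s and s + pi, for x = cos s. With y = 2 r x / (1 + r^2) it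
  equals (1 + r^2)^b ((1 + y)^b + (1 - y)^b), and it depends only on |x|.\<close>

definition even_base :: "real \<Rightarrow> real \<Rightarrow> real \<Rightarrow> real" where
  "even_base b r x = (1 + r\<^sup>2 + 2 * r * x) powr b + (1 + r\<^sup>2 - 2 * r * x) powr b"

lemma even_base_pos:
  fixes r x :: real
  assumes "0 \<le> r" "r < 1" "\<bar>x\<bar> \<le> 1"
  shows "1 + r\<^sup>2 + 2 * r * x > 0" "1 + r\<^sup>2 - 2 * r * x > 0"
proof -
  have "r * x \<ge> r * (-1)" "r * x \<le> r * 1" using assms by (intro mult_left_mono; simp)+
  moreover have "(1 - r)\<^sup>2 > 0" using assms by simp
  ultimately show "1 + r\<^sup>2 + 2 * r * x > 0" "1 + r\<^sup>2 - 2 * r * x > 0"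
    by (simp_all add: power2_eq_square algebra_simps)
qed

lemma even_base_abs: "even_base b r \<bar>x\<bar> = even_base b r x"
  by (cases "x \<ge> 0") (auto simp: even_base_def)

lemma continuous_on_even_base:
  fixes f :: "real \<Rightarrow> real"
  assumes "0 \<le> r" "r < 1" "continuous_on S f" "\<And>s. \<bar>f s\<bar> \<le> 1"
  shows "continuous_on S (\<lambda>s. even_base b r (f s))"
  unfolding even_base_def using even_base_pos[OF assms(1,2,4)]
  by (intro continuous_intros assms) (auto simp: less_le)

text \<open>Adding the integrals shifted by 0 and by pi symmetrises the base when the weight has
  period pi. A further quarter turn replaces cosine by sine in the base and moves the weight
  instead.\<close>

lemma power_integral_even:
  assumes r: "0 \<le> r" "r < 1" and \<phi>: "continuous_on UNIV \<phi>" "\<And>s. \<phi> (s + pi) = \<phi> s"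
  shows "2 * power_integral \<phi> a r = (LINT s|circ. \<phi> s * even_base (a/2) r (cos s))"
    and "2 * power_integral \<phi> a r = (LINT s|circ. \<phi> (s + pi/2) * even_base (a/2) r (sin s))"
proof -
  let ?f = "\<lambda>s. \<phi> s * (1 + r\<^sup>2 + 2 * r * cos s) powr (a / 2)"
  have c: "continuous_on UNIV ?f"
    by (intro continuous_on_mult \<phi>(1) continuous_on_base_powr r)
  have p: "\<phi> (s + 2*pi) = \<phi> s" for s using \<phi>(2)[of "s + pi"] \<phi>(2)[of s] by (simp add: add.assoc)
  then have p': "?f (s + 2*pi) = ?f s" for s by simp
  have sh: "(LINT s|circ. ?f (s + pi)) = (LINT s|circ. ?f s)"
    by (rule circ_shift_integral[OF c p'])
  have c2: "continuous_on UNIV (\<lambda>s. ?f (s + pi))"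
    by (intro continuous_on_compose2[OF c]) (auto intro!: continuous_intros)
  have "2 * power_integral \<phi> a r = (LINT s|circ. ?f s) + (LINT s|circ. ?f (s + pi))"
    unfolding sh by (simp add: power_integral_def)
  also have "\<dots> = (LINT s|circ. ?f s + ?f (s + pi))"
    by (rule Bochner_Integration.integral_add[symmetric]) (intro circ_integrable_continuous c c2)+
  also have "\<dots> = (LINT s|circ. \<phi> s * even_base (a/2) r (cos s))"
    by (intro Bochner_Integration.integral_cong refl) (simp add: even_base_def \<phi>(2) distrib_left)
  finally show 1: "2 * power_integral \<phi> a r = (LINT s|circ. \<phi> s * even_base (a/2) r (cos s))" .
  have "(LINT s|circ. \<phi> (s + pi/2) * even_base (a/2) r (cos (s + pi/2))) = (LINT s|circ. \<phi> s * even_base (a/2) r (cos s))"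
    by (rule circ_shift_integral[where f = "\<lambda>s. \<phi> s * even_base (a/2) r (cos s)"])
      (use r in \<open>auto intro!: continuous_on_mult \<phi>(1) continuous_on_even_base continuous_intros simp: p\<close>)
  moreover have "even_base (a/2) r (cos (s + pi/2)) = even_base (a/2) r (sin s)" for s
    using even_base_abs[of "a/2" r "sin s"] even_base_abs[of "a/2" r "cos (s + pi/2)"] by (simp add: cos_add)
  ultimately show "2 * power_integral \<phi> a r = (LINT s|circ. \<phi> (s + pi/2) * even_base (a/2) r (sin s))"
    using 1 by simp
qed

abbreviation "abs_cos \<equiv> \<lambda>s::real. \<bar>cos s\<bar>"
abbreviation "abs_sin \<equiv> \<lambda>s::real. \<bar>sin s\<bar>"

text \<open>Both representations of each integral are used. A quarter turn exchanges the weights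
  |cos| and |sin|, so the four terms combine into one product; as in Chebyshev's integral
  inequality, its sign is decided by the monotonicity of \<open>even_base\<close>.\<close>

lemma cos_sin_difference:
  assumes r: "0 \<le> r" "r < 1"
  shows "4 * (power_integral abs_cos a r - power_integral abs_sin a r) =
    (LINT s|circ. (\<bar>cos s\<bar> - \<bar>sin s\<bar>) * (even_base (a/2) r (cos s) - even_base (a/2) r (sin s)))"
proof -
  have cc: "continuous_on UNIV (\<lambda>s. even_base (a/2) r (cos s))" "continuous_on UNIV (\<lambda>s. even_base (a/2) r (sin s))"
    using r by (auto intro!: continuous_on_even_base continuous_intros)
  have i: "integrable circ (\<lambda>s. \<bar>cos s\<bar> * even_base (a/2) r (cos s))" "integrable circ (\<lambda>s. \<bar>sin s\<bar> * even_base (a/2) r (sin s))"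
    "integrable circ (\<lambda>s. \<bar>sin s\<bar> * even_base (a/2) r (cos s))" "integrable circ (\<lambda>s. \<bar>cos s\<bar> * even_base (a/2) r (sin s))"
    by (intro circ_integrable_continuous continuous_on_mult cc continuous_intros)+
  have C: "continuous_on UNIV abs_cos" "continuous_on UNIV abs_sin" by (intro continuous_intros)+
  note e = power_integral_even[OF r C(1), of a] power_integral_even[OF r C(2), of a]
  have "(\<bar>cos s\<bar> - \<bar>sin s\<bar>) * (even_base (a/2) r (cos s) - even_base (a/2) r (sin s)) =
     (\<bar>cos s\<bar> * even_base (a/2) r (cos s) + \<bar>sin s\<bar> * even_base (a/2) r (sin s))
      - (\<bar>sin s\<bar> * even_base (a/2) r (cos s) + \<bar>cos s\<bar> * even_base (a/2) r (sin s))" for s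
    by (simp add: algebra_simps)
  then show ?thesis
    using e i by (simp add: cos_add sin_add)
qed

text \<open>The derivative is 2 r b times the difference of the (b - 1)-th powers of a larger and a
  smaller base, so its sign turns at b = 1. This is the source of the case distinction at \<alpha> +
  \<beta> = 2.\<close>

lemma even_base_mono:
  assumes r: "0 \<le> r" "r < 1" and xy: "0 \<le> x" "x \<le> y" "y \<le> 1"
  shows "1 \<le> b \<Longrightarrow> even_base b r x \<le> even_base b r y"
    and "0 \<le> b \<Longrightarrow> b \<le> 1 \<Longrightarrow> even_base b r y \<le> even_base b r x"
proof -
  define D where "D = (\<lambda>x. 2 * r * b * ((1 + r\<^sup>2 + 2 * r * x) powr (b - 1) - (1 + r\<^sup>2 - 2 * r * x) powr (b - 1)))"
  have d: "(even_base b r has_real_derivative D t) (at t)" if "x \<le> t" "t \<le> y" for t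
  proof -
    have "\<bar>t\<bar> \<le> 1" using that xy by simp
    note p = even_base_pos[OF r this]
    have 1: "((\<lambda>x. 1 + r\<^sup>2 + 2 * r * x) has_real_derivative 2 * r) (at t)"
      by (auto intro!: derivative_eq_intros)
    have 2: "((\<lambda>x. 1 + r\<^sup>2 - 2 * r * x) has_real_derivative - (2 * r)) (at t)"
      by (auto intro!: derivative_eq_intros)
    have "even_base b r = (\<lambda>x. (1 + r\<^sup>2 + 2 * r * x) powr b + (1 + r\<^sup>2 - 2 * r * x) powr b)"
      by (simp add: fun_eq_iff even_base_def)
    moreover have "D t = b * (1 + r\<^sup>2 + 2 * r * t) powr (b - of_nat 1) * (2 * r) + b * (1 + r\<^sup>2 - 2 * r * t) powr (b - of_nat 1) * - (2 * r)"
      by (simp add: D_def right_diff_distrib)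
    ultimately show ?thesis
      using DERIV_add[OF DERIV_fun_powr[OF 1 p(1), of b] DERIV_fun_powr[OF 2 p(2), of b]] by (simp only:)
  qed
  have le: "1 + r\<^sup>2 - 2 * r * t \<le> 1 + r\<^sup>2 + 2 * r * t" "1 + r\<^sup>2 - 2 * r * t > 0" if "x \<le> t" "t \<le> y" for t
    using that xy r even_base_pos(2)[of r t] by auto
  { assume b: "1 \<le> b"
    have D: "D t \<ge> 0" if "x \<le> t" "t \<le> y" for t
      using le[OF that] b r powr_mono2[of "b - 1" "1 + r\<^sup>2 - 2 * r * t" "1 + r\<^sup>2 + 2 * r * t"] by (simp add: D_def)
    show "even_base b r x \<le> even_base b r y"
      by (rule DERIV_nonneg_imp_nondecreasing[OF xy(2)]) (blast intro: d D) }
  { assume b: "0 \<le> b" "b \<le> 1"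
    have D: "D t \<le> 0" if "x \<le> t" "t \<le> y" for t
      using le[OF that] b r powr_mono2'[of "b - 1" "1 + r\<^sup>2 - 2 * r * t" "1 + r\<^sup>2 + 2 * r * t"]
      by (auto simp: D_def intro!: mult_nonneg_nonpos)
    show "even_base b r y \<le> even_base b r x"
      by (rule DERIV_nonpos_imp_nonincreasing[OF xy(2)]) (blast intro: d D) }
qed

text \<open>Both factors of the integrand in \<open>cos_sin_difference\<close> compare |cos s| with
  |sin s|, so the integrand has the same sign at every s.\<close>

lemma cos_sin_comparison:
  assumes r: "0 \<le> r" "r < 1"
  shows "2 \<le> a \<Longrightarrow> power_integral abs_sin a r \<le> power_integral abs_cos a r"
    and "0 \<le> a \<Longrightarrow> a \<le> 2 \<Longrightarrow> power_integral abs_cos a r \<le> power_integral abs_sin a r"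
proof -
  let ?H = "even_base (a/2) r"
  { assume a: "2 \<le> a"
    have "0 \<le> (\<bar>cos s\<bar> - \<bar>sin s\<bar>) * (?H (cos s) - ?H (sin s))" for s
    proof (cases "\<bar>sin s\<bar> \<le> \<bar>cos s\<bar>")
      case True
      then have "?H \<bar>sin s\<bar> \<le> ?H \<bar>cos s\<bar>" using a by (intro even_base_mono(1)[OF r]) auto
      then show ?thesis using True by (simp add: even_base_abs)
    next
      case False
      then have "?H \<bar>cos s\<bar> \<le> ?H \<bar>sin s\<bar>" using a by (intro even_base_mono(1)[OF r]) auto
      then show ?thesis using False by (auto simp add: even_base_abs intro!: mult_nonpos_nonpos)
    qed
    then have "0 \<le> 4 * (power_integral abs_cos a r - power_integral abs_sin a r)"
      unfolding cos_sin_difference[OF r] by (intro integral_nonneg_AE AE_I2) auto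
    then show "power_integral abs_sin a r \<le> power_integral abs_cos a r" by simp }
  { assume a: "0 \<le> a" "a \<le> 2"
    have "0 \<le> - ((\<bar>cos s\<bar> - \<bar>sin s\<bar>) * (?H (cos s) - ?H (sin s)))" for s
    proof (cases "\<bar>sin s\<bar> \<le> \<bar>cos s\<bar>")
      case True
      then have "?H \<bar>cos s\<bar> \<le> ?H \<bar>sin s\<bar>" using a by (intro even_base_mono(2)[OF r]) auto
      then show ?thesis using True by (auto simp add: even_base_abs intro!: mult_nonneg_nonpos)
    next
      case False
      then have "?H \<bar>sin s\<bar> \<le> ?H \<bar>cos s\<bar>" using a by (intro even_base_mono(2)[OF r]) auto
      then show ?thesis using False by (auto simp add: even_base_abs intro!: mult_nonpos_nonneg)
    qed
    then have "0 \<le> (LINT s|circ. - ((\<bar>cos s\<bar> - \<bar>sin s\<bar>) * (?H (cos s) - ?H (sin s))))"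
      by (intro integral_nonneg_AE AE_I2) auto
    then have "4 * (power_integral abs_cos a r - power_integral abs_sin a r) \<le> 0"
      unfolding cos_sin_difference[OF r] by simp
    then show "power_integral abs_cos a r \<le> power_integral abs_sin a r" by simp }
qed

text \<open>In the derivative with respect to the radius t, the terms with 2 t are nonnegative on
  their own, and those with 2 x form a difference of (b - 1)-th powers that is nonnegative for b >=
  1.\<close>

lemma even_base_mono_radius:
  assumes b: "1 \<le> b" and x: "0 \<le> x" "x \<le> 1" and rR: "0 \<le> r" "r \<le> R" "R < 1"
  shows "even_base b r x \<le> even_base b R x"
proof -
  let ?D = "\<lambda>t. b * ((2 * t + 2 * x) * (1 + t\<^sup>2 + 2 * t * x) powr (b - 1) + (2 * t - 2 * x) * (1 + t\<^sup>2 - 2 * t * x) powr (b - 1))"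
  show ?thesis
  proof (rule DERIV_nonneg_imp_nondecreasing[OF rR(2), where f = "\<lambda>t. even_base b t x"], intro exI conjI)
    fix t assume t: "r \<le> t" "t \<le> R"
    then have t0: "0 \<le> t" "t < 1" using rR by auto
    have x1: "\<bar>x\<bar> \<le> 1" using x by simp
    note p = even_base_pos[OF t0 x1]
    show "((\<lambda>t. even_base b t x) has_real_derivative ?D t) (at t)"
    proof -
      have 1: "((\<lambda>t. 1 + t\<^sup>2 + 2 * t * x) has_real_derivative 2 * t + 2 * x) (at t)"
        by (auto intro!: derivative_eq_intros)
      have 2: "((\<lambda>t. 1 + t\<^sup>2 - 2 * t * x) has_real_derivative 2 * t - 2 * x) (at t)"
        by (auto intro!: derivative_eq_intros)
      have "?D t = b * (1 + t\<^sup>2 + 2 * t * x) powr (b - of_nat 1) * (2 * t + 2 * x) + b * (1 + t\<^sup>2 - 2 * t * x) powr (b - of_nat 1) * (2 * t - 2 * x)"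
        unfolding distrib_left[of b] of_nat_1 by (simp only: mult_ac)
      then show ?thesis
        unfolding even_base_def
        using DERIV_add[OF DERIV_fun_powr[OF 1 p(1), of b] DERIV_fun_powr[OF 2 p(2), of b]] by (simp only:)
    qed
    have "(1 + t\<^sup>2 - 2 * t * x) powr (b - 1) \<le> (1 + t\<^sup>2 + 2 * t * x) powr (b - 1)"
      using p b t0 x by (intro powr_mono2) auto
    then have "2 * x * (1 + t\<^sup>2 - 2 * t * x) powr (b - 1) \<le> 2 * x * (1 + t\<^sup>2 + 2 * t * x) powr (b - 1)"
      using x by (intro mult_left_mono) auto
    moreover have "2 * t * (1 + t\<^sup>2 - 2 * t * x) powr (b - 1) \<ge> 0" "2 * t * (1 + t\<^sup>2 + 2 * t * x) powr (b - 1) \<ge> 0"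
      using t0 by auto
    ultimately show "0 \<le> ?D t"
      using b unfolding distrib_right left_diff_distrib by (intro mult_nonneg_nonneg) linarith+
  qed
qed

lemma power_integral_cos_mono:
  assumes a: "2 \<le> a" and rR: "0 \<le> r" "r \<le> R" "R < 1"
  shows "power_integral abs_cos a r \<le> power_integral abs_cos a R"
proof -
  have C: "continuous_on UNIV abs_cos" by (intro continuous_intros)
  have r1: "r < 1" "0 \<le> R" using rR by auto
  have i: "integrable circ (\<lambda>s. \<bar>cos s\<bar> * even_base (a/2) q (cos s))" if "0 \<le> q" "q < 1" for q
    using that by (auto intro!: circ_integrable_continuous continuous_on_mult continuous_on_even_base continuous_intros)
  have "2 * power_integral abs_cos a r = (LINT s|circ. \<bar>cos s\<bar> * even_base (a/2) r (cos s))"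
    by (rule power_integral_even[OF rR(1) r1(1) C]) simp
  also have "\<dots> \<le> (LINT s|circ. \<bar>cos s\<bar> * even_base (a/2) R (cos s))"
  proof (rule integral_mono)
    fix s
    have "even_base (a/2) r \<bar>cos s\<bar> \<le> even_base (a/2) R \<bar>cos s\<bar>"
      using a by (intro even_base_mono_radius rR) auto
    then show "\<bar>cos s\<bar> * even_base (a/2) r (cos s) \<le> \<bar>cos s\<bar> * even_base (a/2) R (cos s)"
      by (intro mult_left_mono) (auto simp: even_base_abs)
  qed (use i rR in auto)
  also have "\<dots> = 2 * power_integral abs_cos a R"
    by (rule power_integral_even(1)[OF r1(2) rR(3) C, symmetric]) simp
  finally show ?thesis by simp
qed

text \<open>The factor sin s makes the integrand an exact derivative of a power of the base; the
  absolute value is removed by treating the two half periods separately.\<close>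

lemma power_integral_sin:
  assumes r: "0 < r" "r < 1" and b: "a > -2"
  shows "power_integral abs_sin a r = 2 * ((1 + r) powr (a + 2) - (1 - r) powr (a + 2)) / (r * (a + 2))"
proof -
  \<comment> \<open>The exponent of the antiderivative, positive because a > -2.\<close>
  define c where "c = a/2 + 1"
  have c: "c > 0" using b by (simp add: c_def)
  define F where "F = (\<lambda>s. (1 + r\<^sup>2 + 2 * r * cos s) powr c / (2 * r * c))"
  let ?f = "\<lambda>s. \<bar>sin s\<bar> * (1 + r\<^sup>2 + 2 * r * cos s) powr (a / 2)"
  have pos: "1 + r\<^sup>2 + 2 * r * cos s > 0" for s using base_pos[of r s] r by simp
  have dF: "(F has_vector_derivative (- sin s * (1 + r\<^sup>2 + 2 * r * cos s) powr (a / 2))) (at s within S)" for s S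
  proof -
    have "(F has_real_derivative (c * (1 + r\<^sup>2 + 2 * r * cos s) powr (c - 1) * (- (2 * r * sin s)) / (2 * r * c))) (at s within S)"
      unfolding F_def using pos[of s] by (intro DERIV_cdivide) (auto intro!: derivative_eq_intros)
    also have "c * (1 + r\<^sup>2 + 2 * r * cos s) powr (c - 1) * (- (2 * r * sin s)) / (2 * r * c) =
      - sin s * (1 + r\<^sup>2 + 2 * r * cos s) powr (a / 2)"
      using r c by (simp add: c_def[symmetric]) (simp add: c_def)
    finally show ?thesis by (simp add: has_real_derivative_iff_has_vector_derivative)
  qed
  have "((\<lambda>s. - sin s * (1 + r\<^sup>2 + 2 * r * cos s) powr (a / 2)) has_integral (F pi - F 0)) {0..pi}"
    by (intro fundamental_theorem_of_calculus dF) auto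
  from has_integral_neg[OF this] have 1: "(?f has_integral (F 0 - F pi)) {0..pi}"
    by (rule has_integral_eq_rhs[OF has_integral_eq[rotated]]) (auto simp: sin_ge_zero)
  have "((\<lambda>s. - sin s * (1 + r\<^sup>2 + 2 * r * cos s) powr (a / 2)) has_integral (F (2*pi) - F pi)) {pi..2*pi}"
    by (intro fundamental_theorem_of_calculus dF) auto
  then have 2: "(?f has_integral (F (2*pi) - F pi)) {pi..2*pi}"
  proof (rule has_integral_eq[rotated])
    fix s assume "s \<in> {pi..2*pi}"
    then have "sin s \<le> 0" using sin_ge_zero[of "s - pi"] by (simp add: sin_diff)
    then show "- sin s * (1 + r\<^sup>2 + 2 * r * cos s) powr (a / 2) = ?f s" by simp
  qed
  have "(?f has_integral ((F 0 - F pi) + (F (2*pi) - F pi))) {0..2*pi}"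
    by (rule has_integral_combine[OF _ _ 1 2]) auto
  moreover have "integrable circ ?f"
    using r by (intro power_integral_integrable continuous_intros) auto
  ultimately have "power_integral abs_sin a r = (F 0 - F pi) + (F (2*pi) - F pi)"
    by (simp add: power_integral_def lebesgue_integral_eq_integral integral_unique)
  moreover have "F 0 = (1 + r) powr (2 * c) / (2 * r * c)" "F (2*pi) = F 0" "F pi = (1 - r) powr (2 * c) / (2 * r * c)"
  proof -
    have "1 + r\<^sup>2 + 2 * r = (1 + r) powr 2" "1 + r\<^sup>2 - 2 * r = (1 - r) powr 2"
      using r by (simp_all add: powr_numeral power2_eq_square algebra_simps)
    then show "F 0 = (1 + r) powr (2 * c) / (2 * r * c)" "F (2*pi) = F 0" "F pi = (1 - r) powr (2 * c) / (2 * r * c)"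
      by (simp_all add: F_def powr_powr)
  qed
  ultimately have "power_integral abs_sin a r = 2 * ((1 + r) powr (2 * c) - (1 - r) powr (2 * c)) / (r * (2 * c))"
    by (simp add: diff_divide_distrib mult.commute)
  then show ?thesis by (simp add: c_def distrib_left)
qed

text \<open>\<open>k(x) = (1 + x)\<^sup>q - (1 - x)\<^sup>q\<close> is convex on \<open>[0, 1)\<close> with \<open>k(0) = 0\<close>, so \<open>k(x) / x\<close> increases.\<close>

lemma power_integral_sin_mono:
  assumes a: "0 \<le> a" and rR: "0 < r" "r \<le> R" "R < 1"
  shows "power_integral abs_sin a r \<le> power_integral abs_sin a R"
proof -
  define q where "q = a + 2"
  have q: "q \<ge> 2" using a by (simp add: q_def)
  define k where "k = (\<lambda>x::real. (1 + x) powr q - (1 - x) powr q)"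
  have cv: "convex_on {0..<1} k"
  proof (rule f''_ge0_imp_convex[where f' = "\<lambda>x. q * (1 + x) powr (q - 1) + q * (1 - x) powr (q - 1)"
      and f'' = "\<lambda>x. q * (q - 1) * ((1 + x) powr (q - 2) - (1 - x) powr (q - 2))"])
    fix x :: real assume x: "x \<in> {0..<1}"
    show "(k has_real_derivative q * (1 + x) powr (q - 1) + q * (1 - x) powr (q - 1)) (at x)"
      unfolding k_def using x by (auto intro!: derivative_eq_intros)
    show "((\<lambda>x. q * (1 + x) powr (q - 1) + q * (1 - x) powr (q - 1)) has_real_derivative
        q * (q - 1) * ((1 + x) powr (q - 2) - (1 - x) powr (q - 2))) (at x)"
      using x by (auto intro!: derivative_eq_intros simp: algebra_simps)
    \<comment> \<open>Convexity uses q >= 2, that is, a >= 0.\<close>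
    have "(1 - x) powr (q - 2) \<le> (1 + x) powr (q - 2)"
      using x q by (intro powr_mono2) auto
    then show "0 \<le> q * (q - 1) * ((1 + x) powr (q - 2) - (1 - x) powr (q - 2))"
      using q by simp
  qed auto
  have R: "R > 0" using rR by simp
  have "k ((1 - r / R) *\<^sub>R 0 + (r / R) *\<^sub>R R) \<le> (1 - r / R) * k 0 + (r / R) * k R"
    using rR R by (intro convex_onD[OF cv]) auto
  then have "k r \<le> r / R * k R" using R by (simp add: k_def)
  then have "k r / r \<le> k R / R" using rR R by (simp add: field_simps)
  then have "2 / q * (k r / r) \<le> 2 / q * (k R / R)" using q by (intro mult_left_mono) auto
  moreover have "power_integral abs_sin a t = 2 / q * (k t / t)" if "0 < t" "t < 1" for t
    using power_integral_sin[OF that, of a] a by (simp add: q_def k_def)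
  ultimately show ?thesis using rR R by simp
qed

section \<open>Boundary values\<close>

text \<open>The substitution t = (1 + cos s) / 2 produces a Beta integral, whose exponent at t = 0
  exceeds -1 exactly when a > -1.\<close>

lemma half_angle_has_integral:
  assumes a: "a > -1"
  shows "((\<lambda>s. ((1 + cos s) / 2) powr (a/2)) absolutely_integrable_on {0<..<pi})"
    and "integral {0<..<pi} (\<lambda>s. ((1 + cos s) / 2) powr (a/2)) = Beta ((a + 1) / 2) (1/2)"
proof -
  define f where "f = (\<lambda>t::real. t powr ((a + 1) / 2 - 1) * (1 - t) powr (1/2 - 1))"
  define g where "g = (\<lambda>s::real. (1 + cos s) / 2)"
  have I: "(f has_integral Beta ((a + 1) / 2) (1/2)) {0..1}"
    unfolding f_def using a by (intro has_integral_Beta_real) auto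
  have f_abs: "f absolutely_integrable_on {0..1}"
    using I by (intro nonnegative_absolutely_integrable_1) (auto simp: f_def)
  have im: "g ` {0<..<pi} = {0<..<1}"
  proof (intro equalityI subsetI)
    fix y assume "y \<in> g ` {0<..<pi}"
    then obtain s where s: "0 < s" "s < pi" "y = g s" by auto
    then have "cos s < cos 0" "cos pi < cos s" by (intro cos_monotone_0_pi; simp)+
    then show "y \<in> {0<..<1}" using s by (simp add: g_def)
  next
    fix y :: real assume y: "y \<in> {0<..<1}"
    then have "arccos (2 * y - 1) \<in> {0<..<pi}" using arccos_lt_bounded[of "2 * y - 1"] by simp
    moreover have "g (arccos (2 * y - 1)) = y" using y by (simp add: g_def)
    ultimately show "y \<in> g ` {0<..<pi}" by (metis imageI)
  qed
  have inj: "inj_on g {0<..<pi}"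
    by (intro inj_onI) (auto simp: g_def intro: cos_inj_pi)
  have f01: "f absolutely_integrable_on g ` {0<..<pi}" "integral (g ` {0<..<pi}) f = Beta ((a + 1) / 2) (1/2)"
  proof -
    show "f absolutely_integrable_on g ` {0<..<pi}" unfolding im
      by (rule set_integrable_subset[OF f_abs]) auto
    have "(f has_integral Beta ((a + 1) / 2) (1/2)) {0<..<1}"
      using I has_integral_Icc_iff_Ioo by blast
    then show "integral (g ` {0<..<pi}) f = Beta ((a + 1) / 2) (1/2)" unfolding im by (rule integral_unique)
  qed
  have "(\<lambda>x. \<bar>- sin x / 2\<bar> * f (g x)) absolutely_integrable_on {0<..<pi} \<and>
           integral {0<..<pi} (\<lambda>x. \<bar>- sin x / 2\<bar> * f (g x)) = Beta ((a + 1) / 2) (1/2)"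
    by (subst has_absolute_integral_change_of_variables_1'[OF _ _ inj])
      (use f01 in \<open>auto simp: g_def intro!: derivative_eq_intros\<close>)
  moreover have eq: "\<bar>- sin x / 2\<bar> * f (g x) = ((1 + cos x) / 2) powr (a/2)" if "x \<in> {0<..<pi}" for x
  proof -
    have s: "sin x > 0" using that by (intro sin_gt_zero) auto
    have "cos x < cos 0" "cos pi < cos x" using that by (intro cos_monotone_0_pi; simp)+
    then have c: "(1 + cos x) / 2 > 0" "(1 - cos x) / 2 > 0" by auto
    \<comment> \<open>The Jacobian is the geometric mean of t and 1 - t: it cancels (1 - t)^(-1/2)
      and raises the exponent of t by 1/2.\<close>
    have "(sin x / 2)\<^sup>2 = ((1 + cos x) / 2) * ((1 - cos x) / 2)"
      using sin_squared_eq[of x] by (simp add: power2_eq_square algebra_simps)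
    then have "sin x / 2 = (((1 + cos x) / 2) * ((1 - cos x) / 2)) powr (1/2)"
      using s c by (metis powr_half_sqrt real_sqrt_unique mult_pos_pos less_imp_le half_gt_zero)
    also have "\<dots> = ((1 + cos x) / 2) powr (1/2) * ((1 - cos x) / 2) powr (1/2)"
      using c by (simp only: powr_mult)
    finally have sx: "\<bar>- sin x / 2\<bar> = ((1 + cos x) / 2) powr (1/2) * ((1 - cos x) / 2) powr (1/2)"
      using s by simp
    have "1 - g x = (1 - cos x) / 2" by (simp add: g_def field_simps)
    then have "\<bar>- sin x / 2\<bar> * f (g x) = (((1 + cos x) / 2) powr (1/2) * ((1 + cos x) / 2) powr ((a + 1) / 2 - 1)) *
        (((1 - cos x) / 2) powr (1/2) * ((1 - cos x) / 2) powr (1/2 - 1))"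
      unfolding sx f_def by (simp only: g_def mult_ac)
    also have "\<dots> = ((1 + cos x) / 2) powr (1/2 + ((a + 1) / 2 - 1)) * ((1 - cos x) / 2) powr (1/2 + (1/2 - 1))"
      by (simp only: powr_add)
    also have "\<dots> = ((1 + cos x) / 2) powr (a/2)"
      using c by (simp add: add_divide_distrib)
    finally show ?thesis .
  qed
  ultimately have p: "(\<lambda>x. \<bar>- sin x / 2\<bar> * f (g x)) absolutely_integrable_on {0<..<pi}"
    "integral {0<..<pi} (\<lambda>x. \<bar>- sin x / 2\<bar> * f (g x)) = Beta ((a + 1) / 2) (1/2)"
    by (simp_all only: simp_thms)
  show "((\<lambda>s. ((1 + cos s) / 2) powr (a/2)) absolutely_integrable_on {0<..<pi})"
    by (rule iffD1[OF set_integrable_cong[OF refl refl eq] p(1)])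
  show "integral {0<..<pi} (\<lambda>s. ((1 + cos s) / 2) powr (a/2)) = Beta ((a + 1) / 2) (1/2)"
    unfolding p(2)[symmetric] by (rule Henstock_Kurzweil_Integration.integral_cong) (rule eq[symmetric])
qed

text \<open>The reflection s -> 2 pi - s copies the integral over the first half period onto the
  second.\<close>

lemma half_angle_integral:
  assumes a: "a > -1"
  shows "integrable circ (\<lambda>s. ((1 + cos s) / 2) powr (a/2))"
    and "(LINT s|circ. ((1 + cos s) / 2) powr (a/2)) = 2 * Beta ((a + 1) / 2) (1/2)"
proof -
  let ?E = "\<lambda>s. ((1 + cos s) / 2) powr (a/2)"
  let ?B = "Beta ((a + 1) / 2) (1/2) :: real"
  have "(?E has_integral ?B) {0<..<pi}"
    using half_angle_has_integral[OF a] set_lebesgue_integral_eq_integral(1) integrable_integral by metis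
  then have 1: "(?E has_integral ?B) {0..pi}"
    using has_integral_Icc_iff_Ioo by blast
  have "((\<lambda>s. ?E (- s)) has_integral ?B) {- pi..- 0}"
    using 1 by (rule has_integral_reflect_real[THEN iffD2])
  then have "((?E \<circ> (+) (2*pi)) has_integral ?B) {- pi..0}" by (simp add: o_def cos_add)
  then have 2: "(?E has_integral ?B) {pi..2*pi}"
    unfolding has_integral_shift_Icc_real by simp
  have 3: "(?E has_integral (?B + ?B)) {0..2*pi}"
    by (rule has_integral_combine[OF _ _ 1 2]) auto
  then have "?E absolutely_integrable_on {0..2*pi}"
    by (intro nonnegative_absolutely_integrable_1) auto
  then show "integrable circ ?E"
    by (simp add: set_integrable_def integrable_restrict_space)
  then show "(LINT s|circ. ?E s) = 2 * ?B"
    using 3 by (simp add: lebesgue_integral_eq_integral integral_unique)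
qed

section \<open>Gamma functions and the Beta integral\<close>

lemma Gamma_duplication_real:
  assumes "x > (0::real)"
  shows "Gamma x * Gamma (x + 1/2) = 2 powr (1 - 2 * x) * sqrt pi * Gamma (2 * x)"
proof -
  have n: "y \<notin> \<int>\<^sub>\<le>\<^sub>0" if "y > 0" for y :: real
    using that by (auto elim!: nonpos_Ints_cases)
  have "complex_of_real x \<notin> \<int>\<^sub>\<le>\<^sub>0" "complex_of_real x + 1/2 \<notin> \<int>\<^sub>\<le>\<^sub>0"
    using n[of x] n[of "x + 1/2"] assms of_real_in_nonpos_Ints_iff[of x, where 'a = complex]
      of_real_in_nonpos_Ints_iff[of "x + 1/2", where 'a = complex] by simp_all
  from Gamma_legendre_duplication[OF this]
  have "complex_of_real (Gamma x * Gamma (x + 1/2)) = of_real (exp ((1 - 2 * x) * ln 2) * sqrt pi * Gamma (2 * x))"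
    by (simp add: Gamma_complex_of_real[symmetric] exp_of_real[symmetric])
  then show ?thesis
    unfolding of_real_eq_iff by (simp add: powr_def)
qed

text \<open>Legendre duplication at (a + 1) / 2 rewrites the numerator of the Beta function; the
  powers of 2 that depend on a then cancel.\<close>

lemma half_angle_Gamma:
  assumes a: "a > (-1::real)"
  shows "2 powr a * (2 * Beta ((a + 1) / 2) (1/2)) = 2 * pi * (Gamma (a + 1) / (Gamma ((a + 2) / 2))\<^sup>2)"
proof -
  have G: "Gamma ((a + 2) / 2) > 0" using a by (intro Gamma_real_pos) auto
  have "Gamma ((a + 1) / 2) * Gamma ((a + 2) / 2) = 2 powr (- a) * sqrt pi * Gamma (a + 1)"
    using Gamma_duplication_real[of "(a + 1) / 2"] a by (simp add: add_divide_distrib algebra_simps)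
  then have "Gamma ((a + 1) / 2) = 2 powr (- a) * sqrt pi * Gamma (a + 1) / Gamma ((a + 2) / 2)"
    using G by (simp add: field_simps)
  moreover have "Beta ((a + 1) / 2) (1/2) = Gamma ((a + 1) / 2) * sqrt pi / Gamma ((a + 2) / 2)"
  proof -
    have "(a + 1) / 2 + 1 / 2 = (a + 2) / 2" by (simp add: add_divide_distrib)
    then show ?thesis unfolding Beta_def by (simp only: Gamma_one_half_real)
  qed
  ultimately show ?thesis
    using pi_ge_zero by (simp add: powr_minus power2_eq_square field_simps)
qed

text \<open>At r = 1 the base vanishes only where cos s = -1; excluding this null set avoids the
  singularity of a negative power.\<close>

lemma AE_circ_cos_neq: "AE s in circ. cos s > -1"
proof -
  have "AE s in circ. s \<noteq> pi"
    by (subst AE_restrict_space_iff) (use AE_not_in[of "{pi}" lebesgue] in \<open>auto simp: negligible_iff_null_sets[symmetric]\<close>)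
  moreover have "AE s in circ. s \<in> {0..2*pi}" by (rule AE_I2) simp
  ultimately show ?thesis
  proof eventually_elim
    case (elim s)
    have "cos s \<noteq> -1"
    proof
      assume "cos s = -1"
      then obtain n where "s = (2 * of_int n + 1) * pi"
        unfolding cos_eq_minus1 by (auto simp: algebra_simps)
      then have "0 \<le> 2 * real_of_int n + 1" "2 * real_of_int n + 1 \<le> 2"
        using elim pi_gt_zero by (auto simp: zero_le_mult_iff mult_le_cancel_right)
      then have "n = 0" by linarith
      then show False using \<open>s = _\<close> elim by simp
    qed
    then show ?case using cos_ge_minus_one[of s] by linarith
  qed
qed

text \<open>The lower bound is free of r, so it controls negative powers uniformly. For c = cos s <
  0 the quadratic in r is least at r = -c, with value (1 + c)(1 - c) >= 1 + c; for c >= 0 the base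
  is at least 1.\<close>

lemma base_bounds:
  fixes r s :: real
  assumes r: "0 \<le> r" "r \<le> 1"
  shows "(1 + cos s) / 2 \<le> 1 + r\<^sup>2 + 2 * r * cos s" "1 + r\<^sup>2 + 2 * r * cos s \<le> 4"
proof -
  have "r * cos s \<le> r * 1" using r by (intro mult_left_mono) auto
  moreover have "r\<^sup>2 \<le> 1" using r by (simp add: power_le_one)
  ultimately show "1 + r\<^sup>2 + 2 * r * cos s \<le> 4" using r by simp
  show "(1 + cos s) / 2 \<le> 1 + r\<^sup>2 + 2 * r * cos s"
  proof (cases "cos s \<ge> 0")
    case True
    then have "r * cos s \<ge> 0" using r by simp
    moreover have "r\<^sup>2 \<ge> 0" by simp
    moreover have "(1 + cos s) / 2 \<le> 1" using cos_le_one[of s] by simp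
    ultimately show ?thesis by linarith
  next
    case False
    define c where "c = cos s"
    have c: "-1 \<le> c" "c < 0" using False by (simp_all add: c_def)
    have "(r + c)\<^sup>2 \<ge> 0" by simp
    then have "(1 + c) * (1 - c) \<le> 1 + r\<^sup>2 + 2 * r * c"
      by (simp add: power2_eq_square algebra_simps)
    moreover have "(1 + c) * 1 \<le> (1 + c) * (1 - c)"
      using c by (intro mult_left_mono) auto
    moreover have "(1 + c) / 2 \<le> (1 + c) * 1" using c by simp
    ultimately show ?thesis unfolding c_def[symmetric] by (meson order_trans)
  qed
qed

lemma power_integral_tendsto:
  assumes a: "a > -1" and \<phi>: "continuous_on UNIV \<phi>" "\<And>s. \<bar>\<phi> s\<bar> \<le> 1"
  shows "(power_integral \<phi> a \<longlongrightarrow> power_integral \<phi> a 1) (at_left 1)"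
proof (rule tendsto_at_left_sequentially[of 0])
  fix S :: "nat \<Rightarrow> real"
  assume S: "\<And>n. S n < 1" "\<And>n. 0 < S n" "S \<longlonglongrightarrow> 1"
  let ?f = "\<lambda>r s. \<phi> s * (1 + r\<^sup>2 + 2 * r * cos s) powr (a / 2)"
  show "(\<lambda>n. power_integral \<phi> a (S n)) \<longlonglongrightarrow> power_integral \<phi> a 1"
    unfolding power_integral_def
  proof (rule integral_dominated_convergence)
    have m: "\<phi> \<in> borel_measurable circ" "cos \<in> borel_measurable circ"
      by (intro borel_measurable_integrable circ_integrable_continuous \<phi> continuous_intros)+
    show "?f 1 \<in> borel_measurable circ" "\<And>n. ?f (S n) \<in> borel_measurable circ" using m by measurable
    \<comment> \<open>A majorant for both signs of a: the constant serves a >= 0, and the half-angle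
      power serves a < 0, where it is integrable because a > -1.\<close>
    show "integrable circ (\<lambda>s. 4 powr \<bar>a/2\<bar> + ((1 + cos s) / 2) powr (a/2))"
      using half_angle_integral(1)[OF a] by simp
    show "AE s in circ. (\<lambda>n. ?f (S n) s) \<longlonglongrightarrow> ?f 1 s"
      using AE_circ_cos_neq
    proof eventually_elim
      case (elim s)
      then have "1 + 1\<^sup>2 + 2 * 1 * cos s \<noteq> 0" by simp
      then show ?case by (intro tendsto_intros S) auto
    qed
    show "AE s in circ. norm (?f (S n) s) \<le> 4 powr \<bar>a/2\<bar> + ((1 + cos s) / 2) powr (a/2)" for n
      using AE_circ_cos_neq
    proof eventually_elim
      case (elim s)
      let ?q = "1 + (S n)\<^sup>2 + 2 * S n * cos s"
      have q: "(1 + cos s) / 2 \<le> ?q" "?q \<le> 4" using base_bounds[of "S n" s] S(1,2)[of n] by simp_all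
      have "?q powr (a/2) \<le> 4 powr \<bar>a/2\<bar> + ((1 + cos s) / 2) powr (a/2)"
      proof (cases "a \<ge> 0")
        case True
        then have "?q powr (a/2) \<le> 4 powr (a/2)" using q elim by (intro powr_mono2) auto
        then show ?thesis using True by (simp add: add_increasing2)
      next
        case False
        then have "?q powr (a/2) \<le> ((1 + cos s) / 2) powr (a/2)" using q elim by (intro powr_mono2') auto
        then show ?thesis by (simp add: add_increasing)
      qed
      moreover have "norm (?f (S n) s) \<le> 1 * ?q powr (a/2)"
        unfolding real_norm_def abs_mult using \<phi>(2)[of s] by (intro mult_mono) auto
      ultimately show ?case by linarith
    qed
  qed
qed simp

lemma power_integral_one_eq:
  assumes a: "a > -1"
  shows "power_integral (\<lambda>_. 1) a 1 = 2 * pi * (Gamma (a + 1) / (Gamma ((a + 2) / 2))\<^sup>2)"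
proof -
  have "power_integral (\<lambda>_. 1) a 1 = (LINT s|circ. 2 powr a * ((1 + cos s) / 2) powr (a/2))"
    unfolding power_integral_def
  proof (rule Bochner_Integration.integral_cong[OF refl])
    fix s :: real
    have "1 + 1\<^sup>2 + 2 * 1 * cos s = 4 * ((1 + cos s) / 2)" by simp
    then have "1 * (1 + 1\<^sup>2 + 2 * 1 * cos s) powr (a / 2) = 4 powr (a/2) * ((1 + cos s) / 2) powr (a/2)"
      by (simp only: powr_mult mult_1)
    also have "(4::real) powr (a/2) = 2 powr a"
      using powr_powr[of 2 2 "a/2"] by simp
    finally show "1 * (1 + 1\<^sup>2 + 2 * 1 * cos s) powr (a / 2) = 2 powr a * ((1 + cos s) / 2) powr (a/2)" .
  qed
  also have "\<dots> = 2 powr a * (2 * Beta ((a + 1) / 2) (1/2))"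
    using half_angle_integral(2)[OF a] by simp
  finally show ?thesis using half_angle_Gamma[OF a] by simp
qed

section \<open>Parseval's identity and the growth of J\<close>

lemma integral_cis_multiple:
  fixes m n :: nat
  shows "(LINT s|circ. cis (real m * s) * cis (- (real n * s))) = (if m = n then of_real (2*pi) else 0)"
proof (cases "m = n")
  case True
  have "cis (real m * s) * cis (- (real m * s)) = 1" for s by (simp add: cis_mult)
  then have "(LINT s|circ. cis (real m * s) * cis (- (real m * s))) = (LINT s|circ. (1::complex))" by (simp only:)
  also have "\<dots> = of_real (2*pi)" by (simp add: scaleR_conv_of_real)
  finally show ?thesis using True by simp
next
  case False
  define k where "k = real m - real n"
  have k: "k \<noteq> 0" using False by (simp add: k_def)
  have e: "cis (real m * s) * cis (- (real n * s)) = cis (k * s)" for s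
    by (simp add: cis_mult k_def algebra_simps)
  have "(LINT s|circ. cis (k * s)) = cis (k * (2*pi)) / (\<i> * of_real k) - cis (k * 0) / (\<i> * of_real k)"
  proof (rule circ_integral_FTC)
    show "continuous_on {0..2*pi} (\<lambda>s. cis (k * s))" by (intro continuous_on_cis continuous_intros)
    show "((\<lambda>s. cis (k * s) / (\<i> * of_real k)) has_vector_derivative cis (k * x)) (at x within {0..2*pi})" for x
    proof -
      have i: "- (\<i> * (e * \<i>)) = e" for e :: complex
        by (simp add: complex_eq_iff)
      show ?thesis
        unfolding cis_conv_exp using k
        by (auto intro!: derivative_eq_intros has_vector_derivative_real_field simp: i)
    qed
  qed simp
  also have "cis (k * (2*pi)) = 1"
  proof -
    have "cis (k * (2*pi)) = cis (2 * pi * (of_int (int m - int n)))" by (simp add: k_def algebra_simps)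
    also have "\<dots> = 1" by (rule cis_multiple_2pi) simp
    finally show ?thesis .
  qed
  finally show ?thesis using False unfolding e by simp
qed

text \<open>Absolute summability at radius r justifies termwise integration. The free factor
  \<open>h\<close> permits one use with an exponential and one with the conjugate of
  \<open>G\<close>.\<close>

lemma integral_power_series_circle:
  fixes C :: "nat \<Rightarrow> complex" and h G :: "real \<Rightarrow> complex"
  assumes h: "continuous_on UNIV h" and sm: "summable (\<lambda>n. cmod (C n) * r ^ n)" and r: "0 \<le> r"
    and G: "\<And>s. (\<lambda>n. C n * (of_real r * cis s) ^ n) sums G s"
  shows "(\<lambda>n. C n * of_real (r ^ n) * (LINT s|circ. cis (real n * s) * h s)) sums (LINT s|circ. G s * h s)"
proof -
  have e: "C n * (of_real r * cis s) ^ n = C n * of_real (r ^ n) * cis (real n * s)" for n s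
    by (simp add: power_mult_distrib Complex.DeMoivre)
  have ch: "continuous_on UNIV (\<lambda>s. cis (real n * s) * h s)" for n
    by (intro continuous_on_mult h continuous_on_cis continuous_intros)
  let ?f = "\<lambda>n s. C n * of_real (r ^ n) * (cis (real n * s) * h s)"
  have nf: "norm (?f n s) = cmod (C n) * r ^ n * cmod (h s)" for n s
    using r by (simp add: norm_mult norm_power)
  have hi: "integrable circ (\<lambda>s. cmod (h s))"
    by (intro circ_integrable_continuous continuous_on_norm h)
  have "(\<lambda>n. LINT s|circ. ?f n s) sums (LINT s|circ. (\<Sum>n. ?f n s))"
  proof (rule sums_integral)
    show "integrable circ (?f n)" for n
      by (intro integrable_mult_right circ_integrable_continuous ch)
    show "AE s in circ. summable (\<lambda>n. norm (?f n s))"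
      unfolding nf by (intro AE_I2 summable_mult2 sm)
    show "summable (\<lambda>n. LINT s|circ. norm (?f n s))"
      unfolding nf integral_mult_right_zero by (intro summable_mult2 sm)
  qed
  moreover have "(\<Sum>n. ?f n s) = G s * h s" for s
    using sums_unique[OF sums_mult2[OF G[of s], of "h s"]] unfolding e by (simp only: mult.assoc)
  ultimately show ?thesis by (simp only: integral_mult_right_zero)
qed

text \<open>Integration against exponentials identifies the coefficients; integration of the series
  against the conjugate of \<open>G\<close> then turns each term into a squared modulus.\<close>

lemma parseval_circle:
  fixes C :: "nat \<Rightarrow> complex" and G :: "real \<Rightarrow> complex"
  assumes c: "continuous_on UNIV G" and sm: "summable (\<lambda>n. cmod (C n) * r ^ n)" and r: "0 \<le> r"
    and G: "\<And>s. (\<lambda>n. C n * (of_real r * cis s) ^ n) sums G s"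
  shows "(\<lambda>n. 2 * pi * (cmod (C n) * r ^ n)\<^sup>2) sums (LINT s|circ. (cmod (G s))\<^sup>2)"
proof -
  have coeff: "(LINT s|circ. G s * cis (- (real n * s))) = 2 * pi * (C n * of_real (r ^ n))" for n
  proof -
    have "continuous_on UNIV (\<lambda>s. cis (- (real n * s)))" by (intro continuous_on_cis continuous_intros)
    from integral_power_series_circle[OF this sm r G]
    have "(\<lambda>m. if m = n then C m * of_real (r ^ m) * of_real (2*pi) else 0) sums (LINT s|circ. G s * cis (- (real n * s)))"
      unfolding integral_cis_multiple by (simp add: if_distrib cong: if_cong)
    then show ?thesis using sums_unique2[OF _ sums_single[of n "\<lambda>m. C m * of_real (r ^ m) * of_real (2*pi)"]]
      by (simp add: mult_ac)
  qed
  have "continuous_on UNIV (\<lambda>s. cnj (G s))" by (intro continuous_on_cnj c)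
  from integral_power_series_circle[OF this sm r G]
  have s: "(\<lambda>n. C n * of_real (r ^ n) * (LINT s|circ. cis (real n * s) * cnj (G s))) sums (LINT s|circ. G s * cnj (G s))" .
  have cc: "(LINT s|circ. cis (real n * s) * cnj (G s)) = cnj (2 * pi * (C n * of_real (r ^ n)))" for n
  proof -
    have "(LINT s|circ. cis (real n * s) * cnj (G s)) = (LINT s|circ. cnj (G s * cis (- (real n * s))))"
      by (simp add: cis_cnj mult.commute)
    also have "\<dots> = cnj (LINT s|circ. G s * cis (- (real n * s)))" by (rule integral_bounded_linear[OF bounded_linear_cnj])
        (intro circ_integrable_continuous continuous_on_mult c continuous_on_cis continuous_intros)
    finally show ?thesis unfolding coeff .
  qed
  have "C n * of_real (r ^ n) * cnj (2 * pi * (C n * of_real (r ^ n))) = of_real (2 * pi * (cmod (C n) * r ^ n)\<^sup>2)" for n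
  proof -
    have "C n * of_real (r ^ n) * cnj (2 * pi * (C n * of_real (r ^ n))) = 2 * pi * ((C n * of_real (r ^ n)) * cnj (C n * of_real (r ^ n)))"
      by simp
    also have "\<dots> = of_real (2 * pi * (cmod (C n * of_real (r ^ n)))\<^sup>2)"
      unfolding complex_norm_square[symmetric] by simp
    finally show ?thesis using r by (simp add: norm_mult norm_power)
  qed
  moreover have "(LINT s|circ. G s * cnj (G s)) = of_real (LINT s|circ. (cmod (G s))\<^sup>2)"
    unfolding complex_norm_square[symmetric] of_real_power[symmetric] by (rule integral_of_real)
      (intro circ_integrable_continuous continuous_intros c)
  ultimately show ?thesis using s unfolding cc by (simp only: sums_of_real_iff)
qed

text \<open>On |z| = r the function (1 + z)^(a/2) has squared modulus |1 + r e^{is}|^a, so its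
  binomial series exhibits J as a power series in r^2 with nonnegative coefficients.\<close>

lemma power_integral_one_sums:
  assumes r: "0 \<le> r" "r < 1"
  shows "(\<lambda>n. 2 * pi * (cmod (complex_of_real (a/2) gchoose n) * r ^ n)\<^sup>2) sums power_integral (\<lambda>_. 1) a r"
proof -
  let ?C = "\<lambda>n. complex_of_real (a/2) gchoose n"
  let ?G = "\<lambda>s. (1 + of_real r * cis s) powr complex_of_real (a/2)"
  have nz: "1 + of_real r * cis s \<notin> \<real>\<^sub>\<le>\<^sub>0" for s
    using one_plus_nonzero(3)[of r "cis s"] r by (cases "r = 0") auto
  have s: "(\<lambda>n. ?C n * (of_real r * cis s) ^ n) sums ?G s" for s
    using r by (intro gen_binomial_complex) (simp add: norm_mult)
  have "(\<lambda>n. 2 * pi * (cmod (?C n) * r ^ n)\<^sup>2) sums (LINT s|circ. (cmod (?G s))\<^sup>2)"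
  proof (rule parseval_circle[OF _ _ r(1) s])
    show "continuous_on UNIV ?G"
    proof -
      have "?G = (\<lambda>s. exp (complex_of_real (a/2) * Ln (1 + of_real r * cis s)))"
      proof
        fix s
        have "1 + of_real r * cis s \<noteq> 0" using nz[of s] by auto
        then show "?G s = exp (complex_of_real (a/2) * Ln (1 + of_real r * cis s))"
          by (simp add: powr_def)
      qed
      then show ?thesis
        by (simp only:) (intro continuous_intros continuous_on_cis nz)
    qed
    \<comment> \<open>Convergence at the larger radius (r + 1) / 2 gives absolute convergence at
      r.\<close>
    have "summable (\<lambda>n. ?C n * of_real ((r + 1) / 2) ^ n)"
      using r by (intro sums_summable[OF gen_binomial_complex]) (simp add: norm_divide flip: of_real_add)
    then have "summable (\<lambda>n. norm (?C n * of_real r ^ n))"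
      by (rule powser_insidea) (use r in \<open>simp add: norm_divide flip: of_real_add\<close>)
    then show "summable (\<lambda>n. cmod (?C n) * r ^ n)"
      using r by (simp add: norm_mult norm_power)
  qed
  moreover have "(cmod (?G s))\<^sup>2 = 1 * (1 + r\<^sup>2 + 2 * r * cos s) powr (a / 2)" for s
  proof -
    have X: "1 + of_real r * cis s \<noteq> 0" using nz[of s] by auto
    have "(cmod (?G s))\<^sup>2 = (cmod (1 + of_real r * cis s) powr (a/2)) powr 2"
      by (simp only: cmod_powr_of_real[OF X]) simp
    also have "\<dots> = cmod (1 + of_real r * cis s) powr a" by (simp add: powr_powr)
    finally show ?thesis by (simp only: cmod_powr_eq_sq_powr mult_1)
  qed
  ultimately show ?thesis unfolding power_integral_def by (simp only:)
qed

lemma power_integral_one_mono: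
  assumes "0 \<le> r" "r \<le> R" "R < 1"
  shows "power_integral (\<lambda>_. 1) a r \<le> power_integral (\<lambda>_. 1) a R"
proof (rule sums_le[OF _ power_integral_one_sums power_integral_one_sums])
  show "2 * pi * (cmod (complex_of_real (a/2) gchoose n) * r ^ n)\<^sup>2 \<le> 2 * pi * (cmod (complex_of_real (a/2) gchoose n) * R ^ n)\<^sup>2" for n
    using assms by (intro mult_left_mono power_mono) auto
qed (use assms in auto)

section \<open>Bounds by the boundary values\<close>

lemma power_integral_le_boundary:
  assumes t: "(power_integral \<phi> a \<longlongrightarrow> L) (at_left 1)" and r: "r < 1"
    and m: "\<And>R. r \<le> R \<Longrightarrow> R < 1 \<Longrightarrow> I \<le> power_integral \<phi> a R"
  shows "I \<le> L"
proof (rule tendsto_lowerbound[OF t])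
  show "eventually (\<lambda>R. I \<le> power_integral \<phi> a R) (at_left 1)"
    using eventually_at_left_real[OF r] by eventually_elim (intro m, auto)
qed simp

lemma power_integral_le_one:
  assumes a: "a > -1" and r: "0 \<le> r" "r < 1"
  shows "power_integral (\<lambda>_. 1) a r \<le> power_integral (\<lambda>_. 1) a 1"
  by (rule power_integral_le_boundary[OF power_integral_tendsto[OF a] r(2)])
    (auto intro!: power_integral_one_mono r continuous_intros)

lemma abs_trig_tendsto:
  assumes "a > -1"
  shows "(power_integral (\<lambda>_. 1) a \<longlongrightarrow> power_integral (\<lambda>_. 1) a 1) (at_left 1)"
    and "(power_integral abs_cos a \<longlongrightarrow> power_integral abs_cos a 1) (at_left 1)"
    and "(power_integral abs_sin a \<longlongrightarrow> power_integral abs_sin a 1) (at_left 1)"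
  by (intro power_integral_tendsto assms continuous_intros; simp)+

text \<open>The weight with the larger integral when a >= 0, following the case distinction of
  \<open>weight_int\<close>.\<close>

definition dominant_weight :: "real \<Rightarrow> real \<Rightarrow> real" where
  "dominant_weight a = (if 2 \<le> a then abs_cos else abs_sin)"

text \<open>The larger of the two integrals increases up to its boundary value; the smaller one is
  first bounded by the larger at the same radius.\<close>

lemma dominant_weight_bound:
  assumes a: "0 \<le> a" and r: "0 < r" "r < 1"
  shows "power_integral abs_cos a r \<le> power_integral (dominant_weight a) a 1"
    and "power_integral abs_sin a r \<le> power_integral (dominant_weight a) a 1"
proof -
  have am: "a > -1" using a by simp
  have r0: "0 \<le> r" using r by simp
  { assume a2: "2 \<le> a"
    have "power_integral abs_cos a r \<le> power_integral abs_cos a 1"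
      by (rule power_integral_le_boundary[OF abs_trig_tendsto(2)[OF am] r(2)])
        (intro power_integral_cos_mono a2 r0; assumption)
    then have "power_integral abs_cos a r \<le> power_integral (dominant_weight a) a 1"
      "power_integral abs_sin a r \<le> power_integral (dominant_weight a) a 1"
      using cos_sin_comparison(1)[OF r0 r(2) a2] a2 by (auto simp: dominant_weight_def) }
  moreover
  { assume a2: "\<not> 2 \<le> a"
    have "power_integral abs_sin a r \<le> power_integral abs_sin a 1"
      by (rule power_integral_le_boundary[OF abs_trig_tendsto(3)[OF am] r(2)])
        (intro power_integral_sin_mono a r; assumption)
    then have "power_integral abs_cos a r \<le> power_integral (dominant_weight a) a 1"
      "power_integral abs_sin a r \<le> power_integral (dominant_weight a) a 1"
      using cos_sin_comparison(2)[OF r0 r(2) a] a2 by (auto simp: dominant_weight_def) }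
  ultimately show "power_integral abs_cos a r \<le> power_integral (dominant_weight a) a 1"
    and "power_integral abs_sin a r \<le> power_integral (dominant_weight a) a 1" by blast+
qed

text \<open>At these exponents \<open>even_base\<close> is constant in x, with value 2 or 2 (1 +
  r^2), so neither weight is preferred.\<close>

lemma cos_sin_equal:
  assumes a: "a = 0 \<or> a = 2" and r: "0 \<le> r" "r < 1"
  shows "power_integral abs_cos a r = power_integral abs_sin a r"
proof (cases "a = 0")
  case True
  have "even_base (a/2) r x = 2" if "\<bar>x\<bar> \<le> 1" for x
    using True even_base_pos[OF r that] by (simp add: even_base_def)
  then show ?thesis using cos_sin_difference[OF r, of a] by simp
next
  case False
  then show ?thesis using cos_sin_comparison[OF r, of a] a by (intro antisym) auto
qed

text \<open>The limit r -> 1 of the preceding identity. At these exponents it reconciles the mixed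
  weights of \<open>A_fun\<close> and \<open>B_fun\<close> with the single weight of the closed
  formulas.\<close>

lemma cos_sin_boundary:
  assumes a: "a = 0 \<or> a = 2"
  shows "power_integral abs_cos a 1 = power_integral abs_sin a 1"
proof -
  have am: "a > -1" using a by auto
  have "eventually (\<lambda>r. power_integral abs_cos a r = power_integral abs_sin a r) (at_left 1)"
    using eventually_at_left_real[of 0 1] cos_sin_equal[OF a] by (simp add: eventually_mono)
  then have "(power_integral abs_sin a \<longlongrightarrow> power_integral abs_cos a 1) (at_left 1)"
    using abs_trig_tendsto(2)[OF am] Lim_transform_eventually by blast
  then show ?thesis using abs_trig_tendsto(3)[OF am] tendsto_unique trivial_limit_at_left_real by blast
qed

text \<open>At r = 1 the base is 2 (1 + cos s), which explains the power of 2 in the closed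
  formulas.\<close>

lemma weight_int_eq:
  "2 powr ((\<alpha> + \<beta>) / 2) * weight_int \<alpha> \<beta> = power_integral (dominant_weight (\<alpha> + \<beta>)) (\<alpha> + \<beta>) 1"
proof -
  have "(1 + 1\<^sup>2 + 2 * 1 * cos s) powr b = 2 powr b * (1 + cos s) powr b" for s b :: real
  proof -
    have "1 + 1\<^sup>2 + 2 * 1 * cos s = 2 * (1 + cos s)" by simp
    then show ?thesis by (simp only: powr_mult)
  qed
  then show ?thesis
    unfolding weight_int_def power_integral_def dominant_weight_def
    by (simp only: integral_mult_right_zero[symmetric] if_distrib mult_ac split: if_splits) (simp add: mult_ac)
qed

section \<open>Suprema, norm inequalities and sharpness\<close>

text \<open>Replaces a proof that \<open>F\<close> increases: an upper bound that is also the limit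
  at 1 is already the supremum.\<close>

lemma SUP_eq_left_limit:
  fixes F :: "real \<Rightarrow> real"
  assumes le: "\<And>r. 0 < r \<Longrightarrow> r < 1 \<Longrightarrow> F r \<le> L" and lim: "(F \<longlongrightarrow> L) (at_left 1)"
  shows "(SUP r\<in>{0<..<1}. F r) = L"
proof (rule antisym)
  show "(SUP r\<in>{0<..<1}. F r) \<le> L"
    by (rule cSUP_least) (use le in auto)
  have bdd: "bdd_above (F ` {0<..<1})" using le by (auto intro!: bdd_aboveI)
  show "L \<le> (SUP r\<in>{0<..<1}. F r)"
  proof (rule tendsto_upperbound[OF lim])
    show "eventually (\<lambda>r. F r \<le> (SUP r\<in>{0<..<1}. F r)) (at_left 1)"
      using eventually_at_left_real[OF zero_less_one] by eventually_elim (rule cSUP_upper[OF _ bdd])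
  qed simp
qed

section \<open>The functions and closed formulas in terms of power integrals\<close>

lemma A_fun_eq:
  "A_fun \<alpha> \<beta> r = \<bar>c_coeff \<alpha> \<beta>\<bar> / (2*pi) * (\<bar>\<alpha> + \<beta>\<bar> * r * power_integral (\<lambda>_. 1) (\<alpha> + \<beta>) r
    + (\<alpha> + \<beta> + 2) * power_integral abs_cos (\<alpha> + \<beta>) r + \<bar>\<alpha> - \<beta>\<bar> * power_integral abs_sin (\<alpha> + \<beta>) r)"
  unfolding A_fun_def J_eq_power_integral by (simp add: distrib_left)

lemma B_fun_eq:
  "B_fun \<alpha> \<beta> r = \<bar>c_coeff \<alpha> \<beta>\<bar> / (2*pi) * (\<bar>\<beta> - \<alpha>\<bar> * r * power_integral (\<lambda>_. 1) (\<alpha> + \<beta>) r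
    + (\<alpha> + \<beta> + 2) * power_integral abs_sin (\<alpha> + \<beta>) r + \<bar>\<beta> - \<alpha>\<bar> * power_integral abs_cos (\<alpha> + \<beta>) r)"
  unfolding B_fun_def J_eq_power_integral by (simp add: distrib_left)

lemma C_fun_eq:
  "C_fun \<alpha> \<beta> r = \<bar>c_coeff \<alpha> \<beta>\<bar> / (2*pi) * ((\<bar>\<alpha> + 1\<bar> + \<bar>\<beta>\<bar> * r) * power_integral (\<lambda>_. 1) (\<alpha> + \<beta>) r)"
  unfolding C_fun_def J_eq_power_integral by simp

lemma two_powr_half: "2 powr (x / 2 - 1) = 2 powr (x / 2) / (2::real)"
  by (simp add: powr_diff)

lemma A_formula_eq:
  assumes "\<alpha> + \<beta> > -1"
  shows "A_formula \<alpha> \<beta> = \<bar>c_coeff \<alpha> \<beta>\<bar> / (2*pi) * (\<bar>\<alpha> + \<beta>\<bar> * 1 * power_integral (\<lambda>_. 1) (\<alpha> + \<beta>) 1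
    + (\<alpha> + \<beta> + 2) * power_integral (dominant_weight (\<alpha> + \<beta>)) (\<alpha> + \<beta>) 1
    + \<bar>\<alpha> - \<beta>\<bar> * power_integral (dominant_weight (\<alpha> + \<beta>)) (\<alpha> + \<beta>) 1)"
  unfolding A_formula_def two_powr_half weight_int_eq[symmetric] power_integral_one_eq[OF assms]
  by (simp add: field_simps)

lemma B_formula_eq:
  assumes "\<alpha> + \<beta> > -1"
  shows "B_formula \<alpha> \<beta> = \<bar>c_coeff \<alpha> \<beta>\<bar> / (2*pi) * (\<bar>\<beta> - \<alpha>\<bar> * 1 * power_integral (\<lambda>_. 1) (\<alpha> + \<beta>) 1
    + (\<alpha> + \<beta> + 2) * power_integral (dominant_weight (\<alpha> + \<beta>)) (\<alpha> + \<beta>) 1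
    + \<bar>\<beta> - \<alpha>\<bar> * power_integral (dominant_weight (\<alpha> + \<beta>)) (\<alpha> + \<beta>) 1)"
  unfolding B_formula_def two_powr_half weight_int_eq[symmetric] power_integral_one_eq[OF assms]
  by (simp add: field_simps)

lemma C_formula_eq:
  assumes "\<alpha> + \<beta> > -1"
  shows "C_formula \<alpha> \<beta> = \<bar>c_coeff \<alpha> \<beta>\<bar> / (2*pi) * ((\<bar>\<alpha> + 1\<bar> + \<bar>\<beta>\<bar> * 1) * power_integral (\<lambda>_. 1) (\<alpha> + \<beta>) 1)"
  unfolding C_formula_def power_integral_one_eq[OF assms] by simp

lemma weighted_sum_le:
  fixes u v w x y z :: real
  assumes "0 \<le> c" "0 \<le> u" "0 \<le> v" "0 \<le> w" "0 \<le> x" "0 \<le> r" "r \<le> 1" "x \<le> x'" "y \<le> y'" "z \<le> z'"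
  shows "c * (u * r * x + v * y + w * z) \<le> c * (u * 1 * x' + v * y' + w * z')"
  using assms by (intro mult_left_mono add_mono mult_mono) auto

lemma power_integral_one_nonneg: "power_integral (\<lambda>_. 1) a r \<ge> 0"
  unfolding power_integral_def by (intro integral_nonneg_AE AE_I2) auto

lemma abs_trig_le_one:
  assumes "0 \<le> r" "r < 1"
  shows "power_integral abs_cos a r \<le> power_integral (\<lambda>_. 1) a r" "power_integral abs_sin a r \<le> power_integral (\<lambda>_. 1) a r"
  by (intro power_integral_mono assms continuous_intros; simp)+

lemma fun_bdd:
  assumes ab: "\<alpha> + \<beta> > -1"
  shows "bdd_above (A_fun \<alpha> \<beta> ` {0<..<1})" "bdd_above (B_fun \<alpha> \<beta> ` {0<..<1})"
proof -
  let ?J = "power_integral (\<lambda>_. 1) (\<alpha> + \<beta>) 1"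
  have le: "power_integral (\<lambda>_. 1) (\<alpha> + \<beta>) r \<le> ?J" "power_integral abs_cos (\<alpha> + \<beta>) r \<le> ?J" "power_integral abs_sin (\<alpha> + \<beta>) r \<le> ?J"
    if "0 < r" "r < 1" for r
    using power_integral_le_one[OF ab, of r] abs_trig_le_one[of r "\<alpha> + \<beta>"] that by auto
  have "A_fun \<alpha> \<beta> r \<le> \<bar>c_coeff \<alpha> \<beta>\<bar> / (2*pi) * (\<bar>\<alpha> + \<beta>\<bar> * 1 * ?J + (\<alpha> + \<beta> + 2) * ?J + \<bar>\<alpha> - \<beta>\<bar> * ?J)" if "0 < r" "r < 1" for r
    unfolding A_fun_eq using that ab le[OF that] power_integral_one_nonneg by (intro weighted_sum_le) auto
  then show "bdd_above (A_fun \<alpha> \<beta> ` {0<..<1})" by (auto intro!: bdd_aboveI2)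
  have "B_fun \<alpha> \<beta> r \<le> \<bar>c_coeff \<alpha> \<beta>\<bar> / (2*pi) * (\<bar>\<beta> - \<alpha>\<bar> * 1 * ?J + (\<alpha> + \<beta> + 2) * ?J + \<bar>\<beta> - \<alpha>\<bar> * ?J)" if "0 < r" "r < 1" for r
    unfolding B_fun_eq using that ab le[OF that] power_integral_one_nonneg by (intro weighted_sum_le) auto
  then show "bdd_above (B_fun \<alpha> \<beta> ` {0<..<1})" by (auto intro!: bdd_aboveI2)
qed

lemma C_fun_le_formula:
  assumes ab: "\<alpha> + \<beta> > -1" and r: "0 < r" "r < 1"
  shows "C_fun \<alpha> \<beta> r \<le> C_formula \<alpha> \<beta>"
  unfolding C_fun_eq C_formula_eq[OF ab]
  using power_integral_le_one[OF ab, of r] r power_integral_one_nonneg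
  by (intro mult_left_mono mult_mono add_mono) auto

lemma C_const_eq:
  assumes ab: "\<alpha> + \<beta> > -1"
  shows "C_const \<alpha> \<beta> = C_formula \<alpha> \<beta>"
  unfolding C_const_def
proof (rule SUP_eq_left_limit)
  show "(C_fun \<alpha> \<beta> \<longlongrightarrow> C_formula \<alpha> \<beta>) (at_left 1)"
    unfolding C_fun_eq[abs_def] C_formula_eq[OF ab]
    by (intro tendsto_intros abs_trig_tendsto ab)
qed (rule C_fun_le_formula[OF ab])

lemma A_fun_le_formula:
  assumes ab: "\<alpha> + \<beta> \<ge> 0" and r: "0 < r" "r < 1"
  shows "A_fun \<alpha> \<beta> r \<le> A_formula \<alpha> \<beta>" "B_fun \<alpha> \<beta> r \<le> B_formula \<alpha> \<beta>"
proof -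
  have am: "\<alpha> + \<beta> > -1" using ab by simp
  note le = power_integral_le_one[OF am, of r] dominant_weight_bound[OF ab r]
  show "A_fun \<alpha> \<beta> r \<le> A_formula \<alpha> \<beta>"
    unfolding A_fun_eq A_formula_eq[OF am]
    using r ab le power_integral_one_nonneg by (intro weighted_sum_le) auto
  show "B_fun \<alpha> \<beta> r \<le> B_formula \<alpha> \<beta>"
    unfolding B_fun_eq B_formula_eq[OF am]
    using r ab le power_integral_one_nonneg by (intro weighted_sum_le) auto
qed

lemma A_const_le:
  assumes ab: "\<alpha> + \<beta> \<ge> 0"
  shows "A_const \<alpha> \<beta> \<le> A_formula \<alpha> \<beta>" "B_const \<alpha> \<beta> \<le> B_formula \<alpha> \<beta>"
  unfolding A_const_def B_const_def using A_fun_le_formula[OF ab] by (auto intro!: cSUP_least)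

text \<open>The limit of \<open>A_fun\<close> matches the formula because either both weights have
  equal boundary integrals, or \<alpha> = \<beta> removes the sine term while the cosine weight is
  the dominant one.\<close>

lemma A_const_eq:
  assumes "\<alpha> + \<beta> = 0 \<or> \<alpha> + \<beta> = 2 \<or> (\<alpha> = \<beta> \<and> \<alpha> + \<beta> \<ge> 2)"
  shows "A_const \<alpha> \<beta> = A_formula \<alpha> \<beta>"
proof -
  have ab: "\<alpha> + \<beta> \<ge> 0" and am: "\<alpha> + \<beta> > -1" using assms by auto
  have "(A_fun \<alpha> \<beta> \<longlongrightarrow> \<bar>c_coeff \<alpha> \<beta>\<bar> / (2*pi) * (\<bar>\<alpha> + \<beta>\<bar> * 1 * power_integral (\<lambda>_. 1) (\<alpha> + \<beta>) 1
    + (\<alpha> + \<beta> + 2) * power_integral abs_cos (\<alpha> + \<beta>) 1 + \<bar>\<alpha> - \<beta>\<bar> * power_integral abs_sin (\<alpha> + \<beta>) 1)) (at_left 1)"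
    unfolding A_fun_eq[abs_def] by (intro tendsto_intros abs_trig_tendsto am)
  moreover have "(\<alpha> + \<beta> + 2) * power_integral abs_cos (\<alpha> + \<beta>) 1 + \<bar>\<alpha> - \<beta>\<bar> * power_integral abs_sin (\<alpha> + \<beta>) 1 =
    (\<alpha> + \<beta> + 2) * power_integral (dominant_weight (\<alpha> + \<beta>)) (\<alpha> + \<beta>) 1
    + \<bar>\<alpha> - \<beta>\<bar> * power_integral (dominant_weight (\<alpha> + \<beta>)) (\<alpha> + \<beta>) 1"
    using assms cos_sin_boundary[of "\<alpha> + \<beta>"] by (auto simp: dominant_weight_def)
  ultimately have "(A_fun \<alpha> \<beta> \<longlongrightarrow> A_formula \<alpha> \<beta>) (at_left 1)"
    unfolding A_formula_eq[OF am] by (simp only: add.assoc)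
  then show ?thesis
    unfolding A_const_def by (intro SUP_eq_left_limit A_fun_le_formula ab)
qed

text \<open>As for A with the weights exchanged: \<alpha> = \<beta> leaves only the sine term, and
  that weight is the dominant one for sums below 2.\<close>

lemma B_const_eq:
  assumes "\<alpha> + \<beta> = 0 \<or> \<alpha> + \<beta> = 2 \<or> (\<alpha> = \<beta> \<and> 0 \<le> \<alpha> + \<beta> \<and> \<alpha> + \<beta> < 2)"
  shows "B_const \<alpha> \<beta> = B_formula \<alpha> \<beta>"
proof -
  have ab: "\<alpha> + \<beta> \<ge> 0" and am: "\<alpha> + \<beta> > -1" using assms by auto
  have "(B_fun \<alpha> \<beta> \<longlongrightarrow> \<bar>c_coeff \<alpha> \<beta>\<bar> / (2*pi) * (\<bar>\<beta> - \<alpha>\<bar> * 1 * power_integral (\<lambda>_. 1) (\<alpha> + \<beta>) 1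
    + (\<alpha> + \<beta> + 2) * power_integral abs_sin (\<alpha> + \<beta>) 1 + \<bar>\<beta> - \<alpha>\<bar> * power_integral abs_cos (\<alpha> + \<beta>) 1)) (at_left 1)"
    unfolding B_fun_eq[abs_def] by (intro tendsto_intros abs_trig_tendsto am)
  moreover have "(\<alpha> + \<beta> + 2) * power_integral abs_sin (\<alpha> + \<beta>) 1 + \<bar>\<beta> - \<alpha>\<bar> * power_integral abs_cos (\<alpha> + \<beta>) 1 =
    (\<alpha> + \<beta> + 2) * power_integral (dominant_weight (\<alpha> + \<beta>)) (\<alpha> + \<beta>) 1
    + \<bar>\<beta> - \<alpha>\<bar> * power_integral (dominant_weight (\<alpha> + \<beta>)) (\<alpha> + \<beta>) 1"
    using assms cos_sin_boundary[of "\<alpha> + \<beta>"] by (auto simp: dominant_weight_def)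
  ultimately have "(B_fun \<alpha> \<beta> \<longlongrightarrow> B_formula \<alpha> \<beta>) (at_left 1)"
    unfolding B_formula_eq[OF am] by (simp only: add.assoc)
  then show ?thesis
    unfolding B_const_def by (intro SUP_eq_left_limit A_fun_le_formula ab)
qed

section \<open>Norm inequalities for the three derivatives\<close>

lemma Lp_circleD:
  assumes "f \<in> Lp_circle p"
  shows "(\<lambda>t. f (cis t)) \<in> borel_measurable circ" "circle_norm p (\<lambda>t. f (cis t)) < \<infinity>"
  using assms by (auto simp: Lp_circle_def Lp_norm_def)

lemma Lp_circle_integrable:
  assumes "f \<in> Lp_circle p" "p \<ge> 1"
  shows "integrable circ (\<lambda>t. f (cis t))"
  by (rule circ_integrable_of_norm[OF Lp_circleD(1)[OF assms(1)] assms(2) Lp_circleD(2)[OF assms(1)]])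

lemma integral_mean_radial_le:
  assumes f: "f \<in> Lp_circle p" and p: "p \<ge> 1" and r: "0 < r" "r < 1" and ab: "\<alpha> + \<beta> > -1"
  shows "integral_mean p r (d_radial (poisson_integral \<alpha> \<beta> f)) \<le> ennreal (A_fun \<alpha> \<beta> r / (1 - r\<^sup>2)) * Lp_norm p f"
proof -
  have "integral_mean p r (d_radial (poisson_integral \<alpha> \<beta> f)) = circle_norm p (circ_conv (radial_kernel \<alpha> \<beta> r) (\<lambda>t. f (cis t)))"
    unfolding integral_mean_def by (simp add: d_radial_conv[OF Lp_circle_integrable[OF f p] r])
  also have "\<dots> \<le> ennreal (circ_mean (radial_kernel \<alpha> \<beta> r)) * circle_norm p (\<lambda>t. f (cis t))"
    by (intro circ_conv_norm_le continuous_on_kernels r Lp_circleD[OF f] p)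
  also have "\<dots> \<le> ennreal (A_fun \<alpha> \<beta> r / (1 - r\<^sup>2)) * Lp_norm p f"
    unfolding Lp_norm_def by (intro mult_right_mono ennreal_leI circ_mean_radial_le r ab) simp
  finally show ?thesis .
qed

lemma integral_mean_angular_le:
  assumes f: "f \<in> Lp_circle p" and p: "p \<ge> 1" and r: "0 < r" "r < 1" and ab: "\<alpha> + \<beta> > -1"
  shows "integral_mean p r (d_angular (poisson_integral \<alpha> \<beta> f)) \<le> ennreal (B_fun \<alpha> \<beta> r / (1 - r\<^sup>2)) * Lp_norm p f"
proof -
  have "integral_mean p r (d_angular (poisson_integral \<alpha> \<beta> f)) = circle_norm p (circ_conv (angular_kernel \<alpha> \<beta> r) (\<lambda>t. f (cis t)))"
    unfolding integral_mean_def by (simp add: d_angular_conv[OF Lp_circle_integrable[OF f p] r])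
  also have "\<dots> \<le> ennreal (circ_mean (angular_kernel \<alpha> \<beta> r)) * circle_norm p (\<lambda>t. f (cis t))"
    by (intro circ_conv_norm_le continuous_on_kernels r Lp_circleD[OF f] p)
  also have "\<dots> \<le> ennreal (B_fun \<alpha> \<beta> r / (1 - r\<^sup>2)) * Lp_norm p f"
    unfolding Lp_norm_def by (intro mult_right_mono ennreal_leI circ_mean_angular_le r ab) simp
  finally show ?thesis .
qed

lemma integral_mean_wirtinger_le:
  assumes f: "f \<in> Lp_circle p" and p: "p \<ge> 1" and r: "0 < r" "r < 1"
  shows "integral_mean p r (d_wirtinger (poisson_integral \<alpha> \<beta> f)) \<le> ennreal (C_fun \<alpha> \<beta> r / (1 - r\<^sup>2)) * Lp_norm p f"
proof -
  have n: "circle_norm p (\<lambda>t. cis (- t) * f (cis t)) = circle_norm p (\<lambda>t. f (cis t))"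
    unfolding circle_norm_def norm_mult norm_cis mult_1 ..
  have "(\<lambda>t. cis (- t)) \<in> borel_measurable circ"
    by (intro borel_measurable_integrable circ_integrable_continuous continuous_on_cis continuous_intros)
  then have m: "(\<lambda>t. cis (- t) * f (cis t)) \<in> borel_measurable circ"
    using Lp_circleD(1)[OF f] by (rule borel_measurable_times)
  have "integral_mean p r (d_wirtinger (poisson_integral \<alpha> \<beta> f)) = circle_norm p (circ_conv (wirtinger_kernel \<alpha> \<beta> r) (\<lambda>t. cis (- t) * f (cis t)))"
    unfolding integral_mean_def by (simp add: d_wirtinger_conv[OF Lp_circle_integrable[OF f p] r])
  also have "\<dots> \<le> ennreal (circ_mean (wirtinger_kernel \<alpha> \<beta> r)) * circle_norm p (\<lambda>t. f (cis t))"
    unfolding n[symmetric] using Lp_circleD(2)[OF f] n by (intro circ_conv_norm_le continuous_on_kernels r m p) simp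
  also have "\<dots> \<le> ennreal (C_fun \<alpha> \<beta> r / (1 - r\<^sup>2)) * Lp_norm p f"
    unfolding Lp_norm_def by (intro mult_right_mono ennreal_leI circ_mean_wirtinger_le r) simp
  finally show ?thesis .
qed

text \<open>The angles where |g| is at most the essential supremum form a closed set containing
  almost every angle, hence the whole closed interval; the endpoint 0 is reached by taking a
  closure.\<close>

lemma esssup_continuous_ge:
  assumes g: "continuous_on UNIV g"
  shows "ennreal (cmod (g 0)) \<le> circle_norm \<infinity> g"
proof (rule ccontr)
  assume "\<not> ?thesis"
  then have less: "esssup circ (\<lambda>t. ennreal (cmod (g t))) < ennreal (cmod (g 0))"
    by (simp add: circle_norm_def)
  obtain E where E: "esssup circ (\<lambda>t. ennreal (cmod (g t))) = ennreal E" "E \<ge> 0"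
  proof (cases "esssup circ (\<lambda>t. ennreal (cmod (g t)))")
    case top
    then show ?thesis using less by simp
  qed (use that in blast)
  define C where "C = {t. cmod (g t) \<le> E}"
  have C: "closed C" unfolding C_def
    by (intro closed_Collect_le continuous_on_norm g continuous_on_const)
  have "AE t in circ. ennreal (cmod (g t)) \<le> ennreal E"
    using esssup_AE[of "\<lambda>t. ennreal (cmod (g t))" circ] E by simp
  then have "AE t in circ. t \<in> C"
    by eventually_elim (use E in \<open>simp add: C_def\<close>)
  then have "AE t in lebesgue. t \<in> {0..2*pi} \<longrightarrow> t \<in> C"
    by (subst (asm) AE_restrict_space_iff) simp_all
  then have ae: "AE t \<in> {0<..<2*pi} in lebesgue. t \<in> C"
    by eventually_elim auto
  have "{0<..<2*pi} \<subseteq> C"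
    using mem_closed_if_AE_lebesgue_open[OF _ C ae] by auto
  then have "closure {0<..<2*pi} \<subseteq> C" using C by (rule closure_minimal)
  then have "0 \<in> C" by (auto simp: closure_greaterThanLessThan)
  then show False using less E by (simp add: C_def ennreal_less_iff)
qed

text \<open>For a real kernel, the unimodular function \<open>sgn k\<close>, reflected, turns the convolution at the angle \<open>0\<close>
  into the \<open>L\<^sup>1\<close> norm of \<open>k\<close>.\<close>

definition sign_data :: "(complex \<Rightarrow> complex) \<Rightarrow> complex \<Rightarrow> complex" where
  "sign_data k z = of_real (sgn (Re (k (cnj z))))"

lemma sign_data_Lp:
  assumes k: "continuous_on (sphere 0 1) k"
  shows "sign_data k \<in> Lp_circle \<infinity>" "Lp_norm \<infinity> (sign_data k) \<le> 1"
proof -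
  have "continuous_on UNIV (\<lambda>t. k (cis (- t)))"
    by (rule continuous_on_cis_comp[OF k]) (intro continuous_intros)
  then have "(\<lambda>t. k (cis (- t))) \<in> borel_measurable circ"
    by (intro borel_measurable_integrable circ_integrable_continuous)
  then have m: "(\<lambda>t. sign_data k (cis t)) \<in> borel_measurable circ"
    unfolding sign_data_def cis_cnj by measurable
  have me: "(\<lambda>t. ennreal (cmod (sign_data k (cis t)))) \<in> borel_measurable circ"
    using m by measurable
  have "cmod (sign_data k z) \<le> 1" for z
    by (simp add: sign_data_def sgn_real_def)
  then show n: "Lp_norm \<infinity> (sign_data k) \<le> 1"
    unfolding Lp_norm_def circle_norm_def by (auto intro!: esssup_I me)
  then show "sign_data k \<in> Lp_circle \<infinity>"
    using m by (auto simp: Lp_circle_def intro: le_less_trans)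
qed

lemma circ_conv_sign_data:
  assumes k: "continuous_on (sphere 0 1) k" and real: "\<And>w. cmod w = 1 \<Longrightarrow> Im (k w) = 0"
  shows "circ_conv k (\<lambda>t. sign_data k (cis t)) 0 = of_real (circ_mean k)"
proof -
  have "k (cis (0 - t)) * sign_data k (cis t) = of_real (cmod (k (cis (0 - t))))" for t
  proof -
    have "k (cis (- t)) = of_real (Re (k (cis (- t))))"
      using real[of "cis (- t)"] by (simp add: complex_eq_iff)
    then have 1: "k (cis (- t)) * sign_data k (cis t) = of_real (Re (k (cis (- t))) * sgn (Re (k (cis (- t)))))"
      unfolding sign_data_def cis_cnj by (metis of_real_mult)
    have "cmod (k (cis (- t))) = \<bar>Re (k (cis (- t)))\<bar>"
      using real[of "cis (- t)"] by (simp add: cmod_eq_Re)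
    then show ?thesis using 1 by (simp add: abs_sgn)
  qed
  then have "circ_conv k (\<lambda>t. sign_data k (cis t)) 0 = of_real (1 / (2*pi)) * of_real (LINT t|circ. cmod (k (cis (0 - t))))"
    unfolding circ_conv_def by (simp add: integral_complex_of_real)
  then show ?thesis
    unfolding circ_mean_shift(1)[OF k] by simp
qed

section \<open>The classical case \<alpha> = \<beta> = 0 and sharpness\<close>

lemma poisson_classical_cnj: "cnj (poisson_dz 0 0 z) = poisson_dzbar 0 0 z"
  by (simp add: poisson_dz_def poisson_dzbar_def poisson_kernel_def mult.commute)

lemma kernels_classical_real:
  "Im (radial_kernel 0 0 r w) = 0" "Im (angular_kernel 0 0 r w) = 0"
proof -
  have "radial_kernel 0 0 r w = poisson_dz 0 0 (of_real r * w) * w + cnj (poisson_dz 0 0 (of_real r * w) * w)"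
    by (simp add: radial_kernel_def poisson_classical_cnj)
  then show "Im (radial_kernel 0 0 r w) = 0" by (simp only: complex_add_cnj Im_complex_of_real)
  have "angular_kernel 0 0 r w = \<i> * of_real r * (poisson_dz 0 0 (of_real r * w) * w - cnj (poisson_dz 0 0 (of_real r * w) * w))"
    by (simp add: angular_kernel_def poisson_classical_cnj)
  then show "Im (angular_kernel 0 0 r w) = 0" by (simp only: complex_diff_cnj) simp
qed

lemma c_coeff_0 [simp]: "c_coeff 0 0 = 1"
  by (simp add: c_coeff_def)

lemma classical_funs:
  assumes r: "0 < r" "r < 1"
  shows "A_fun 0 0 r = 4 / pi" "B_fun 0 0 r = 4 / pi"
proof -
  have r0: "0 \<le> r" using r by simp
  have "(1 + r)\<^sup>2 - (1 - r)\<^sup>2 = 4 * r" by (simp add: power2_eq_square algebra_simps)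
  then have s: "power_integral abs_sin 0 r = 4"
    using power_integral_sin[OF r, of 0] r by (simp add: powr_numeral)
  have "power_integral abs_cos 0 r = power_integral abs_sin 0 r"
    by (rule cos_sin_equal) (use r in auto)
  then show "A_fun 0 0 r = 4 / pi" "B_fun 0 0 r = 4 / pi"
    using s unfolding A_fun_eq B_fun_eq by simp_all
qed

lemma classical_consts: "A_const 0 0 = 4 / pi" "B_const 0 0 = 4 / pi" "C_const 0 0 = 1"
proof -
  have "(SUP r\<in>{0<..<1::real}. 4 / pi) = 4 / pi" by (intro cSUP_const) auto
  then show "A_const 0 0 = 4 / pi" "B_const 0 0 = 4 / pi"
    unfolding A_const_def B_const_def by (simp_all add: classical_funs cong: SUP_cong_simp)
  show "C_const 0 0 = 1" by (simp add: C_const_eq C_formula_def)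
qed

text \<open>At the angle 0 the sign data produce the full mean of the kernel, while their norm is at
  most 1. The operator \<open>D\<close> is left abstract so that the radial and angular derivatives
  share the argument.\<close>

lemma sign_data_integral_mean:
  assumes k: "continuous_on (sphere 0 1) k" and real: "\<And>w. cmod w = 1 \<Longrightarrow> Im (k w) = 0"
    and D: "D (poisson_integral 0 0 (sign_data k)) r = circ_conv k (\<lambda>t. sign_data k (cis t))"
    and K: "K < (1 - r\<^sup>2) * circ_mean k" and r: "0 < r" "r < 1" and pos: "0 < circ_mean k"
  shows "\<not> integral_mean \<infinity> r (D (poisson_integral 0 0 (sign_data k))) \<le> ennreal (K / (1 - r\<^sup>2)) * Lp_norm \<infinity> (sign_data k)"
proof -
  have q: "1 - r\<^sup>2 > 0" by (rule one_minus_sq_pos[OF r])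
  have i: "integrable circ (\<lambda>t. sign_data k (cis t))"
    by (rule Lp_circle_integrable[OF sign_data_Lp(1)[OF k]]) simp
  have "ennreal (K / (1 - r\<^sup>2)) * Lp_norm \<infinity> (sign_data k) \<le> ennreal (K / (1 - r\<^sup>2)) * 1"
    by (intro mult_left_mono sign_data_Lp k) simp
  \<comment> \<open>\<open>K\<close> may be negative; \<open>ennreal\<close> then gives 0, and
    positivity of the mean keeps the inequality strict.\<close>
  also have "\<dots> < ennreal (circ_mean k)"
    using K q pos by (auto simp: field_simps intro!: ennreal_lessI)
  also have "\<dots> = ennreal (cmod (circ_conv k (\<lambda>t. sign_data k (cis t)) 0))"
    using circ_conv_sign_data[of k] k real pos by simp
  also have "\<dots> \<le> integral_mean \<infinity> r (D (poisson_integral 0 0 (sign_data k)))"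
    unfolding integral_mean_def D by (rule esssup_continuous_ge[OF continuous_on_circ_conv[OF k i]])
  finally show ?thesis by simp
qed

lemma radial_sharp: "asymptotically_sharp {1..} d_radial A_const"
  unfolding asymptotically_sharp_def
proof (intro allI impI notI)
  fix K :: real assume K: "K < A_const 0 0"
  assume all: "\<forall>p\<in>{1..}. \<forall>f\<in>Lp_circle p. \<forall>r\<in>{0<..<1}.
    integral_mean p r (d_radial (poisson_integral 0 0 f)) \<le> ennreal (K / (1 - r\<^sup>2)) * Lp_norm p f"
  \<comment> \<open>Any radius would do: the radial mean equals (4 / pi) / (1 - r^2) at every
    r.\<close>
  define r :: real where "r = 1/2"
  have r: "0 < r" "r < 1" by (simp_all add: r_def)
  let ?k = "radial_kernel 0 0 r"
  note k = continuous_on_kernels(1)[OF r, of 0 0]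
  have q: "1 - r\<^sup>2 > 0" by (rule one_minus_sq_pos[OF r])
  have m: "circ_mean ?k = (4 / pi) / (1 - r\<^sup>2)"
    unfolding circ_mean_classical[OF r] classical_funs[OF r] ..
  have Km: "(1 - r\<^sup>2) * circ_mean ?k = 4 / pi" "circ_mean ?k > 0"
  proof -
    have q': "1 - r\<^sup>2 \<noteq> 0" using q by (simp del: right_minus_eq)
    show "(1 - r\<^sup>2) * circ_mean ?k = 4 / pi"
    proof -
      have "x * (y / x) = y" if "x \<noteq> 0" for x y :: real using that by simp
      from this[OF q'] show ?thesis unfolding m .
    qed
    show "circ_mean ?k > 0" unfolding m using q by simp
  qed
  have i: "integrable circ (\<lambda>t. sign_data ?k (cis t))"
    by (rule Lp_circle_integrable[OF sign_data_Lp(1)[OF k]]) simp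
  have "\<not> integral_mean \<infinity> r (d_radial (poisson_integral 0 0 (sign_data ?k))) \<le> ennreal (K / (1 - r\<^sup>2)) * Lp_norm \<infinity> (sign_data ?k)"
    by (rule sign_data_integral_mean[where k = ?k and D = d_radial, OF k _ d_radial_conv[OF i r] _ r])
      (use K Km in \<open>simp_all add: classical_consts kernels_classical_real\<close>)
  then show False using all sign_data_Lp(1)[OF k] r by force
qed

lemma angular_sharp: "asymptotically_sharp {1..} d_angular B_const"
  unfolding asymptotically_sharp_def
proof (intro allI impI notI)
  fix K :: real assume "K < B_const 0 0"
  then have K: "K * pi / 4 < 1" by (simp add: classical_consts field_simps)
  assume all: "\<forall>p\<in>{1..}. \<forall>f\<in>Lp_circle p. \<forall>r\<in>{0<..<1}.
    integral_mean p r (d_angular (poisson_integral 0 0 f)) \<le> ennreal (K / (1 - r\<^sup>2)) * Lp_norm p f"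
  \<comment> \<open>The angular mean is only r times (4 / pi) / (1 - r^2), so \<open>r\<close> has
    to exceed K pi / 4.\<close>
  obtain r where "max 0 (K * pi / 4) < r" "r < 1" using dense[of "max 0 (K * pi / 4)" 1] K by auto
  then have r: "0 < r" "r < 1" and Kr: "K < r * (4 / pi)" by (auto simp: field_simps)
  let ?k = "angular_kernel 0 0 r"
  note k = continuous_on_kernels(2)[OF r, of 0 0]
  have q: "1 - r\<^sup>2 > 0" by (rule one_minus_sq_pos[OF r])
  have m: "circ_mean ?k = r * (4 / pi) / (1 - r\<^sup>2)"
    unfolding circ_mean_classical[OF r] classical_funs[OF r] ..
  have i: "integrable circ (\<lambda>t. sign_data ?k (cis t))"
    by (rule Lp_circle_integrable[OF sign_data_Lp(1)[OF k]]) simp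
  have "\<not> integral_mean \<infinity> r (d_angular (poisson_integral 0 0 (sign_data ?k))) \<le> ennreal (K / (1 - r\<^sup>2)) * Lp_norm \<infinity> (sign_data ?k)"
    by (rule sign_data_integral_mean[where k = ?k and D = d_angular, OF k _ d_angular_conv[OF i r] _ r])
      (use Kr r q in \<open>simp_all add: m kernels_classical_real\<close>)
  then show False using all sign_data_Lp(1)[OF k] r by force
qed

text \<open>The classical kernel is 1 / (1 - z) + cnj z / (1 - cnj z), with z-derivative 1 / (1 -
  z)^2. The computation finds this through 1 - |z|^2 - cnj z (1 - z) = 1 - cnj z.\<close>

lemma wirtinger_kernel_classical:
  assumes r: "0 < r" "r < 1" and w: "cmod w = 1"
  shows "wirtinger_kernel 0 0 r w = 1 / (1 - of_real r * w)\<^sup>2"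
proof -
  define z where "z = of_real r * w"
  have z: "cmod z < 1" using r w by (simp add: z_def norm_mult)
  have n: "1 - z \<noteq> 0" "1 - cnj z \<noteq> 0" using disc_notin_nonpos[OF z] disc_notin_nonpos[of "cnj z"] z by auto
  define Q where "Q = complex_of_real (1 - (cmod z)\<^sup>2)"
  have Q0: "Q \<noteq> 0" unfolding Q_def of_real_eq_0_iff using disc_sq_pos[OF z] by simp
  have Q: "Q = 1 - z * cnj z" by (simp only: Q_def of_real_diff of_real_1 complex_norm_square)
  have e: "Q / (a * b) * (1 / a - c / Q) = (Q - c * a) / (a * a * b)" if "a \<noteq> 0" "b \<noteq> 0" "Q \<noteq> 0" for a b c Q :: complex
    using that by (simp add: divide_simps)
  have "poisson_dz 0 0 z = Q / ((1 - z) * (1 - cnj z)) * (1 / (1 - z) - cnj z / Q)"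
    using disc_sq_pos[OF z] n by (simp add: poisson_dz_def poisson_kernel_def Q_def)
  also have "\<dots> = (Q - cnj z * (1 - z)) / ((1 - z) * (1 - z) * (1 - cnj z))"
    using n Q0 by (rule e)
  also have "Q - cnj z * (1 - z) = 1 - cnj z" by (simp add: Q algebra_simps)
  finally show ?thesis
    unfolding wirtinger_kernel_def z_def[symmetric] using n by (simp add: power2_eq_square)
qed

text \<open>The mean value property of the holomorphic function 1 / (1 - z)^2, whose value at 0 is
  1, obtained from an explicit antiderivative.\<close>

lemma integral_wirtinger_kernel_classical:
  assumes r: "0 < r" "r < 1"
  shows "(LINT t|circ. wirtinger_kernel 0 0 r (cis t)) = of_real (2*pi)"
proof -
  define Z where "Z = (\<lambda>t. of_real r * cis t)"
  have n: "1 - Z t \<noteq> 0" "1 - Z t \<notin> \<real>\<^sub>\<le>\<^sub>0" for t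
    using disc_notin_nonpos[of "Z t"] r by (auto simp: Z_def norm_mult)
  \<comment> \<open>Termwise antiderivative of 1 + Z / (1 - Z) + Z / (1 - Z)^2 = 1 / (1 - Z)^2,
    using that Z has derivative i Z; only the first term of \<open>F\<close> is not
    periodic.\<close>
  define F where "F = (\<lambda>t. of_real t + \<i> * Ln (1 - Z t) - \<i> / (1 - Z t))"
  have "(LINT t|circ. wirtinger_kernel 0 0 r (cis t)) = F (2*pi) - F 0"
  proof (rule circ_integral_FTC)
    show "continuous_on {0..2*pi} (\<lambda>t. wirtinger_kernel 0 0 r (cis t))"
      by (rule continuous_on_cis_comp[OF continuous_on_kernels(3)[OF r]]) (intro continuous_intros)
    fix t
    have dZ: "((\<lambda>t. 1 - Z t) has_vector_derivative - (\<i> * Z t)) (at t within {0..2*pi})"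
      unfolding Z_def cis_conv_exp by (auto intro!: derivative_eq_intros has_vector_derivative_real_field)
    have dG: "((\<lambda>u. \<i> * Ln u - \<i> / u) has_field_derivative (\<i> / (1 - Z t) + \<i> / (1 - Z t)\<^sup>2)) (at (1 - Z t))"
      using n[of t] by (auto intro!: derivative_eq_intros simp: field_simps power2_eq_square)
    have "(((\<lambda>u. \<i> * Ln u - \<i> / u) \<circ> (\<lambda>t. 1 - Z t)) has_vector_derivative - (\<i> * Z t) * (\<i> / (1 - Z t) + \<i> / (1 - Z t)\<^sup>2)) (at t within {0..2*pi})"
      by (rule field_vector_diff_chain_within[OF dZ has_field_derivative_at_within[OF dG]])
    from has_vector_derivative_add[OF has_vector_derivative_of_real[OF DERIV_ident] this]
    have "(F has_vector_derivative (1 + - (\<i> * Z t) * (\<i> / (1 - Z t) + \<i> / (1 - Z t)\<^sup>2))) (at t within {0..2*pi})"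
      by (simp add: F_def o_def add_diff_eq)
    also have "1 + - (\<i> * Z t) * (\<i> / (1 - Z t) + \<i> / (1 - Z t)\<^sup>2) = 1 / (1 - Z t)\<^sup>2"
    proof -
      have "- (\<i> * Z t) * (\<i> / (1 - Z t) + \<i> / (1 - Z t)\<^sup>2) = Z t / (1 - Z t) + Z t / (1 - Z t)\<^sup>2"
      proof -
        have "(\<i> * x) * (\<i> / y) = (\<i> * \<i>) * (x / y)" for x y :: complex
          by (simp only: times_divide_eq_right times_divide_eq_left mult_ac)
        then have "- (\<i> * x) * (\<i> / y) = x / y" for x y :: complex
          by simp
        then show ?thesis unfolding distrib_left by (simp only:)
      qed
      moreover have "1 + ((1 - b) / b + (1 - b) / b\<^sup>2) = 1 / b\<^sup>2" if "b \<noteq> 0" for b :: complex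
        using that by (simp add: divide_simps) (simp add: power2_eq_square algebra_simps)
      from this[OF n(1)[of t]] have "1 + (Z t / (1 - Z t) + Z t / (1 - Z t)\<^sup>2) = 1 / (1 - Z t)\<^sup>2"
        by (simp only: diff_diff_eq2 add_diff_cancel_left')
      ultimately show ?thesis by (simp only:)
    qed
    finally show "(F has_vector_derivative wirtinger_kernel 0 0 r (cis t)) (at t within {0..2*pi})"
      by (simp add: wirtinger_kernel_classical[OF r] Z_def)
  qed simp
  then show ?thesis by (simp add: F_def Z_def)
qed

lemma circle_norm_unimodular:
  assumes "\<And>t. cmod (g t) = 1"
  shows "circle_norm p g = 1"
proof (cases "p = \<infinity>")
  case True
  have "esssup circ (\<lambda>t. 1 :: ennreal) = 1"
    by (rule esssup_const) (simp add: emeasure_restrict_space)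
  then show ?thesis using True assms by (simp add: circle_norm_def)
next
  case False
  have "(\<integral>\<^sup>+ t. ennreal 1 \<partial>circ) = ennreal (2*pi)"
    by (simp add: emeasure_restrict_space)
  then show ?thesis using False assms by (simp add: circle_norm_def Let_def)
qed

text \<open>For f(z) = z the data cancel the factor \<open>cis (- t)\<close> and leave the bare
  kernel, of mean 1, so the Wirtinger derivative is identically 1 on the circle. It and f then have
  norm 1 for every exponent, hence the singleton \<open>{p}\<close>.\<close>

lemma wirtinger_sharp:
  assumes p: "p \<ge> 1"
  shows "asymptotically_sharp {p} d_wirtinger C_const"
  unfolding asymptotically_sharp_def
proof (intro allI impI notI)
  fix K :: real assume "K < C_const 0 0"
  then have K: "K < 1" by (simp add: classical_consts)
  assume all: "\<forall>p\<in>{p}. \<forall>f\<in>Lp_circle p. \<forall>r\<in>{0<..<1}.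
    integral_mean p r (d_wirtinger (poisson_integral 0 0 f)) \<le> ennreal (K / (1 - r\<^sup>2)) * Lp_norm p f"
  \<comment> \<open>The inequality would read 1 \<le> K / (1 - r^2), so any r with r^2 < 1 - K
    refutes it.\<close>
  obtain r where r: "0 < r" "r < min 1 (1 - K)" using dense[of 0 "min 1 (1 - K)"] K by auto
  then have r1: "r < 1" by simp
  then have "r * r < 1 * r" using r(1) by (rule mult_strict_right_mono)
  then have "r\<^sup>2 < 1 - K" using r(2) by (simp add: power2_eq_square)
  then have Kr: "K / (1 - r\<^sup>2) < 1"
    using one_minus_sq_pos[OF r(1) r1] by simp
  have N: "Lp_norm p (\<lambda>z. z) = 1" unfolding Lp_norm_def by (rule circle_norm_unimodular) simp
  have "(\<lambda>t. cis t) \<in> borel_measurable circ"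
    by (intro borel_measurable_integrable circ_integrable_continuous continuous_on_cis continuous_intros)
  then have f: "(\<lambda>z. z) \<in> Lp_circle p" using N by (simp add: Lp_circle_def)
  have "d_wirtinger (poisson_integral 0 0 (\<lambda>z. z)) r \<theta> = 1" for \<theta>
  proof -
    have c: "continuous_on UNIV (\<lambda>t. wirtinger_kernel 0 0 r (cis t))"
      by (rule continuous_on_cis_comp[OF continuous_on_kernels(3)[OF r(1) r1]]) (intro continuous_intros)
    have per: "wirtinger_kernel 0 0 r (cis (t + 2*pi)) = wirtinger_kernel 0 0 r (cis t)" for t
      by (simp add: cis_mult[symmetric])
    have "d_wirtinger (poisson_integral 0 0 (\<lambda>z. z)) r \<theta> = of_real (1 / (2*pi)) * (LINT t|circ. wirtinger_kernel 0 0 r (cis (\<theta> - t)))"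
      unfolding d_wirtinger_conv[OF Lp_circle_integrable[OF f p] r(1) r1] circ_conv_def by (simp add: cis_mult)
    then show ?thesis
      unfolding periodic_integral(2)[OF c per] integral_wirtinger_kernel_classical[OF r(1) r1] by simp
  qed
  then have "integral_mean p r (d_wirtinger (poisson_integral 0 0 (\<lambda>z. z))) = 1"
    unfolding integral_mean_def by (intro circle_norm_unimodular) simp
  then have "1 \<le> ennreal (K / (1 - r\<^sup>2))"
    using all f r(1) r1 N by force
  moreover have "ennreal (K / (1 - r\<^sup>2)) < ennreal 1" using Kr by (intro ennreal_lessI) auto
  ultimately show False by (simp add: not_le[symmetric])
qed

unused_thms

theorem theorem3p4:
  fixes \<alpha> \<beta> :: real and p :: ennreal and f u :: "complex \<Rightarrow> complex"
  assumes "\<not> (\<alpha> \<in> \<int> \<and> \<alpha> < 0)" and "\<not> (\<beta> \<in> \<int> \<and> \<beta> < 0)" and "\<alpha> + \<beta> > -1"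
    and "p \<ge> 1" and "f \<in> Lp_circle p"
    and "u = poisson_integral \<alpha> \<beta> f"
  shows
    "(bdd_above (A_fun \<alpha> \<beta> ` {0<..<1}) \<and> bdd_above (B_fun \<alpha> \<beta> ` {0<..<1})
       \<and> bdd_above (C_fun \<alpha> \<beta> ` {0<..<1})) \<and>
     (\<alpha> + \<beta> = 0 \<or> \<alpha> + \<beta> = 2 \<or> (\<alpha> = \<beta> \<and> \<alpha> + \<beta> \<ge> 2)
       \<longrightarrow> A_const \<alpha> \<beta> = A_formula \<alpha> \<beta>) \<and>
     (\<alpha> + \<beta> = 0 \<or> \<alpha> + \<beta> = 2 \<or> (\<alpha> = \<beta> \<and> 0 \<le> \<alpha> + \<beta> \<and> \<alpha> + \<beta> < 2)
       \<longrightarrow> B_const \<alpha> \<beta> = B_formula \<alpha> \<beta>) \<and>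
     (\<alpha> + \<beta> \<ge> 0 \<longrightarrow> A_const \<alpha> \<beta> \<le> A_formula \<alpha> \<beta> \<and> B_const \<alpha> \<beta> \<le> B_formula \<alpha> \<beta>) \<and>
     C_const \<alpha> \<beta> = C_formula \<alpha> \<beta> \<and>
     ((\<forall>r\<in>{0<..<1}.
         integral_mean p r (d_radial u) \<le> ennreal (A_fun \<alpha> \<beta> r / (1 - r\<^sup>2)) * Lp_norm p f \<and>
         ennreal (A_fun \<alpha> \<beta> r / (1 - r\<^sup>2)) * Lp_norm p f
           \<le> ennreal (A_const \<alpha> \<beta> / (1 - r\<^sup>2)) * Lp_norm p f) \<and>
      asymptotically_sharp {1..} d_radial A_const) \<and>
     ((\<forall>r\<in>{0<..<1}.
         integral_mean p r (d_angular u) \<le> ennreal (B_fun \<alpha> \<beta> r / (1 - r\<^sup>2)) * Lp_norm p f \<and>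
         ennreal (B_fun \<alpha> \<beta> r / (1 - r\<^sup>2)) * Lp_norm p f
           \<le> ennreal (B_const \<alpha> \<beta> / (1 - r\<^sup>2)) * Lp_norm p f) \<and>
      asymptotically_sharp {1..} d_angular B_const) \<and>
     ((\<forall>r\<in>{0<..<1}.
         integral_mean p r (d_wirtinger u) \<le> ennreal (C_fun \<alpha> \<beta> r / (1 - r\<^sup>2)) * Lp_norm p f \<and>
         ennreal (C_fun \<alpha> \<beta> r / (1 - r\<^sup>2)) * Lp_norm p f
           \<le> ennreal (C_const \<alpha> \<beta> / (1 - r\<^sup>2)) * Lp_norm p f) \<and>
      asymptotically_sharp {p} d_wirtinger C_const)"
proof -
  note am = assms(3) and p = assms(4) and f = assms(5)
  have C_bdd: "bdd_above (C_fun \<alpha> \<beta> ` {0<..<1})"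
    using C_fun_le_formula[OF am] by (auto intro!: bdd_aboveI2)
  note bdd = fun_bdd[OF am] C_bdd
  have mono: "ennreal (x / (1 - r\<^sup>2)) * Lp_norm p f \<le> ennreal (y / (1 - r\<^sup>2)) * Lp_norm p f"
    if "x \<le> y" "r \<in> {0<..<1}" for x y r :: real
    using that one_minus_sq_pos[of r] by (intro mult_right_mono ennreal_leI divide_right_mono) auto
  \<comment> \<open>Boundedness above is what places each value below the real-valued
    \<open>SUP\<close>.\<close>
  have le: "A_fun \<alpha> \<beta> r \<le> A_const \<alpha> \<beta>" "B_fun \<alpha> \<beta> r \<le> B_const \<alpha> \<beta>" "C_fun \<alpha> \<beta> r \<le> C_const \<alpha> \<beta>"
    if "r \<in> {0<..<1}" for r
    unfolding A_const_def B_const_def C_const_def using that bdd by (auto intro: cSUP_upper)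
  have means: "integral_mean p r (d_radial u) \<le> ennreal (A_fun \<alpha> \<beta> r / (1 - r\<^sup>2)) * Lp_norm p f"
    "integral_mean p r (d_angular u) \<le> ennreal (B_fun \<alpha> \<beta> r / (1 - r\<^sup>2)) * Lp_norm p f"
    "integral_mean p r (d_wirtinger u) \<le> ennreal (C_fun \<alpha> \<beta> r / (1 - r\<^sup>2)) * Lp_norm p f"
    if "r \<in> {0<..<1}" for r
    using that unfolding assms(6)
    by (auto intro!: integral_mean_radial_le integral_mean_angular_le integral_mean_wirtinger_le f p am)
  show ?thesis
    by (intro conjI impI ballI bdd A_const_eq B_const_eq C_const_eq[OF am] A_const_le means mono le
        radial_sharp angular_sharp wirtinger_sharp p)
qed

end
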